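(* Let $(\mathcal{A}, \mathbb{E}, \mathbb{F}, \varepsilon)$ be a $\mathcal{B}$-$\mathcal{B}$-non-commutative probability space with a pair of $(\mathcal{B}, \mathcal{D})$-valued expectations. Let $m,n\ge1$ with $m<n$ and let $0 = k(0) < k(1) < \cdots < k(m) = n$ be integers. For $\chi:\{1,\dots,m\}\to\{\ell,r\}$ define $\widehat{\chi}:\{1,\dots,n\}\to\{\ell,r\}$ by $\widehat{\chi}(q)=\chi(p_q)$, where $p_q$ is the unique element of $\{1,\dots,m\}$ with $k(p_q-1)<q\le k(p_q)$, and let $\widehat{0_\chi}$ be the partition of $\{1,\dots,n\}$ with blocks $\{k(p-1)+1,\dots,k(p)\}$, $1\le p\le m$. Then $$\mathcal{K}_{1_\chi}\left(Z_1\cdots Z_{k(1)}, Z_{k(1) + 1}\cdots Z_{k(2)}, \dots, Z_{k(m - 1) + 1}\cdots Z_{k(m)}\right) = \sum_{\substack{\sigma \in \mathcal{BNC}(\widehat{\chi})\\\sigma \vee \widehat{0_\chi} = 1_{\widehat{\chi}}}}\mathcal{K}_\sigma(Z_1, \dots, Z_n)$$ for all $\chi: \{1, \dots, m\} \to \{\ell, r\}$ and $Z_k \in \mathcal{A}_{\widehat{\chi}(k)}$, where $\pi\vee\sigma$ denotes the smallest partition in $\mathcal{BNC}(\widehat{\chi})$ greater than $\pi$ and $\sigma$.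
   Context: All algebras are over $\mathbb{C}$. Spaces. A $\mathcal{B}$-$\mathcal{B}$-non-commutative probability space with a pair of $(\mathcal{B},\mathcal{D})$-valued expectations is a quadruple $(\mathcal{A},\mathbb{E},\mathbb{F},\varepsilon)$ where $\mathcal{A},\mathcal{B},\mathcal{D}$ are unital algebras with $1:=1_{\mathcal{D}}\in\mathcal{B}\subset\mathcal{D}$, $\varepsilon:\mathcal{B}\otimes\mathcal{B}^{\mathrm{op}}\to\mathcal{A}$ is a unital homomorphism whose restrictions to $\mathcal{B}\otimes 1$ and $1\otimes\mathcal{B}^{\mathrm{op}}$ are injective, and $\mathbb{E}:\mathcal{A}\to\mathcal{B}$, $\mathbb{F}:\mathcal{A}\to\mathcal{D}$ are unital linear maps such that, writing $L_b=\varepsilon(b\otimes 1)$ and $R_b=\varepsilon(1\otimes b)$, for all $b_1,b_2,b\in\mathcal{B}$ and $Z\in\mathcal{A}$: $\mathbb{E}(L_{b_1}R_{b_2}Z)=b_1\mathbb{E}(Z)b_2$, $\mathbb{E}(ZL_b)=\mathbb{E}(ZR_b)$, $\mathbb{F}(L_{b_1}R_{b_2}Z)=b_1\mathbb{F}(Z)b_2$, $\mathbb{F}(ZL_b)=\mathbb{F}(ZR_b)$. Set $\mathcal{A}_\ell=\{Z\in\mathcal{A}: ZR_b=R_bZ\ \forall b\in\mathcal{B}\}$ and $\mathcal{A}_r=\{Z\in\mathcal{A}: ZL_b=L_bZ\ \forall b\in\mathcal{B}\}$. Bi-non-crossing partitions. For $\chi:\{1,\dots,n\}\to\{\ell,r\}$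 with $\chi^{-1}(\ell)=\{i_1<\dots<i_p\}$ and $\chi^{-1}(r)=\{j_1<\dots<j_{n-p}\}$, $\prec_\chi$ is the total order $i_1\prec_\chi\dots\prec_\chi i_p\prec_\chi j_{n-p}\prec_\chi\dots\prec_\chi j_1$. A $\chi$-interval is an interval for $\prec_\chi$. $\mathcal{BNC}(\chi)$ is the lattice (under refinement) of partitions of $\{1,\dots,n\}$ that are non-crossing with respect to $\prec_\chi$; $1_\chi$ is the one-block partition and $\mu_{\mathcal{BNC}}$ the Möbius function of this lattice. Restrictions $\pi|_V$, $(Z_1,\dots,Z_n)|_V$ keep the indices in $V$, relabelled in increasing order. $\min(V)$ is for the usual order; $\min_{\prec_\chi},\max_{\prec_\chi}$ for $\prec_\chi$. Bi-free moments and cumulants. For $\pi\in\mathcal{BNC}(\chi)$ and $Z_1,\dots,Z_n\in\mathcal{A}$ define $\mathcal{E}_\pi(Z_1,\dots,Z_n)\in\mathcal{B}$ recursively. If $\pi=1_\chi$, it is $\mathbb{E}(Z_1\cdots Z_n)$. Otherwise let $V=\{v_1<\dots<v_s\}$ be the block with the largest $\min(V)$, $m=\min(V)$, $b=\mathbb{E}(Z_{v_1}\cdots Z_{v_s})$, and $T_b=L_b$ if $\chi(m)=\ell$, $T_b=R_b$ if $\chi(m)=r$. If $V=\{m,\dots,n\}$, then $\mathcal{E}_\pi(Z_1,\dots,Z_n)=\mathcal{E}_{\pi|_{V^\complement}}(Z_1,\dots,Z_{m-2},Z_{m-1}T_b)$. Otherwise let $W$ be the block containing the $\prec_\chi$-smallest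 (if $\chi(m)=\ell$) or $\prec_\chi$-largest (if $\chi(m)=r$) element of $\{m+1,\dots,n\}\setminus V$ (the block whose spine is adjacent to $\min(V)$ in the diagram of $\pi$), let $k=\min\{j\in W: j>m\}$, and set $\mathcal{E}_\pi(Z_1,\dots,Z_n)=\mathcal{E}_{\pi|_{V^\complement}}((Z_1,\dots,Z_{k-1},T_bZ_k,Z_{k+1},\dots,Z_n)|_{V^\complement})$. The operator-valued bi-free cumulant function is $\kappa_\pi(Z_1,\dots,Z_n)=\sum_{\sigma\in\mathcal{BNC}(\chi),\,\sigma\le\pi}\mathcal{E}_\sigma(Z_1,\dots,Z_n)\mu_{\mathcal{BNC}}(\sigma,\pi)$ for $Z_k\in\mathcal{A}_{\chi(k)}$. Conditionally bi-free cumulants. For $\pi\in\mathcal{BNC}(\chi)$ and $Z_k\in\mathcal{A}_{\chi(k)}$, $\mathcal{K}_\pi(Z_1,\dots,Z_n)\in\mathcal{D}$ is defined recursively on $n$. If $n=1$, $\mathcal{K}_{1_\chi}(Z)=\mathbb{F}(Z)$. If $n\ge2$ and $\pi\ne1_\chi$, let $V_1,\dots,V_t$ (ordered by $\prec_\chi$) be the unique partition of $\{1,\dots,n\}$ into $\chi$-intervals, each a union of blocks of $\pi$, such that $\min_{\prec_\chi}(V_i)$ and $\max_{\prec_\chi}(V_i)$ lie in a common block $V_i'$ of $\pi$ for each $i$; then $\mathcal{K}_\pi(Z_1,\dots,Z_n)=\mathcal{K}_{\pi|_{V_1}}((Z_1,\dots,Z_n)|_{V_1})\cdots\mathcal{K}_{\pi|_{V_t}}((Z_1,\dots,Z_n)|_{V_t})$,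 where each factor is reduced as follows until only the block $V_i'$ remains: let $V\subset V_i\setminus V_i'$ be the block of $\pi$ with the largest $\min(V)$, let $p=\max_{\prec_\chi}\{j\in V_i: j\prec_\chi\min_{\prec_\chi}(V)\}$ and $c=\kappa_{\pi|_V}((Z_1,\dots,Z_n)|_V)$; then $\mathcal{K}_{\pi|_{V_i}}((Z_1,\dots,Z_n)|_{V_i})$ equals $\mathcal{K}_{\pi|_{V_i\setminus V}}$ evaluated at $(Z_1,\dots,Z_n)|_{V_i\setminus V}$ with $Z_p$ replaced by $Z_pL_c$ if $\chi(p)=\ell$ and by $R_cZ_p$ if $\chi(p)=r$. Finally, $\mathcal{K}_{1_\chi}(Z_1,\dots,Z_n)=\mathbb{F}(Z_1\cdots Z_n)-\sum_{\pi\in\mathcal{BNC}(\chi),\,\pi\ne1_\chi}\mathcal{K}_\pi(Z_1,\dots,Z_n)$. *)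

theory Defs
  imports Complex_Main "HOL-Library.Disjoint_Sets" "HOL-Library.Poly_Mapping"
begin

section \<open>Complex algebras and the algebra \<open>B \<otimes> B\<^sup>o\<^sup>p\<close>\<close>

locale complex_algebra = vector_space scale
  for scale :: "complex \<Rightarrow> 'a::ring_1 \<Rightarrow> 'a" +
  assumes scale_mult_left: "scale c x * y = scale c (x * y)"
    and scale_mult_right: "x * scale c y = scale c (x * y)"

text \<open>
  The product monoid of \<open>(D, *)\<close> and its opposite.  It is written additively because the
  convolution product of \<open>Poly_Mapping\<close> is built on an additive monoid:
  \<open>'d op_pair \<Rightarrow>\<^sub>0 complex\<close> is then the monoid algebra, i.e. the free complex vector space on the
  symbols \<open>b \<otimes> b'\<close> with the product \<open>(b\<^sub>1 \<otimes> b\<^sub>1') (b\<^sub>2 \<otimes> b\<^sub>2') = b\<^sub>1 b\<^sub>2 \<otimes> b\<^sub>2' b\<^sub>1'\<close>.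
\<close>

datatype 'd op_pair = OpPair 'd 'd

instantiation op_pair :: (monoid_mult) monoid_add
begin

definition zero_op_pair :: "'a op_pair"
  where "0 = OpPair 1 1"

definition plus_op_pair :: "'a op_pair \<Rightarrow> 'a op_pair \<Rightarrow> 'a op_pair"
  where "s + t = (case s of OpPair a a' \<Rightarrow> case t of OpPair b b' \<Rightarrow> OpPair (a * b) (b' * a'))"

instance
proof
  fix a b c :: "'a op_pair"
  show "a + b + c = a + (b + c)" "0 + a = a" "a + 0 = a"
    by (cases a; cases b; cases c; simp add: zero_op_pair_def plus_op_pair_def mult.assoc)+
qed

end

lemma OpPair_add [simp]: "OpPair a a' + OpPair b b' = OpPair (a * b) (b' * a')"
  by (simp add: plus_op_pair_def)

type_synonym 'd tensor_rep = "'d op_pair \<Rightarrow>\<^sub>0 complex"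

definition tensor_free :: "'d set \<Rightarrow> ('d::monoid_mult) tensor_rep set"
  where "tensor_free B = {p. \<forall>s \<in> Poly_Mapping.keys p. \<exists>b\<in>B. \<exists>b'\<in>B. s = OpPair b b'}"

abbreviation symb :: "'d \<Rightarrow> 'd \<Rightarrow> ('d::monoid_mult) tensor_rep"
  where "symb b b' \<equiv> Poly_Mapping.single (OpPair b b') 1"

text \<open>Left multiplication by \<open>single 0 c\<close> is multiplication by the scalar \<open>c\<close>.\<close>

abbreviation tscale :: "complex \<Rightarrow> ('d::monoid_mult) tensor_rep \<Rightarrow> 'd tensor_rep"
  where "tscale c p \<equiv> Poly_Mapping.single 0 c * p"

text \<open>The span of the relations expressing bilinearity of \<open>\<otimes>\<close> on \<open>B \<times> B\<close>.\<close>

inductive_set tensor_null :: "(complex \<Rightarrow> 'd \<Rightarrow> 'd) \<Rightarrow> 'd set \<Rightarrow> ('d::ring_1) tensor_rep set"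
  for sD :: "complex \<Rightarrow> 'd \<Rightarrow> 'd" and B :: "'d set"
where
  zero: "0 \<in> tensor_null sD B"
| add: "p \<in> tensor_null sD B \<Longrightarrow> q \<in> tensor_null sD B \<Longrightarrow> p + q \<in> tensor_null sD B"
| scale: "p \<in> tensor_null sD B \<Longrightarrow> tscale c p \<in> tensor_null sD B"
| add_left: "x \<in> B \<Longrightarrow> y \<in> B \<Longrightarrow> z \<in> B \<Longrightarrow>
    symb (x + y) z - (symb x z + symb y z) \<in> tensor_null sD B"
| add_right: "x \<in> B \<Longrightarrow> y \<in> B \<Longrightarrow> z \<in> B \<Longrightarrow>
    symb z (x + y) - (symb z x + symb z y) \<in> tensor_null sD B"
| scale_left: "x \<in> B \<Longrightarrow> z \<in> B \<Longrightarrow>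
    symb (sD c x) z - tscale c (symb x z) \<in> tensor_null sD B"
| scale_right: "x \<in> B \<Longrightarrow> z \<in> B \<Longrightarrow>
    symb z (sD c x) - tscale c (symb z x) \<in> tensor_null sD B"

text \<open>
  The algebra \<open>B \<otimes> B\<^sup>o\<^sup>p\<close> is the quotient of \<^const>\<open>tensor_free\<close> by \<^const>\<open>tensor_null\<close>; its elements
  are the cosets \<open>tcls sD B p\<close>, and its operations are those of representatives
  (well defined by \<open>tcls_cong\<close> below).
\<close>

definition tcls :: "(complex \<Rightarrow> 'd \<Rightarrow> 'd) \<Rightarrow> 'd set \<Rightarrow> ('d::ring_1) tensor_rep \<Rightarrow> 'd tensor_rep set"
  where "tcls sD B p = {q. q - p \<in> tensor_null sD B}"

definition tens :: "(complex \<Rightarrow> 'd \<Rightarrow> 'd) \<Rightarrow> 'd set \<Rightarrow> 'd \<Rightarrow> 'd \<Rightarrow> ('d::ring_1) tensor_rep set"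
  where "tens sD B b b' = tcls sD B (symb b b')"

definition unital_subalgebra :: "(complex \<Rightarrow> 'd \<Rightarrow> 'd) \<Rightarrow> ('d::ring_1) set \<Rightarrow> bool"
  where "unital_subalgebra sD B \<longleftrightarrow>
    module.subspace sD B \<and> 1 \<in> B \<and> (\<forall>x\<in>B. \<forall>y\<in>B. x * y \<in> B)"

definition tensor_unital_hom ::
    "(complex \<Rightarrow> 'd \<Rightarrow> 'd) \<Rightarrow> 'd set \<Rightarrow> (complex \<Rightarrow> 'a \<Rightarrow> 'a) \<Rightarrow>
      (('d::ring_1) tensor_rep set \<Rightarrow> 'a::ring_1) \<Rightarrow> bool"
  where "tensor_unital_hom sD B sA \<epsilon> \<longleftrightarrow>
    (\<forall>p\<in>tensor_free B. \<forall>q\<in>tensor_free B.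
        \<epsilon> (tcls sD B (p + q)) = \<epsilon> (tcls sD B p) + \<epsilon> (tcls sD B q) \<and>
        \<epsilon> (tcls sD B (p * q)) = \<epsilon> (tcls sD B p) * \<epsilon> (tcls sD B q)) \<and>
    (\<forall>c. \<forall>p\<in>tensor_free B. \<epsilon> (tcls sD B (tscale c p)) = sA c (\<epsilon> (tcls sD B p))) \<and>
    \<epsilon> (tcls sD B 1) = 1"

lemma tscale_single: "tscale c (Poly_Mapping.single s d) = Poly_Mapping.single s (c * d)"
  by (simp add: mult_single)

lemma tensor_null_minus: "p \<in> tensor_null sD B \<Longrightarrow> - p \<in> tensor_null sD B"
  using tensor_null.scale[of p sD B "-1"] by (simp add: single_uminus)

lemma tensor_rep_induct [consumes 1, case_names zero step]:
  assumes p: "p \<in> tensor_free B"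
    and zero: "P 0"
    and step: "\<And>b b' c q. b \<in> B \<Longrightarrow> b' \<in> B \<Longrightarrow> P q \<Longrightarrow> P (tscale c (symb b b') + q)"
  shows "P p"
proof -
  have eq: "p = (\<Sum>s\<in>Poly_Mapping.keys p. Poly_Mapping.single s (Poly_Mapping.lookup p s))"
    by (rule poly_mapping_eqI)
      (auto simp: lookup_sum lookup_single when_def in_keys_iff)
  have "P (\<Sum>s\<in>S. Poly_Mapping.single s (Poly_Mapping.lookup p s))" if "finite S" "S \<subseteq> Poly_Mapping.keys p" for S
    using that
  proof (induction S rule: finite_induct)
    case (insert s S)
    then obtain b b' where "b \<in> B" "b' \<in> B" "s = OpPair b b'"
      using p by (auto simp: tensor_free_def)
    then show ?case
      using insert step[of b b' _ "Poly_Mapping.lookup p s"] by (simp add: tscale_single)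
  qed (simp add: zero)
  from this[OF finite_keys subset_refl] show ?thesis
    by (simp flip: eq)
qed

context
  fixes sD :: "complex \<Rightarrow> 'd::ring_1 \<Rightarrow> 'd" and B :: "'d set"
  assumes alg: "complex_algebra sD" and sub: "unital_subalgebra sD B"
begin

interpretation complex_algebra sD by (fact alg)

lemma tensor_null_mult_symb:
  assumes "p \<in> tensor_null sD B" "b \<in> B" "b' \<in> B"
  shows "p * symb b b' \<in> tensor_null sD B \<and> symb b b' * p \<in> tensor_null sD B"
  using assms(1)
proof induction
  case (scale p c)
  have "symb b b' * tscale c p = tscale c (symb b b' * p)"
    by (simp only: mult.assoc [symmetric] mult_single add_0_left add_0_right mult.commute [of c])
  with scale show ?case
    by (simp add: mult.assoc tensor_null.scale)
next
  case (add_left x y z)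
  with assms sub show ?case
    using tensor_null.add_left[of "x * b" B "y * b" "b' * z" sD]
      tensor_null.add_left[of "b * x" B "b * y" "z * b'" sD]
    by (simp add: unital_subalgebra_def algebra_simps mult_single)
next
  case (add_right x y z)
  with assms sub show ?case
    using tensor_null.add_right[of "b' * x" B "b' * y" "z * b" sD]
      tensor_null.add_right[of "x * b'" B "y * b'" "b * z" sD]
    by (simp add: unital_subalgebra_def algebra_simps mult_single)
next
  case (scale_left x z c)
  with assms sub show ?case
    using tensor_null.scale_left[of "x * b" B "b' * z" sD c]
      tensor_null.scale_left[of "b * x" B "z * b'" sD c]
    by (simp add: unital_subalgebra_def left_diff_distrib right_diff_distrib mult_single
        scale_mult_left scale_mult_right)
next
  case (scale_right x z c)
  with assms sub show ?case
    using tensor_null.scale_right[of "b' * x" B "z * b" sD c]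
      tensor_null.scale_right[of "x * b'" B "b * z" sD c]
    by (simp add: unital_subalgebra_def left_diff_distrib right_diff_distrib mult_single
        scale_mult_left scale_mult_right)
qed (auto simp: algebra_simps intro: tensor_null.intros)

lemma tensor_null_ideal:
  assumes "q \<in> tensor_free B" "p \<in> tensor_null sD B"
  shows "p * q \<in> tensor_null sD B \<and> q * p \<in> tensor_null sD B"
  using assms(1)
proof (induction rule: tensor_rep_induct)
  case (step b b' c q)
  have "p * Poly_Mapping.single 0 c = tscale c p"
  proof (induction p rule: update_induct)
    case (update f a d)
    then have "Poly_Mapping.update a d f = f + Poly_Mapping.single a d"
      by (intro poly_mapping_eqI)
        (auto simp: lookup_update lookup_add lookup_single when_def in_keys_iff)
    then show ?case
      using update by (simp add: algebra_simps mult_single)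
  qed simp
  then have 1: "p * (tscale c (symb b b') + q) = tscale c (p * symb b b') + p * q"
    by (simp only: distrib_left flip: mult.assoc)
  have 2: "(tscale c (symb b b') + q) * p = tscale c (symb b b' * p) + q * p"
    by (simp only: distrib_right mult.assoc)
  show ?case
    unfolding 1 2 using step tensor_null_mult_symb[OF assms(2), of b b']
    by (blast intro: tensor_null.add tensor_null.scale)
qed (simp add: tensor_null.zero)

lemma tcls_eq_iff: "tcls sD B p = tcls sD B q \<longleftrightarrow> p - q \<in> tensor_null sD B"
proof
  assume "tcls sD B p = tcls sD B q"
  moreover have "p \<in> tcls sD B p"
    by (simp add: tcls_def tensor_null.zero)
  ultimately show "p - q \<in> tensor_null sD B"
    by (simp add: tcls_def)
next
  assume *: "p - q \<in> tensor_null sD B"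
  have "x - q \<in> tensor_null sD B" if "x - p \<in> tensor_null sD B" for x
    using tensor_null.add[OF that *] by simp
  moreover have "x - p \<in> tensor_null sD B" if "x - q \<in> tensor_null sD B" for x
    using tensor_null.add[OF that tensor_null_minus[OF *]] by simp
  ultimately show "tcls sD B p = tcls sD B q"
    by (auto simp: tcls_def)
qed

lemma tcls_cong:
  assumes "tcls sD B p = tcls sD B p'" "tcls sD B q = tcls sD B q'"
  shows "tcls sD B (p + q) = tcls sD B (p' + q')"
    and "tcls sD B (tscale c p) = tcls sD B (tscale c p')"
    and "p' \<in> tensor_free B \<Longrightarrow> q \<in> tensor_free B \<Longrightarrow> tcls sD B (p * q) = tcls sD B (p' * q')"
proof -
  from assms have *: "p - p' \<in> tensor_null sD B" "q - q' \<in> tensor_null sD B"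
    by (simp_all add: tcls_eq_iff)
  show "tcls sD B (p + q) = tcls sD B (p' + q')"
    using tensor_null.add[OF *] by (simp add: tcls_eq_iff algebra_simps)
  show "tcls sD B (tscale c p) = tcls sD B (tscale c p')"
    using tensor_null.scale[OF *(1), of c] by (simp add: tcls_eq_iff right_diff_distrib)
  assume "p' \<in> tensor_free B" "q \<in> tensor_free B"
  then have "(p - p') * q + p' * (q - q') \<in> tensor_null sD B"
    using * tensor_null_ideal by (blast intro: tensor_null.add)
  then show "tcls sD B (p * q) = tcls sD B (p' * q')"
    by (simp add: tcls_eq_iff algebra_simps)
qed

end


section \<open>Spaces with a pair of \<open>(B, D)\<close>-valued expectations\<close>

definition Lop :: "(complex \<Rightarrow> 'd \<Rightarrow> 'd) \<Rightarrow> 'd set \<Rightarrow> (('d::ring_1) tensor_rep set \<Rightarrow> 'a) \<Rightarrow> 'd \<Rightarrow> 'a"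
  where "Lop sD B \<epsilon> b = \<epsilon> (tens sD B b 1)"

definition Rop :: "(complex \<Rightarrow> 'd \<Rightarrow> 'd) \<Rightarrow> 'd set \<Rightarrow> (('d::ring_1) tensor_rep set \<Rightarrow> 'a) \<Rightarrow> 'd \<Rightarrow> 'a"
  where "Rop sD B \<epsilon> b = \<epsilon> (tens sD B 1 b)"

locale cbf_space =
  A: complex_algebra sA + D: complex_algebra sD
  for sA :: "complex \<Rightarrow> 'a::ring_1 \<Rightarrow> 'a"
    and sD :: "complex \<Rightarrow> 'd::ring_1 \<Rightarrow> 'd" +
  fixes B :: "'d set"
    and \<epsilon> :: "'d tensor_rep set \<Rightarrow> 'a"
    and E :: "'a \<Rightarrow> 'd"
    and F :: "'a \<Rightarrow> 'd"
  assumes B_subalgebra: "unital_subalgebra sD B"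
    and \<epsilon>_hom: "tensor_unital_hom sD B sA \<epsilon>"
    and \<epsilon>_inj_left: "inj_on \<epsilon> {tens sD B b 1 | b. b \<in> B}"
    and \<epsilon>_inj_right: "inj_on \<epsilon> {tens sD B 1 b | b. b \<in> B}"
    and E_linear: "Vector_Spaces.linear sA sD E"
    and E_unital: "E 1 = 1"
    and E_range: "range E \<subseteq> B"
    and F_linear: "Vector_Spaces.linear sA sD F"
    and F_unital: "F 1 = 1"
    and E_bimodule: "b1 \<in> B \<Longrightarrow> b2 \<in> B \<Longrightarrow>
      E (Lop sD B \<epsilon> b1 * Rop sD B \<epsilon> b2 * x) = b1 * E x * b2"
    and E_left_right: "b \<in> B \<Longrightarrow> E (x * Lop sD B \<epsilon> b) = E (x * Rop sD B \<epsilon> b)"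
    and F_bimodule: "b1 \<in> B \<Longrightarrow> b2 \<in> B \<Longrightarrow>
      F (Lop sD B \<epsilon> b1 * Rop sD B \<epsilon> b2 * x) = b1 * F x * b2"
    and F_left_right: "b \<in> B \<Longrightarrow> F (x * Lop sD B \<epsilon> b) = F (x * Rop sD B \<epsilon> b)"

datatype side = Lft | Rgt

definition face :: "('d \<Rightarrow> 'a) \<Rightarrow> ('d \<Rightarrow> 'a) \<Rightarrow> 'd set \<Rightarrow> side \<Rightarrow> ('a::ring_1) set"
  where "face L R B s = (case s of
      Lft \<Rightarrow> {x. \<forall>b\<in>B. x * R b = R b * x}
    | Rgt \<Rightarrow> {x. \<forall>b\<in>B. x * L b = L b * x})"


section \<open>Bi-non-crossing partitions\<close>

text \<open>
  Everything is indexed by finite sets \<open>S\<close> of natural numbers instead of \<open>{1..n}\<close> only.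
  A restriction then simply keeps the original labels (the relabelling in increasing order
  is an isomorphism of all the structure below), and \<open>\<chi>\<close> and \<open>Z\<close> are total functions of which
  only the values on the index set matter.  A partition \<open>\<pi>\<close> determines its index set \<open>\<Union>\<pi>\<close>,
  and the one-block partition of \<open>S\<close> is \<open>{S}\<close>.
\<close>

definition chi_less :: "(nat \<Rightarrow> side) \<Rightarrow> nat \<Rightarrow> nat \<Rightarrow> bool"
  where "chi_less \<chi> i j \<longleftrightarrow> (case (\<chi> i, \<chi> j) of
      (Lft, Lft) \<Rightarrow> i < j
    | (Lft, Rgt) \<Rightarrow> True
    | (Rgt, Lft) \<Rightarrow> False
    | (Rgt, Rgt) \<Rightarrow> j < i)"

definition chi_Min :: "(nat \<Rightarrow> side) \<Rightarrow> nat set \<Rightarrow> nat"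
  where "chi_Min \<chi> V = (THE v. v \<in> V \<and> (\<forall>w\<in>V. w \<noteq> v \<longrightarrow> chi_less \<chi> v w))"

definition chi_Max :: "(nat \<Rightarrow> side) \<Rightarrow> nat set \<Rightarrow> nat"
  where "chi_Max \<chi> V = (THE v. v \<in> V \<and> (\<forall>w\<in>V. w \<noteq> v \<longrightarrow> chi_less \<chi> w v))"

definition chi_interval :: "(nat \<Rightarrow> side) \<Rightarrow> nat set \<Rightarrow> nat set \<Rightarrow> bool"
  where "chi_interval \<chi> S V \<longleftrightarrow>
    V \<subseteq> S \<and> (\<forall>a\<in>V. \<forall>c\<in>V. \<forall>b\<in>S. chi_less \<chi> a b \<and> chi_less \<chi> b c \<longrightarrow> b \<in> V)"

definition BNC :: "(nat \<Rightarrow> side) \<Rightarrow> nat set \<Rightarrow> nat set set set"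
  where "BNC \<chi> S = {\<pi>. finite S \<and> partition_on S \<pi> \<and>
    \<not> (\<exists>V\<in>\<pi>. \<exists>W\<in>\<pi>. V \<noteq> W \<and> (\<exists>a\<in>V. \<exists>b\<in>W. \<exists>c\<in>V. \<exists>d\<in>W.
        chi_less \<chi> a b \<and> chi_less \<chi> b c \<and> chi_less \<chi> c d))}"

definition finer :: "nat set set \<Rightarrow> nat set set \<Rightarrow> bool"
  where "finer \<sigma> \<pi> \<longleftrightarrow> (\<forall>V\<in>\<sigma>. \<exists>W\<in>\<pi>. V \<subseteq> W)"

definition bnc_join :: "(nat \<Rightarrow> side) \<Rightarrow> nat set \<Rightarrow> nat set set \<Rightarrow> nat set set \<Rightarrow> nat set set"
  where "bnc_join \<chi> S \<pi> \<sigma> = (THE \<tau>. \<tau> \<in> BNC \<chi> S \<and> finer \<pi> \<tau> \<and> finer \<sigma> \<tau> \<and>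
    (\<forall>\<rho>\<in>BNC \<chi> S. finer \<pi> \<rho> \<and> finer \<sigma> \<rho> \<longrightarrow> finer \<tau> \<rho>))"

definition block_of :: "nat set set \<Rightarrow> nat \<Rightarrow> nat set"
  where "block_of \<pi> i = (THE V. V \<in> \<pi> \<and> i \<in> V)"

lemma finite_BNC [simp]: "finite (BNC \<chi> S)"
proof (cases "finite S")
  case True
  then show ?thesis
    by (rule finite_subset[rotated, OF finitely_many_partition_on]) (auto simp: BNC_def)
qed (simp add: BNC_def)

lemma BNC_Union: "\<pi> \<in> BNC \<chi> S \<Longrightarrow> \<Union>\<pi> = S"
  by (auto simp: BNC_def partition_on_def)

lemma BNC_partition: "\<pi> \<in> BNC \<chi> S \<Longrightarrow> partition_on S \<pi>"
  by (auto simp: BNC_def)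

lemma BNC_I:
  assumes "finite S" "partition_on S \<pi>"
    and "\<And>V W a b c d. \<lbrakk>V \<in> \<pi>; W \<in> \<pi>; V \<noteq> W; a \<in> V; b \<in> W; c \<in> V; d \<in> W\<rbrakk> \<Longrightarrow>
      \<not> (chi_less \<chi> a b \<and> chi_less \<chi> b c \<and> chi_less \<chi> c d)"
  shows "\<pi> \<in> BNC \<chi> S"
  unfolding BNC_def mem_Collect_eq
proof (intro conjI notI)
  assume "\<exists>V\<in>\<pi>. \<exists>W\<in>\<pi>. V \<noteq> W \<and> (\<exists>a\<in>V. \<exists>b\<in>W. \<exists>c\<in>V. \<exists>d\<in>W.
      chi_less \<chi> a b \<and> chi_less \<chi> b c \<and> chi_less \<chi> c d)"
  then show False
    by (elim bexE conjE) (use assms(3) in metis)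
qed (fact assms)+

lemma BNC_noncrossing:
  assumes "\<pi> \<in> BNC \<chi> S" "V \<in> \<pi>" "W \<in> \<pi>" "V \<noteq> W" "a \<in> V" "b \<in> W" "c \<in> V" "d \<in> W"
  shows "\<not> (chi_less \<chi> a b \<and> chi_less \<chi> b c \<and> chi_less \<chi> c d)"
proof
  assume "chi_less \<chi> a b \<and> chi_less \<chi> b c \<and> chi_less \<chi> c d"
  with assms(2-) have "\<exists>V\<in>\<pi>. \<exists>W\<in>\<pi>. V \<noteq> W \<and> (\<exists>a\<in>V. \<exists>b\<in>W. \<exists>c\<in>V. \<exists>d\<in>W.
      chi_less \<chi> a b \<and> chi_less \<chi> b c \<and> chi_less \<chi> c d)"
    by (intro bexI[of _ V] bexI[of _ W] conjI bexI[of _ a] bexI[of _ b] bexI[of _ c] bexI[of _ d])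
      auto
  then show False
    using assms(1) by (simp only: BNC_def mem_Collect_eq simp_thms)
qed

lemma finer_refl: "finer \<pi> \<pi>"
  by (auto simp: finer_def)

lemma finer_trans: "finer \<rho> \<sigma> \<Longrightarrow> finer \<sigma> \<pi> \<Longrightarrow> finer \<rho> \<pi>"
  unfolding finer_def by (meson subset_trans)

lemma finer_antisym:
  assumes "\<sigma> \<in> BNC \<chi> S" "\<pi> \<in> BNC \<chi> S" "finer \<sigma> \<pi>" "finer \<pi> \<sigma>"
  shows "\<sigma> = \<pi>"
proof -
  have *: "\<sigma>' \<subseteq> \<pi>'" if "partition_on S \<sigma>'" "partition_on S \<pi>'" "finer \<sigma>' \<pi>'" "finer \<pi>' \<sigma>'" for \<sigma>' \<pi>'
  proof
    fix V assume V: "V \<in> \<sigma>'"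
    with that obtain W where W: "W \<in> \<pi>'" "V \<subseteq> W"
      by (auto simp: finer_def)
    with that obtain V' where V': "V' \<in> \<sigma>'" "W \<subseteq> V'"
      by (auto simp: finer_def)
    have "V \<noteq> {}"
      using V that(1) by (auto simp: partition_on_def)
    with V V' W have "V = V'"
      using partition_onD2[OF that(1)] by (auto dest: disjointD)
    with V' W show "V \<in> \<pi>'" by auto
  qed
  show ?thesis
    using *[of \<sigma> \<pi>] *[of \<pi> \<sigma>] assms by (auto dest!: BNC_partition)
qed

function bnc_mobius :: "(nat \<Rightarrow> side) \<Rightarrow> nat set \<Rightarrow> nat set set \<Rightarrow> nat set set \<Rightarrow> int"
  where "bnc_mobius \<chi> S \<sigma> \<pi> =
    (if \<sigma> \<notin> BNC \<chi> S \<or> \<pi> \<notin> BNC \<chi> S \<or> \<not> finer \<sigma> \<pi> then 0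
     else if \<sigma> = \<pi> then 1
     else - (\<Sum>\<tau> \<in> {\<tau> \<in> BNC \<chi> S. finer \<sigma> \<tau> \<and> finer \<tau> \<pi> \<and> \<tau> \<noteq> \<pi>}. bnc_mobius \<chi> S \<sigma> \<tau>))"
  by pat_completeness auto
termination
proof (relation "measure (\<lambda>(\<chi>, S, \<sigma>, \<pi>). card {\<tau> \<in> BNC \<chi> S. finer \<tau> \<pi>})", goal_cases)
  case (2 \<chi> S \<sigma> \<pi> \<tau>)
  then have \<tau>: "\<tau> \<in> BNC \<chi> S" "finer \<tau> \<pi>" "\<tau> \<noteq> \<pi>" and \<pi>: "\<pi> \<in> BNC \<chi> S"
    by auto
  then have "\<not> finer \<pi> \<tau>"
    using finer_antisym by blast
  with \<tau> \<pi> have "{\<rho> \<in> BNC \<chi> S. finer \<rho> \<tau>} \<subset> {\<rho> \<in> BNC \<chi> S. finer \<rho> \<pi>}"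
    using finer_refl finer_trans by blast
  then show ?case
    by (simp add: psubset_card_mono)
qed auto

declare bnc_mobius.simps [simp del]


section \<open>Bi-free moments and cumulants\<close>

definition oprod :: "(nat \<Rightarrow> 'a::monoid_mult) \<Rightarrow> nat set \<Rightarrow> 'a"
  where "oprod Z S = prod_list (map Z (sorted_list_of_set S))"

lemma arg_max_on_Min_in: "finite \<pi> \<Longrightarrow> \<pi> \<noteq> {} \<Longrightarrow> arg_max_on Min \<pi> \<in> \<pi>" for \<pi> :: "nat set set"
proof -
  assume *: "finite \<pi>" "\<pi> \<noteq> {}"
  then obtain V where "V \<in> \<pi>" by blast
  moreover have "\<forall>W. W \<in> \<pi> \<longrightarrow> Min W < Suc (Max (Min ` \<pi>))"
    using * by (simp add: less_Suc_eq_le)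
  ultimately show ?thesis
    unfolding arg_max_on_def by (rule arg_max_natI)
qed

lemma card_Diff_last_block:
  fixes \<pi> :: "nat set set"
  assumes "\<not> card \<pi> \<le> 1"
  shows "card (\<pi> - {arg_max_on Min \<pi>}) < card \<pi>"
proof -
  have "finite \<pi>" "\<pi> \<noteq> {}"
    using assms by (auto intro: card_ge_0_finite)
  with arg_max_on_Min_in show ?thesis
    by (intro card_Diff1_less) auto
qed

text \<open>
  \<open>moment L R E \<chi> \<pi> Z\<close> is \<open>\<E>\<^sub>\<pi>(Z)\<close>.  A partition of a non-empty set with at most one block is the
  one-block partition.  In the case \<open>V = {i \<in> S. m \<le> i}\<close> the predecessor of \<open>m\<close> in the index set
  plays the role of \<open>m - 1\<close> after relabelling.
\<close>

function moment :: "('d \<Rightarrow> 'a) \<Rightarrow> ('d \<Rightarrow> 'a) \<Rightarrow> ('a \<Rightarrow> 'd) \<Rightarrow> (nat \<Rightarrow> side) \<Rightarrow> nat set set \<Rightarrow>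
    (nat \<Rightarrow> 'a::ring_1) \<Rightarrow> 'd"
  where "moment L R E \<chi> \<pi> Z =
    (if card \<pi> \<le> 1 then E (oprod Z (\<Union>\<pi>))
     else let S = \<Union>\<pi>;
       V = arg_max_on Min \<pi>;
       m = Min V;
       b = E (oprod Z V);
       T = (case \<chi> m of Lft \<Rightarrow> L b | Rgt \<Rightarrow> R b)
     in if V = {i \<in> S. m \<le> i}
        then let q = Max {i \<in> S. i < m}
             in moment L R E \<chi> (\<pi> - {V}) (Z(q := Z q * T))
        else let X = {i \<in> S. m < i} - V;
                 w = (case \<chi> m of Lft \<Rightarrow> chi_Min \<chi> X | Rgt \<Rightarrow> chi_Max \<chi> X);
                 k = Min {j \<in> block_of \<pi> w. m < j}
             in moment L R E \<chi> (\<pi> - {V}) (Z(k := T * Z k)))"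
  by pat_completeness auto
termination
proof (relation "measure (\<lambda>(L, R, E, \<chi>, \<pi>, Z). card \<pi>)", goal_cases)
  case (2 L R E \<chi> \<pi> Z S V)
  show ?case
    using card_Diff_last_block[OF 2(1)] 2(3) by simp
next
  case (3 L R E \<chi> \<pi> Z S V)
  show ?case
    using card_Diff_last_block[OF 3(1)] 3(3) by simp
qed auto

declare moment.simps [simp del]

definition kappa :: "('d \<Rightarrow> 'a) \<Rightarrow> ('d \<Rightarrow> 'a) \<Rightarrow> ('a \<Rightarrow> 'd) \<Rightarrow> (nat \<Rightarrow> side) \<Rightarrow> nat set set \<Rightarrow>
    (nat \<Rightarrow> 'a::ring_1) \<Rightarrow> 'd::ring_1"
  where "kappa L R E \<chi> \<pi> Z =
    (\<Sum>\<sigma> \<in> {\<sigma> \<in> BNC \<chi> (\<Union>\<pi>). finer \<sigma> \<pi>}.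
      moment L R E \<chi> \<sigma> Z * of_int (bnc_mobius \<chi> (\<Union>\<pi>) \<sigma> \<pi>))"


section \<open>Conditionally bi-free cumulants\<close>

text \<open>\<open>V\<^sub>1, \<dots>, V\<^sub>t\<close>, as a list ordered by \<open>\<prec>\<^sub>\<chi>\<close>.\<close>

definition is_outer_list :: "(nat \<Rightarrow> side) \<Rightarrow> nat set set \<Rightarrow> nat set list \<Rightarrow> bool"
  where "is_outer_list \<chi> \<pi> Vs \<longleftrightarrow>
    partition_on (\<Union>\<pi>) (set Vs) \<and>
    sorted_wrt (\<lambda>V W. \<forall>v\<in>V. \<forall>w\<in>W. chi_less \<chi> v w) Vs \<and>
    (\<forall>V\<in>set Vs. chi_interval \<chi> (\<Union>\<pi>) V \<and> (\<exists>\<rho>\<subseteq>\<pi>. V = \<Union>\<rho>) \<and>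
       (\<exists>W\<in>\<pi>. chi_Min \<chi> V \<in> W \<and> chi_Max \<chi> V \<in> W))"

definition outer_list :: "(nat \<Rightarrow> side) \<Rightarrow> nat set set \<Rightarrow> nat set list"
  where "outer_list \<chi> \<pi> = (THE Vs. is_outer_list \<chi> \<pi> Vs)"

lemma chi_less_irrefl: "\<not> chi_less \<chi> i i"
  by (auto simp: chi_less_def split: side.splits)

lemma chi_less_trans: "chi_less \<chi> i j \<Longrightarrow> chi_less \<chi> j k \<Longrightarrow> chi_less \<chi> i k"
  by (auto simp: chi_less_def split: side.splits)

lemma chi_less_asym: "chi_less \<chi> i j \<Longrightarrow> \<not> chi_less \<chi> j i"
  by (auto simp: chi_less_def split: side.splits)

lemma chi_less_total: "i \<noteq> j \<Longrightarrow> chi_less \<chi> i j \<or> chi_less \<chi> j i"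
  by (auto simp: chi_less_def split: side.splits)

lemma chi_Min_unique:
  assumes v: "v \<in> V" and less: "\<And>w. w \<in> V \<Longrightarrow> w \<noteq> v \<Longrightarrow> chi_less \<chi> v w"
  shows "chi_Min \<chi> V = v"
  unfolding chi_Min_def
proof (rule the_equality)
  fix u assume u: "u \<in> V \<and> (\<forall>w\<in>V. w \<noteq> u \<longrightarrow> chi_less \<chi> u w)"
  show "u = v"
  proof (rule ccontr)
    assume "u \<noteq> v"
    then show False
      using u v less[of u] chi_less_asym[of \<chi> u v] chi_less_asym[of \<chi> v u] by auto
  qed
qed (use v less in auto)

lemma chi_Max_unique:
  assumes v: "v \<in> V" and less: "\<And>w. w \<in> V \<Longrightarrow> w \<noteq> v \<Longrightarrow> chi_less \<chi> w v"
  shows "chi_Max \<chi> V = v"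
  unfolding chi_Max_def
proof (rule the_equality)
  fix u assume u: "u \<in> V \<and> (\<forall>w\<in>V. w \<noteq> u \<longrightarrow> chi_less \<chi> w u)"
  show "u = v"
  proof (rule ccontr)
    assume "u \<noteq> v"
    then show False
      using u v less[of u] chi_less_asym[of \<chi> u v] chi_less_asym[of \<chi> v u] by auto
  qed
qed (use v less in auto)

lemma chi_Min:
  assumes "finite V" "V \<noteq> {}"
  shows "chi_Min \<chi> V \<in> V" and "w \<in> V \<Longrightarrow> w \<noteq> chi_Min \<chi> V \<Longrightarrow> chi_less \<chi> (chi_Min \<chi> V) w"
proof -
  from assms have "\<exists>v\<in>V. \<forall>w\<in>V. w \<noteq> v \<longrightarrow> chi_less \<chi> v w"
  proof (induction rule: finite_ne_induct)
    case (insert x V)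
    then obtain v where v: "v \<in> V" "\<forall>w\<in>V. w \<noteq> v \<longrightarrow> chi_less \<chi> v w"
      by blast
    show ?case
    proof (cases "chi_less \<chi> x v")
      case True
      with v show ?thesis
        using chi_less_trans[of \<chi> x v] by (intro bexI[of _ x]) auto
    next
      case False
      then have "chi_less \<chi> v x"
        using v(1) insert.hyps(3) chi_less_total[of x v \<chi>] by auto
      with v show ?thesis
        by (intro bexI[of _ v]) auto
    qed
  qed auto
  then obtain v where v: "v \<in> V" "\<And>w. w \<in> V \<Longrightarrow> w \<noteq> v \<Longrightarrow> chi_less \<chi> v w"
    by blast
  then have "chi_Min \<chi> V = v"
    by (rule chi_Min_unique)
  with v show "chi_Min \<chi> V \<in> V" "w \<in> V \<Longrightarrow> w \<noteq> chi_Min \<chi> V \<Longrightarrow> chi_less \<chi> (chi_Min \<chi> V) w"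
    by auto
qed

lemma chi_Max:
  assumes "finite V" "V \<noteq> {}"
  shows "chi_Max \<chi> V \<in> V" and "w \<in> V \<Longrightarrow> w \<noteq> chi_Max \<chi> V \<Longrightarrow> chi_less \<chi> w (chi_Max \<chi> V)"
proof -
  from assms have "\<exists>v\<in>V. \<forall>w\<in>V. w \<noteq> v \<longrightarrow> chi_less \<chi> w v"
  proof (induction rule: finite_ne_induct)
    case (insert x V)
    then obtain v where v: "v \<in> V" "\<forall>w\<in>V. w \<noteq> v \<longrightarrow> chi_less \<chi> w v"
      by blast
    show ?case
    proof (cases "chi_less \<chi> v x")
      case True
      with v show ?thesis
        using chi_less_trans[of \<chi> _ v x] by (intro bexI[of _ x]) auto
    next
      case False
      then have "chi_less \<chi> x v"
        using v(1) insert.hyps(3) chi_less_total[of x v \<chi>] by auto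
      with v show ?thesis
        by (intro bexI[of _ v]) auto
    qed
  qed auto
  then obtain v where v: "v \<in> V" "\<And>w. w \<in> V \<Longrightarrow> w \<noteq> v \<Longrightarrow> chi_less \<chi> w v"
    by blast
  then have "chi_Max \<chi> V = v"
    by (rule chi_Max_unique)
  with v show "chi_Max \<chi> V \<in> V" "w \<in> V \<Longrightarrow> w \<noteq> chi_Max \<chi> V \<Longrightarrow> chi_less \<chi> w (chi_Max \<chi> V)"
    by auto
qed

lemma block_of_eq: "partition_on S \<pi> \<Longrightarrow> V \<in> \<pi> \<Longrightarrow> i \<in> V \<Longrightarrow> block_of \<pi> i = V"
  unfolding block_of_def
  by (rule the_equality) (auto dest!: partition_onD2 dest: disjointD)

lemma is_outer_list_exists:
  assumes "\<pi> \<in> BNC \<chi> (\<Union>\<pi>)"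
  shows "\<exists>Vs. is_outer_list \<chi> \<pi> Vs"
  using assms
proof (induction "card (\<Union>\<pi>)" arbitrary: \<pi> rule: less_induct)
  case less
  define S where "S = \<Union>\<pi>"
  have fin: "finite S" and part: "partition_on S \<pi>"
    using less.prems by (auto simp: BNC_def S_def)
  show ?case
  proof (cases "\<pi> = {}")
    case True
    then have "is_outer_list \<chi> \<pi> []"
      by (simp add: is_outer_list_def partition_on_def)
    then show ?thesis ..
  next
    case False
    then have "S \<noteq> {}"
      using part by (auto simp: partition_on_def)
    define a where "a = chi_Min \<chi> S"
    have a: "a \<in> S" "\<And>w. w \<in> S \<Longrightarrow> w \<noteq> a \<Longrightarrow> chi_less \<chi> a w"
      using chi_Min[OF fin \<open>S \<noteq> {}\<close>] by (auto simp: a_def)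
    obtain V' where V': "V' \<in> \<pi>" "a \<in> V'"
      using a(1) by (auto simp: S_def)
    have V'S: "V' \<subseteq> S"
      using V' by (auto simp: S_def)
    define M where "M = chi_Max \<chi> V'"
    have M: "M \<in> V'" "\<And>w. w \<in> V' \<Longrightarrow> w \<noteq> M \<Longrightarrow> chi_less \<chi> w M"
      using chi_Max[of V'] V' finite_subset[OF V'S fin] by (auto simp: M_def)
    define V where "V = {s \<in> S. s = M \<or> chi_less \<chi> s M}"
    have blocks: "W \<subseteq> V \<or> W \<inter> V = {}" if W: "W \<in> \<pi>" for W
    proof (rule ccontr)
      assume "\<not> ?thesis"
      then obtain w1 w2 where w: "w1 \<in> W" "w1 \<in> V" "w2 \<in> W" "w2 \<notin> V"
        by blast
      have "w2 \<in> S" using w W by (auto simp: S_def)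
      then have Mw2: "chi_less \<chi> M w2"
        using w(4) chi_less_total[of M w2 \<chi>] by (auto simp: V_def)
      have "w2 \<notin> V'"
        using M(2)[of w2] Mw2 chi_less_irrefl[of \<chi> M] chi_less_asym[of \<chi> M w2] by auto
      then have "W \<noteq> V'" using w by blast
      then have "W \<inter> V' = {}"
        using part W V' by (auto simp: partition_on_def disjoint_def)
      then have "w1 \<noteq> M" "w1 \<noteq> a"
        using w M V' by auto
      then have "chi_less \<chi> a w1" "chi_less \<chi> w1 M"
        using w a(2)[of w1] by (auto simp: V_def)
      moreover have "\<not> (chi_less \<chi> a w1 \<and> chi_less \<chi> w1 M \<and> chi_less \<chi> M w2)"
        using BNC_noncrossing[OF less.prems V'(1) W \<open>W \<noteq> V'\<close>[symmetric] V'(2) w(1) M(1) w(3)] .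
      ultimately show False
        using Mw2 by blast
    qed
    define \<pi>2 where "\<pi>2 = {W \<in> \<pi>. W \<inter> V = {}}"
    have VU: "V = \<Union>{W \<in> \<pi>. W \<subseteq> V}"
    proof -
      have "V \<subseteq> S" by (auto simp: V_def)
      then show ?thesis using blocks by (fastforce simp: S_def)
    qed
    have U2: "\<Union>\<pi>2 = S - V"
      using blocks by (fastforce simp: S_def \<pi>2_def)
    have aV: "a \<in> V"
      using a M V' V'S by (auto simp: V_def)
    have MV: "M \<in> V" using M V'S by (auto simp: V_def)
    have sub2: "\<pi>2 \<subseteq> \<pi>" by (auto simp: \<pi>2_def)
    have bnc2: "\<pi>2 \<in> BNC \<chi> (\<Union>\<pi>2)"
    proof (rule BNC_I)
      show "finite (\<Union>\<pi>2)"
        using fin U2 by simp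
      show "partition_on (\<Union>\<pi>2) \<pi>2"
        using part sub2 pairwise_subset[of disjnt \<pi> \<pi>2] unfolding partition_on_def by auto
      fix V W a b c d
      assume "V \<in> \<pi>2" "W \<in> \<pi>2" "V \<noteq> W" "a \<in> V" "b \<in> W" "c \<in> V" "d \<in> W"
      with sub2 show "\<not> (chi_less \<chi> a b \<and> chi_less \<chi> b c \<and> chi_less \<chi> c d)"
        by (intro BNC_noncrossing[OF less.prems]) auto
    qed
    have "card (\<Union>\<pi>2) < card (\<Union>\<pi>)"
      unfolding U2 S_def[symmetric] using aV a fin by (intro psubset_card_mono) auto
    from less.hyps[OF this bnc2] obtain Vs where Vs: "is_outer_list \<chi> \<pi>2 Vs" ..
    have Vsub: "V \<subseteq> S" by (auto simp: V_def)
    have sets: "X \<subseteq> S - V" if "X \<in> set Vs" for X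
      using Vs that unfolding is_outer_list_def U2 by (auto simp: partition_on_def)
    have less: "chi_less \<chi> v w" if "v \<in> V" "w \<in> S - V" for v w
    proof -
      have "chi_less \<chi> M w" "v = M \<or> chi_less \<chi> v M"
        using that chi_less_total[of w M \<chi>] by (auto simp: V_def)
      then show ?thesis
        using chi_less_trans[of \<chi> v M w] by auto
    qed
    have "partition_on S (set (V # Vs))"
    proof (rule partition_onI)
      show "\<Union>(set (V # Vs)) = S"
        using Vs Vsub unfolding is_outer_list_def U2 by (auto simp: partition_on_def)
      show "{} \<notin> set (V # Vs)"
        using Vs aV unfolding is_outer_list_def by (auto simp: partition_on_def)
      show "disjnt p q" if "p \<in> set (V # Vs)" "q \<in> set (V # Vs)" "p \<noteq> q" for p q
      proof -
        have "disjnt p q" if "p \<in> set Vs" "q \<in> set Vs" "p \<noteq> q"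
          using Vs that unfolding is_outer_list_def partition_on_def
          by (auto simp: disjnt_def dest: disjointD)
        moreover have "disjnt V q" if "q \<in> set Vs" for q
          using sets[OF that] by (auto simp: disjnt_def)
        ultimately show ?thesis
          using that by (auto simp: disjnt_sym)
      qed
    qed
    moreover have "sorted_wrt (\<lambda>V W. \<forall>v\<in>V. \<forall>w\<in>W. chi_less \<chi> v w) (V # Vs)"
      using Vs sets less unfolding is_outer_list_def by fastforce
    moreover have "chi_interval \<chi> S V"
      unfolding chi_interval_def
    proof (intro conjI ballI impI)
      fix p q r assume "q \<in> V" "r \<in> S" "chi_less \<chi> p r \<and> chi_less \<chi> r q"
      then show "r \<in> V"
        using chi_less_trans[of \<chi> r q M] by (auto simp: V_def)
    qed (rule Vsub)
    moreover have "\<exists>W\<in>\<pi>. chi_Min \<chi> V \<in> W \<and> chi_Max \<chi> V \<in> W"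
    proof -
      have "chi_Min \<chi> V = a"
        using a aV by (intro chi_Min_unique) (auto simp: V_def)
      moreover have "chi_Max \<chi> V = M"
        using MV by (intro chi_Max_unique) (auto simp: V_def)
      ultimately show ?thesis
        using V' M by auto
    qed
    moreover have "chi_interval \<chi> S X" if "X \<in> set Vs" for X
    proof -
      have *: "chi_interval \<chi> (S - V) X"
        using Vs that unfolding is_outer_list_def U2 by auto
      show ?thesis
        unfolding chi_interval_def
      proof (intro conjI ballI impI)
        show "X \<subseteq> S" using sets[OF that] by auto
        fix p q r assume pqr: "p \<in> X" "q \<in> X" "r \<in> S" "chi_less \<chi> p r \<and> chi_less \<chi> r q"
        have "r \<notin> V"
          using less[of r p] pqr sets[OF that] chi_less_asym[of \<chi> p r] by auto
        with * pqr show "r \<in> X"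
          unfolding chi_interval_def by blast
      qed
    qed
    moreover have "(\<exists>\<rho>\<subseteq>\<pi>. X = \<Union>\<rho>) \<and> (\<exists>W\<in>\<pi>. chi_Min \<chi> X \<in> W \<and> chi_Max \<chi> X \<in> W)"
      if "X \<in> set Vs" for X
      using Vs that sub2 unfolding is_outer_list_def by (meson subset_iff subset_trans)
    moreover have "\<exists>\<rho>\<subseteq>\<pi>. V = \<Union>\<rho>"
      using VU by (intro exI[of _ "{W \<in> \<pi>. W \<subseteq> V}"]) auto
    ultimately have "is_outer_list \<chi> \<pi> (V # Vs)"
      unfolding is_outer_list_def S_def[symmetric] by auto
    then show ?thesis ..
  qed
qed

lemma is_outer_list_unique:
  assumes "\<pi> \<in> BNC \<chi> (\<Union>\<pi>)" "is_outer_list \<chi> \<pi> Vs" "is_outer_list \<chi> \<pi> Us"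
  shows "Vs = Us"
proof -
  define S where "S = \<Union>\<pi>"
  have fin: "finite S" and part: "partition_on S \<pi>"
    using assms(1) by (auto simp: BNC_def S_def)
  have cover: "\<exists>X\<in>set Xs. Y \<subseteq> X"
    if Xs: "is_outer_list \<chi> \<pi> Xs" and Ys: "is_outer_list \<chi> \<pi> Ys" and Y: "Y \<in> set Ys" for Xs Ys Y
  proof -
    have Ysub: "Y \<subseteq> S" and Yne: "Y \<noteq> {}"
      using Ys Y unfolding is_outer_list_def S_def[symmetric] by (auto simp: partition_on_def)
    have finY: "finite Y" using Ysub fin finite_subset by blast
    obtain W where W: "W \<in> \<pi>" "chi_Min \<chi> Y \<in> W" "chi_Max \<chi> Y \<in> W"
      using Ys Y unfolding is_outer_list_def by blast
    have "chi_Min \<chi> Y \<in> S" using chi_Min(1)[OF finY Yne] Ysub by blast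
    then obtain X where X: "X \<in> set Xs" "chi_Min \<chi> Y \<in> X"
      using Xs unfolding is_outer_list_def S_def[symmetric] by (auto simp: partition_on_def)
    then obtain \<rho> where \<rho>: "\<rho> \<subseteq> \<pi>" "X = \<Union>\<rho>"
      using Xs unfolding is_outer_list_def by blast
    then obtain W' where "W' \<in> \<rho>" "chi_Min \<chi> Y \<in> W'"
      using X by blast
    with \<rho> W have "W' = W"
      using part block_of_eq by (metis subsetD)
    then have Mx: "chi_Max \<chi> Y \<in> X"
      using \<open>W' \<in> \<rho>\<close> \<rho> W by blast
    have "y \<in> X" if "y \<in> Y" for y
    proof (cases "y = chi_Min \<chi> Y \<or> y = chi_Max \<chi> Y")
      case False
      then have "chi_less \<chi> (chi_Min \<chi> Y) y" "chi_less \<chi> y (chi_Max \<chi> Y)"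
        using chi_Min(2)[OF finY Yne that] chi_Max(2)[OF finY Yne that] by blast+
      moreover have "chi_interval \<chi> S X"
        using Xs X unfolding is_outer_list_def S_def[symmetric] by blast
      ultimately show ?thesis
        using X Mx Ysub that unfolding chi_interval_def by blast
    qed (use X Mx in auto)
    with X show ?thesis by blast
  qed
  have sub: "set Ys \<subseteq> set Xs"
    if Xs: "is_outer_list \<chi> \<pi> Xs" and Ys: "is_outer_list \<chi> \<pi> Ys" for Xs Ys
  proof
    fix Y assume Y: "Y \<in> set Ys"
    then obtain X where X: "X \<in> set Xs" "Y \<subseteq> X"
      using cover[OF Xs Ys] by blast
    then obtain Y' where Y': "Y' \<in> set Ys" "X \<subseteq> Y'"
      using cover[OF Ys Xs] by blast
    have "disjoint (set Ys)" "Y \<noteq> {}"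
      using Ys Y unfolding is_outer_list_def by (auto simp: partition_on_def)
    with X Y Y' have "Y = Y'"
      by (auto dest: disjointD)
    with X Y' show "Y \<in> set Xs" by auto
  qed
  have "set Vs = set Us"
    using sub[OF assms(2,3)] sub[OF assms(3,2)] by blast
  moreover have "sorted_wrt (\<lambda>V W. \<forall>v\<in>V. \<forall>w\<in>W. chi_less \<chi> v w) Vs"
    "sorted_wrt (\<lambda>V W. \<forall>v\<in>V. \<forall>w\<in>W. chi_less \<chi> v w) Us" "{} \<notin> set Vs"
    using assms(2,3) by (auto simp: is_outer_list_def partition_on_def)
  ultimately show ?thesis
  proof (induction Vs arbitrary: Us)
    case (Cons V Vs Us')
    let ?R = "\<lambda>V W. \<forall>v\<in>V. \<forall>w\<in>W. chi_less \<chi> v w"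
    have R: "\<not> ?R X X" if "X \<noteq> {}" for X
      using that chi_less_irrefl by blast
    have R': "\<not> (?R X Y \<and> ?R Y X)" if "X \<noteq> {}" "Y \<noteq> {}" for X Y
      using that chi_less_irrefl chi_less_trans by blast
    from Cons.prems obtain U Us where Us': "Us' = U # Us"
      by (cases Us') auto
    have ne: "V \<noteq> {}" "U \<noteq> {}"
      using Cons.prems Us' by auto
    have "V = U"
    proof (rule ccontr)
      assume "V \<noteq> U"
      then have "V \<in> set Us" "U \<in> set Vs"
        using Cons.prems(1) Us' by (metis insert_iff list.set(2) list.set_intros(1))+
      then show False
        using Cons.prems(2,3) Us' R'[OF ne] by simp
    qed
    moreover have "V \<notin> set Vs" "U \<notin> set Us"
      using Cons.prems(2,3) Us' R[OF ne(1)] R[OF ne(2)] by fastforce+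
    ultimately have "set Vs = set Us"
      using Cons.prems(1) Us' by (metis insert_ident list.set(2))
    then show ?case
      using Cons Us' \<open>V = U\<close> by simp
  qed simp
qed

lemma outer_list:
  assumes "\<pi> \<in> BNC \<chi> (\<Union>\<pi>)"
  shows "is_outer_list \<chi> \<pi> (outer_list \<chi> \<pi>)"
  unfolding outer_list_def
  by (rule theI') (use assms is_outer_list_exists is_outer_list_unique in blast)

lemma outer_list_block:
  assumes "\<pi> \<in> BNC \<chi> (\<Union>\<pi>)" "V \<in> set (outer_list \<chi> \<pi>)"
  shows "block_of \<pi> (chi_Min \<chi> V) \<in> \<pi>"
proof -
  obtain W where W: "W \<in> \<pi>" "chi_Min \<chi> V \<in> W"
    using outer_list[OF assms(1)] assms(2) unfolding is_outer_list_def by blast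
  then show ?thesis
    using block_of_eq[OF BNC_partition[OF assms(1)]] by auto
qed

text \<open>
  \<open>outer_reduce\<close> performs the successive removal of the blocks \<open>V \<noteq> V'\<close> of a partition \<open>\<pi>\<close> of some
  \<open>V\<^sub>i\<close> and returns the resulting arguments, of which those with indices in \<open>V' = V\<^sub>i'\<close> are used.
\<close>

function outer_reduce :: "('d::ring_1 \<Rightarrow> 'a) \<Rightarrow> ('d \<Rightarrow> 'a) \<Rightarrow> ('a \<Rightarrow> 'd) \<Rightarrow> (nat \<Rightarrow> side) \<Rightarrow> nat set \<Rightarrow>
    nat set set \<Rightarrow> (nat \<Rightarrow> 'a::ring_1) \<Rightarrow> nat \<Rightarrow> 'a"
  where "outer_reduce L R E \<chi> V' \<pi> Z =
    (if card (\<pi> - {V'}) = 0 then Z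
     else let V = arg_max_on Min (\<pi> - {V'});
       p = chi_Max \<chi> {j \<in> \<Union>\<pi>. chi_less \<chi> j (chi_Min \<chi> V)};
       c = kappa L R E \<chi> {V} Z
     in outer_reduce L R E \<chi> V' (\<pi> - {V})
          (Z(p := (case \<chi> p of Lft \<Rightarrow> Z p * L c | Rgt \<Rightarrow> R c * Z p))))"
  by pat_completeness auto
termination
proof (relation "measure (\<lambda>(L, R, E, \<chi>, V', \<pi>, Z). card (\<pi> - {V'}))", goal_cases)
  case (2 L R E \<chi> V' \<pi> Z V)
  then have "finite (\<pi> - {V'})" "\<pi> - {V'} \<noteq> {}"
    by (auto intro: card_ge_0_finite simp: card_gt_0_iff)
  from arg_max_on_Min_in[OF this] this 2 show ?case
    by (auto intro!: psubset_card_mono)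
qed auto

declare outer_reduce.simps [simp del]

text \<open>\<open>cumK L R E F \<chi> \<pi> Z\<close> is \<open>\<K>\<^sub>\<pi>(Z)\<close>, with the dummy value \<open>0\<close> if \<open>\<pi>\<close> is not bi-non-crossing.\<close>

function cumK :: "('d \<Rightarrow> 'a) \<Rightarrow> ('d \<Rightarrow> 'a) \<Rightarrow> ('a \<Rightarrow> 'd) \<Rightarrow> ('a \<Rightarrow> 'd) \<Rightarrow> (nat \<Rightarrow> side) \<Rightarrow>
    nat set set \<Rightarrow> (nat \<Rightarrow> 'a::ring_1) \<Rightarrow> 'd::ring_1"
  where "cumK L R E F \<chi> \<pi> Z =
    (if \<pi> \<notin> BNC \<chi> (\<Union>\<pi>) then 0
     else if \<pi> = {\<Union>\<pi>}
       then F (oprod Z (\<Union>\<pi>)) - (\<Sum>\<sigma> \<in> BNC \<chi> (\<Union>\<pi>) - {\<pi>}. cumK L R E F \<chi> \<sigma> Z)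
     else prod_list (map (\<lambda>V.
         let V' = block_of \<pi> (chi_Min \<chi> V)
         in cumK L R E F \<chi> {V'} (outer_reduce L R E \<chi> V' {W \<in> \<pi>. W \<subseteq> V} Z))
       (outer_list \<chi> \<pi>)))"
  by pat_completeness auto
termination
proof (relation "measure (\<lambda>(L, R, E, F, \<chi>, \<pi>, Z).
    2 * card (\<Union>\<pi>) + (if \<pi> = {\<Union>\<pi>} then 1 else 0))", goal_cases)
  case (2 L R E F \<chi> \<pi> Z \<sigma>)
  have 1: "\<Union>\<sigma> = \<Union>\<pi>"
    using 2(3) by (intro BNC_Union[of _ \<chi>]) (rule DiffD1)
  have 2: "(\<sigma> = {\<Union>\<pi>}) = False" "(\<pi> = {\<Union>\<pi>}) = True"
    using 2(3) by (simp_all only: flip: 2(2)) simp_all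
  show ?case
    by (simp add: 1 2)
next
  case (3 L R E F \<chi> \<pi> Z V V')
  have bnc: "\<pi> \<in> BNC \<chi> (\<Union>\<pi>)" and ne: "\<pi> \<noteq> {\<Union>\<pi>}"
    using 3(1,2) by simp_all
  have V': "V' \<in> \<pi>"
    using outer_list_block[OF bnc 3(3)] 3(4) by simp
  have "V' \<subset> \<Union>\<pi>"
  proof (rule psubsetI)
    show "V' \<noteq> \<Union>\<pi>"
    proof
      assume eq: "V' = \<Union>\<pi>"
      have "W = V'" if "W \<in> \<pi>" for W
      proof (rule ccontr)
        assume "W \<noteq> V'"
        then have "W \<inter> V' = {}"
          using BNC_partition[OF bnc] that V' by (auto simp: partition_on_def disjoint_def)
        then have "W = {}"
          using eq that by blast
        then show False
          using BNC_partition[OF bnc] that by (auto simp: partition_on_def)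
      qed
      then show False
        using V' ne eq by blast
    qed
  qed (use V' in auto)
  moreover have "finite (\<Union>\<pi>)"
    using bnc by (simp add: BNC_def)
  ultimately have "card V' < card (\<Union>\<pi>)"
    by (rule psubset_card_mono[rotated])
  then show ?case
    using ne by simp
qed auto

declare cumK.simps [simp del]


section \<open>Grouping of indices\<close>

definition hat_chi :: "(nat \<Rightarrow> nat) \<Rightarrow> nat \<Rightarrow> (nat \<Rightarrow> side) \<Rightarrow> nat \<Rightarrow> side"
  where "hat_chi k m \<chi> q = \<chi> (THE p. p \<in> {1..m} \<and> k (p - 1) < q \<and> q \<le> k p)"

definition hat_zero :: "(nat \<Rightarrow> nat) \<Rightarrow> nat \<Rightarrow> nat set set"
  where "hat_zero k m = (\<lambda>p. {k (p - 1) + 1..k p}) ` {1..m}"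

end

theory Submission
  imports Defs
begin

text \<open>
  Read along \<open>\<prec>\<^sub>\<chi>\<close>, a bi-non-crossing partition is a nested non-crossing one: a block that is a
  \<open>\<chi>\<close>-interval can be evaluated and inserted behind its predecessor, as \<open>L\<^sub>c\<close> on the left and as
  \<open>R\<^sub>c\<close> on the right, and the order of these insertions does not matter.  Hence moments and both
  kinds of cumulants are nested evaluations of functionals on single blocks, related by
  \<open>\<E>\<^sub>\<pi> = \<Sum>\<^bsub>\<sigma> \<le> \<pi>\<^esub> \<kappa>\<^sub>\<sigma>\<close> and \<open>F(Z\<^sub>1 \<cdots> Z\<^sub>n) = \<Sum>\<^bsub>\<sigma>\<^esub> \<K>\<^sub>\<sigma>\<close>.  Since products of entries do not change the moments
  of the whole word, the product formula follows by induction: group the partitions \<open>\<sigma>\<close> by the join \<open>\<pi>\<close> of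
  \<open>\<sigma>\<close> with the partition into groups; by multiplicativity of nested evaluation the part belonging
  to \<open>\<pi> \<noteq> 1\<close> is the cumulant of the products for \<open>\<pi>\<close>, and what remains is the claim.
\<close>

section \<open>The order of a side map\<close>

text \<open>The definitions prescribe different orders of removal. Moments and conditional cumulants
  remove the block with the largest minimum in the usual order, \<open>ev\<close> the one with the
  largest chi-minimum, so that outer blocks split off as right factors; \<open>ev_remove\<close>
  reconciles the two. The recursion of the moments multiplies an operator of the side of
  \<open>V\<close> onto an entry that may belong to the other side. The result can leave its face,
  and then no law about \<open>ev\<close> covers it. The operator is therefore given an index of its
  own, which is merged into the neighbouring block and later split off as a singleton. Outer blocks
  are evaluated through \<open>F\<close> with values in \<open>D\<close>, nested ones through
  \<open>E\<close> with values in \<open>B\<close>. When the blocks of a partition are refined, a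
  nested block must not come to lie outside. This holds because the partitions in the product
  formula are connected modulo the groups: they cannot be cut between two groups.\<close>

definition key :: "(nat \<Rightarrow> side) \<Rightarrow> nat \<Rightarrow> real"
  where "key \<chi> i = (case \<chi> i of Lft \<Rightarrow> - 1 / (real i + 1) | Rgt \<Rightarrow> 1 / (real i + 1))"

text \<open>Left indices get negative reals increasing in the index, right indices positive reals
  decreasing in it. The chi-order becomes the order of the reals, and a cut between indices can be
  named by a real number.\<close>

lemma chi_less_key: "chi_less \<chi> i j \<longleftrightarrow> key \<chi> i < key \<chi> j"
proof -
  have 1: "- 1 / (real a + 1) < 1 / (real b + 1)" for a b
    by (rule less_trans[of _ 0]) (auto simp: field_simps)
  have 2: "1 / (real a + 1) < 1 / (real b + 1) \<longleftrightarrow> b < a" for a b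
    by (auto simp: field_simps)
  have 3: "- 1 / (real a + 1) < - 1 / (real b + 1) \<longleftrightarrow> a < b" for a b
    by (auto simp: field_simps)
  show ?thesis
    using 1 1[THEN less_asym] unfolding chi_less_def key_def
    by (auto simp: 2 3 split: side.splits)
qed

lemma key_eq_iff [simp]: "key \<chi> i = key \<chi> j \<longleftrightarrow> i = j"
  using chi_less_total[of i j \<chi>] by (cases "i = j") (auto simp: chi_less_key)

lemma chi_Min_key:
  assumes "finite V" "V \<noteq> {}"
  shows "chi_Min \<chi> V \<in> V" and "w \<in> V \<Longrightarrow> key \<chi> (chi_Min \<chi> V) \<le> key \<chi> w"
  using chi_Min[OF assms, where \<chi> = \<chi>] by (force simp: chi_less_key order_le_less)+

lemma chi_Max_key:
  assumes "finite V" "V \<noteq> {}"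
  shows "chi_Max \<chi> V \<in> V" and "w \<in> V \<Longrightarrow> key \<chi> w \<le> key \<chi> (chi_Max \<chi> V)"
  using chi_Max[OF assms, where \<chi> = \<chi>] by (force simp: chi_less_key order_le_less)+

lemma chi_Min_eq:
  assumes "v \<in> V" "\<And>w. w \<in> V \<Longrightarrow> key \<chi> v \<le> key \<chi> w"
  shows "chi_Min \<chi> V = v"
proof (rule chi_Min_unique[OF assms(1)])
  fix w assume "w \<in> V" "w \<noteq> v"
  then show "chi_less \<chi> v w"
    using assms(2)[of w] by (simp add: chi_less_key order_le_less)
qed

lemma chi_Max_eq:
  assumes "v \<in> V" "\<And>w. w \<in> V \<Longrightarrow> key \<chi> w \<le> key \<chi> v"
  shows "chi_Max \<chi> V = v"
proof (rule chi_Max_unique[OF assms(1)])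
  fix w assume "w \<in> V" "w \<noteq> v"
  then show "chi_less \<chi> w v"
    using assms(2)[of w] by (simp add: chi_less_key order_le_less)
qed

lemma chi_intervalD:
  "chi_interval \<chi> S V \<Longrightarrow> a \<in> V \<Longrightarrow> c \<in> V \<Longrightarrow> b \<in> S \<Longrightarrow> key \<chi> a < key \<chi> b \<Longrightarrow> key \<chi> b < key \<chi> c \<Longrightarrow> b \<in> V"
  unfolding chi_interval_def chi_less_key by blast

lemma chi_intervalI:
  assumes "V \<subseteq> S"
    and "\<And>a b c. a \<in> V \<Longrightarrow> c \<in> V \<Longrightarrow> b \<in> S \<Longrightarrow> key \<chi> a < key \<chi> b \<Longrightarrow> key \<chi> b < key \<chi> c \<Longrightarrow> b \<in> V"
  shows "chi_interval \<chi> S V"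
  unfolding chi_interval_def chi_less_key using assms by blast

lemma chi_interval_mono:
  "chi_interval \<chi> S V \<Longrightarrow> T \<subseteq> S \<Longrightarrow> V \<subseteq> T \<Longrightarrow> chi_interval \<chi> T V"
  unfolding chi_interval_def by blast

lemma chi_interval_trans:
  assumes "chi_interval \<chi> S U" "chi_interval \<chi> U V"
  shows "chi_interval \<chi> S V"
  using assms unfolding chi_interval_def by blast

section \<open>Intervals and predecessors\<close>

definition before :: "(nat \<Rightarrow> side) \<Rightarrow> nat set \<Rightarrow> nat set \<Rightarrow> bool"
  where "before \<chi> S T \<longleftrightarrow> (\<forall>s\<in>S. \<forall>t\<in>T. key \<chi> s < key \<chi> t)"

lemma beforeI: "(\<And>s t. s \<in> S \<Longrightarrow> t \<in> T \<Longrightarrow> key \<chi> s < key \<chi> t) \<Longrightarrow> before \<chi> S T"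
  by (simp add: before_def)

lemma beforeD: "before \<chi> S T \<Longrightarrow> s \<in> S \<Longrightarrow> t \<in> T \<Longrightarrow> key \<chi> s < key \<chi> t"
  by (simp add: before_def)

lemma before_mono: "before \<chi> S T \<Longrightarrow> S' \<subseteq> S \<Longrightarrow> T' \<subseteq> T \<Longrightarrow> before \<chi> S' T'"
  unfolding before_def by blast

lemma before_interval:
  assumes "chi_interval \<chi> S V" "s \<in> S - V" "v \<in> V" "key \<chi> s < key \<chi> v"
  shows "before \<chi> {s} V"
proof (rule beforeI)
  fix s' t assume "s' \<in> {s}" "t \<in> V"
  then show "key \<chi> s' < key \<chi> t"
    using chi_intervalD[OF assms(1), of t v s] assms(2-) key_eq_iff[of \<chi> s t]
    by (cases "key \<chi> s" "key \<chi> t" rule: linorder_cases) auto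
qed

lemma after_interval:
  assumes "chi_interval \<chi> S V" "s \<in> S - V" "v \<in> V" "key \<chi> v < key \<chi> s"
  shows "before \<chi> V {s}"
proof (rule beforeI)
  fix t s' assume "s' \<in> {s}" "t \<in> V"
  then show "key \<chi> t < key \<chi> s'"
    using chi_intervalD[OF assms(1), of v t s] assms(2-) key_eq_iff[of \<chi> s t]
    by (cases "key \<chi> s" "key \<chi> t" rule: linorder_cases) auto
qed

lemma interval_cases:
  assumes "chi_interval \<chi> S V" "s \<in> S - V"
  shows "before \<chi> {s} V \<or> before \<chi> V {s}"
proof (cases "V = {}")
  case False
  then obtain v where "v \<in> V" by blast
  moreover have "key \<chi> s \<noteq> key \<chi> v"
    using assms \<open>v \<in> V\<close> by auto
  ultimately show ?thesis
    using before_interval[OF assms] after_interval[OF assms] by (meson linorder_neqE)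
qed (simp add: before_def)

definition is_pred :: "(nat \<Rightarrow> side) \<Rightarrow> nat set \<Rightarrow> nat set \<Rightarrow> nat \<Rightarrow> bool"
  where "is_pred \<chi> S V p \<longleftrightarrow> p \<in> S \<and> before \<chi> {p} V \<and>
    (\<forall>s\<in>S. before \<chi> {s} V \<longrightarrow> key \<chi> s \<le> key \<chi> p)"

text \<open>The formula is the one in \<open>outer_reduce\<close>. Proofs use its characterisation
  \<open>is_pred\<close>, which holds for no \<open>p\<close> when nothing lies before
  \<open>V\<close>.\<close>

definition chi_pred :: "(nat \<Rightarrow> side) \<Rightarrow> nat set \<Rightarrow> nat set \<Rightarrow> nat"
  where "chi_pred \<chi> S V = chi_Max \<chi> {j \<in> S. chi_less \<chi> j (chi_Min \<chi> V)}"

lemma below_chi_Min: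
  assumes "finite V" "V \<noteq> {}"
  shows "{j \<in> S. chi_less \<chi> j (chi_Min \<chi> V)} = {j \<in> S. before \<chi> {j} V}"
proof -
  have "chi_less \<chi> j (chi_Min \<chi> V) \<longleftrightarrow> before \<chi> {j} V" for j
    unfolding chi_less_key before_def
    using chi_Min_key[OF assms, where \<chi> = \<chi>] by (auto intro: less_le_trans)
  then show ?thesis by simp
qed

lemma chi_pred_eq:
  assumes "finite V" "V \<noteq> {}" "is_pred \<chi> S V p"
  shows "chi_pred \<chi> S V = p"
  using assms(3) unfolding chi_pred_def below_chi_Min[OF assms(1,2)]
  by (intro chi_Max_eq) (auto simp: is_pred_def)

lemma is_pred_exists:
  assumes "finite S" "s \<in> S" "before \<chi> {s} V"
  obtains p where "is_pred \<chi> S V p"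
proof -
  let ?P = "{s \<in> S. before \<chi> {s} V}"
  have P: "finite ?P" "?P \<noteq> {}" using assms by auto
  have "is_pred \<chi> S V (chi_Max \<chi> ?P)"
    using chi_Max_key[OF P, where \<chi> = \<chi>] unfolding is_pred_def by auto
  then show ?thesis by (rule that)
qed

lemma is_pred_notin: "is_pred \<chi> S V p \<Longrightarrow> p \<notin> V"
  unfolding is_pred_def before_def by auto

section \<open>Bi-non-crossing partitions\<close>

lemma BNC_block:
  assumes "\<sigma> \<in> BNC \<chi> S" "V \<in> \<sigma>"
  shows "V \<noteq> {}" "finite V" "V \<subseteq> S"
  using assms unfolding BNC_def partition_on_def by (auto intro: finite_subset)

lemma BNC_finite: "\<sigma> \<in> BNC \<chi> S \<Longrightarrow> finite S"
  by (simp add: BNC_def)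

lemma BNC_finite_blocks: "\<sigma> \<in> BNC \<chi> S \<Longrightarrow> finite \<sigma>"
  by (auto simp: BNC_def intro: finite_elements)

lemma BNC_disjoint: "\<sigma> \<in> BNC \<chi> S \<Longrightarrow> V \<in> \<sigma> \<Longrightarrow> W \<in> \<sigma> \<Longrightarrow> x \<in> V \<Longrightarrow> x \<in> W \<Longrightarrow> V = W"
  by (auto dest!: BNC_partition partition_onD2 dest: disjointD)

lemma BNC_obtain_block:
  assumes "\<sigma> \<in> BNC \<chi> S" "x \<in> S"
  obtains V where "V \<in> \<sigma>" "x \<in> V"
  using assms BNC_Union by blast

lemma BNC_cross:
  assumes "\<sigma> \<in> BNC \<chi> S" "V \<in> \<sigma>" "W \<in> \<sigma>" "a \<in> V" "b \<in> W" "c \<in> V" "d \<in> W"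
    and "key \<chi> a < key \<chi> b" "key \<chi> b < key \<chi> c" "key \<chi> c < key \<chi> d"
  shows "V = W"
  using BNC_noncrossing[OF assms(1-3) _ assms(4-7)] assms(8-) unfolding chi_less_key by blast

lemma BNC_key_I:
  assumes "finite S" "\<Union>\<sigma> = S" "{} \<notin> \<sigma>"
    and "\<And>V W x. V \<in> \<sigma> \<Longrightarrow> W \<in> \<sigma> \<Longrightarrow> x \<in> V \<Longrightarrow> x \<in> W \<Longrightarrow> V = W"
    and "\<And>V W a b c d. \<lbrakk>V \<in> \<sigma>; W \<in> \<sigma>; a \<in> V; b \<in> W; c \<in> V; d \<in> W;
      key \<chi> a < key \<chi> b; key \<chi> b < key \<chi> c; key \<chi> c < key \<chi> d\<rbrakk> \<Longrightarrow> V = W"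
  shows "\<sigma> \<in> BNC \<chi> S"
proof (rule BNC_I)
  show "partition_on S \<sigma>"
    unfolding partition_on_def disjoint_def using assms(2-4) by blast
  show "\<not> (chi_less \<chi> a b \<and> chi_less \<chi> b c \<and> chi_less \<chi> c d)"
    if "V \<in> \<sigma>" "W \<in> \<sigma>" "V \<noteq> W" "a \<in> V" "b \<in> W" "c \<in> V" "d \<in> W" for V W a b c d
    using assms(5)[of V W a b c d] that unfolding chi_less_key by blast
qed (fact assms(1))

lemma BNC_subset:
  assumes "\<sigma> \<in> BNC \<chi> S" "\<rho> \<subseteq> \<sigma>"
  shows "\<rho> \<in> BNC \<chi> (\<Union>\<rho>)"
proof (rule BNC_key_I)
  show "finite (\<Union>\<rho>)"
    using assms BNC_block(2,3)[OF assms(1)] BNC_finite[OF assms(1)]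
    by (meson Sup_le_iff finite_subset subsetD)
  show "{} \<notin> \<rho>" using assms BNC_block(1) by blast
  show "V = W" if "V \<in> \<rho>" "W \<in> \<rho>" "x \<in> V" "x \<in> W" for V W x
    using BNC_disjoint[OF assms(1)] that assms(2) by blast
  show "V = W" if "V \<in> \<rho>" "W \<in> \<rho>" "a \<in> V" "b \<in> W" "c \<in> V" "d \<in> W"
    "key \<chi> a < key \<chi> b" "key \<chi> b < key \<chi> c" "key \<chi> c < key \<chi> d" for V W a b c d
    using BNC_cross[OF assms(1)] that assms(2) by blast
qed simp

lemma BNC_remove:
  assumes "\<sigma> \<in> BNC \<chi> S" "V \<in> \<sigma>"
  shows "\<sigma> - {V} \<in> BNC \<chi> (S - V)"
proof -
  have "\<Union>(\<sigma> - {V}) = S - V"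
    using BNC_Union[OF assms(1)] BNC_disjoint[OF assms(1)] assms(2) by auto
  then show ?thesis
    using BNC_subset[OF assms(1), of "\<sigma> - {V}"] by auto
qed

lemma BNC_empty [simp]: "{} \<in> BNC \<chi> {}"
  by (rule BNC_key_I) auto

lemma BNC_empty_iff: "\<sigma> \<in> BNC \<chi> S \<Longrightarrow> \<sigma> = {} \<longleftrightarrow> S = {}"
  using BNC_Union BNC_block(1) by fastforce

lemma BNC_single: "finite S \<Longrightarrow> S \<noteq> {} \<Longrightarrow> {S} \<in> BNC \<chi> S"
  by (rule BNC_key_I) auto

section \<open>The block with the largest chi-minimum, and nesting\<close>

definition is_last :: "(nat \<Rightarrow> side) \<Rightarrow> nat set set \<Rightarrow> nat set \<Rightarrow> bool"
  where "is_last \<chi> \<sigma> U \<longleftrightarrow> U \<in> \<sigma> \<and> (\<forall>W\<in>\<sigma>. W \<noteq> U \<longrightarrow> (\<exists>w\<in>W. before \<chi> {w} U))"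

lemma is_last_in: "is_last \<chi> \<sigma> U \<Longrightarrow> U \<in> \<sigma>"
  by (simp add: is_last_def)

lemma is_lastE:
  assumes "is_last \<chi> \<sigma> U" "W \<in> \<sigma>" "W \<noteq> U"
  obtains w where "w \<in> W" "before \<chi> {w} U"
  using assms unfolding is_last_def by blast

lemma is_last_exists:
  assumes "\<sigma> \<in> BNC \<chi> S" "\<sigma> \<noteq> {}"
  obtains U where "is_last \<chi> \<sigma> U"
proof -
  have fin: "finite \<sigma>" using BNC_finite_blocks[OF assms(1)] .
  obtain U where U: "U \<in> \<sigma>" "\<And>W. W \<in> \<sigma> \<Longrightarrow> key \<chi> (chi_Min \<chi> W) \<le> key \<chi> (chi_Min \<chi> U)"
  proof -
    let ?f = "\<lambda>W. key \<chi> (chi_Min \<chi> W)"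
    obtain U where "U \<in> \<sigma>" "Max (?f ` \<sigma>) = ?f U" using obtains_MAX[OF fin assms(2)] by blast
    then show ?thesis using that[of U] Max_ge[of "?f ` \<sigma>"] fin by simp
  qed
  have "is_last \<chi> \<sigma> U"
    unfolding is_last_def
  proof (intro conjI ballI impI)
    fix W assume W: "W \<in> \<sigma>" "W \<noteq> U"
    note blk = BNC_block[OF assms(1)]
    have m: "chi_Min \<chi> W \<in> W" "chi_Min \<chi> U \<in> U"
      using chi_Min_key(1) blk W(1) U(1) by auto
    then have "chi_Min \<chi> W \<noteq> chi_Min \<chi> U"
      using BNC_disjoint[OF assms(1) W(1) U(1)] W(2) by metis
    then have "key \<chi> (chi_Min \<chi> W) < key \<chi> (chi_Min \<chi> U)"
      using U(2)[OF W(1)] by (simp add: order_le_less)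
    then have "before \<chi> {chi_Min \<chi> W} U"
      using chi_Min_key(2)[of U _ \<chi>] blk U(1) by (auto simp: before_def intro: less_le_trans)
    with m show "\<exists>w\<in>W. before \<chi> {w} U" by blast
  qed (fact U)
  then show ?thesis by (rule that)
qed

lemma is_last_unique:
  assumes "\<sigma> \<in> BNC \<chi> S" "is_last \<chi> \<sigma> U" "is_last \<chi> \<sigma> W"
  shows "U = W"
proof (rule ccontr)
  assume neq: "U \<noteq> W"
  obtain w where w: "w \<in> W" "before \<chi> {w} U"
    using is_lastE[OF assms(2) is_last_in[OF assms(3)]] neq by blast
  obtain u where u: "u \<in> U" "before \<chi> {u} W"
    using is_lastE[OF assms(3) is_last_in[OF assms(2)]] neq by blast
  show False
    using beforeD[OF w(2), of w u] beforeD[OF u(2), of u w] w(1) u(1) by simp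
qed

text \<open>An index of another block \<open>W\<close> between two elements of \<open>U\<close>,
  together with the element of \<open>W\<close> before \<open>U\<close> that \<open>is_last\<close>
  provides, would make \<open>W\<close> cross \<open>U\<close>.\<close>

lemma is_last_interval:
  assumes "\<sigma> \<in> BNC \<chi> S" "is_last \<chi> \<sigma> U"
  shows "chi_interval \<chi> S U"
proof (rule chi_intervalI)
  show "U \<subseteq> S" using BNC_block(3)[OF assms(1) is_last_in[OF assms(2)]] .
  fix a b c assume *: "a \<in> U" "c \<in> U" "b \<in> S" "key \<chi> a < key \<chi> b" "key \<chi> b < key \<chi> c"
  show "b \<in> U"
  proof (rule ccontr)
    assume "b \<notin> U"
    obtain W where W: "W \<in> \<sigma>" "b \<in> W"
      using BNC_obtain_block[OF assms(1) \<open>b \<in> S\<close>] .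
    obtain w where w: "w \<in> W" "before \<chi> {w} U"
      using is_lastE[OF assms(2) W(1)] W(2) \<open>b \<notin> U\<close> by blast
    have "W = U"
      using BNC_cross[OF assms(1) W(1) is_last_in[OF assms(2)] w(1) *(1) W(2) *(2)]
        beforeD[OF w(2), of w a] *(1,4,5) by simp
    with W \<open>b \<notin> U\<close> show False by simp
  qed
qed

lemma is_last_remove: "is_last \<chi> \<sigma> U \<Longrightarrow> V \<noteq> U \<Longrightarrow> is_last \<chi> (\<sigma> - {V}) U"
  unfolding is_last_def by blast

text \<open>Nested blocks are those to be evaluated by the inner functional.\<close>

definition nested :: "(nat \<Rightarrow> side) \<Rightarrow> nat set set \<Rightarrow> nat set \<Rightarrow> bool"
  where "nested \<chi> \<sigma> V \<longleftrightarrow> (\<exists>W\<in>\<sigma>. \<exists>w\<in>W. \<exists>w'\<in>W. before \<chi> {w} V \<and> before \<chi> V {w'})"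

text \<open>The block of an index after \<open>U\<close> also has an element before
  \<open>U\<close>, because \<open>U\<close> is last. So a last block that is not final is enclosed
  by another one.\<close>

lemma last_nested:
  assumes "\<sigma> \<in> BNC \<chi> S" "is_last \<chi> \<sigma> U" "\<not> before \<chi> (S - U) U"
  shows "nested \<chi> (\<sigma> - {U}) U"
proof -
  obtain s where s: "s \<in> S - U" "\<not> before \<chi> {s} U"
    using assms(3) unfolding before_def by blast
  then have s': "before \<chi> U {s}"
    using interval_cases[OF is_last_interval[OF assms(1,2)] s(1)] by blast
  obtain W where W: "W \<in> \<sigma>" "s \<in> W"
    using BNC_obtain_block[OF assms(1)] s(1) by blast
  obtain w where "w \<in> W" "before \<chi> {w} U"
    using is_lastE[OF assms(2) W(1)] W(2) s(1) by blast
  with W show ?thesis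
    unfolding nested_def using s s' by (intro bexI[of _ W] bexI[of _ w] bexI[of _ s]) auto
qed

lemma nested_last:
  assumes "is_last \<chi> \<sigma> U" "nested \<chi> (\<sigma> - {V}) V" "V \<in> \<sigma>" "V \<noteq> U"
  shows "nested \<chi> (\<sigma> - {U} - {V}) V"
proof -
  obtain W w w' where W: "W \<in> \<sigma> - {V}" "w \<in> W" "w' \<in> W" "before \<chi> {w} V" "before \<chi> V {w'}"
    using assms(2) unfolding nested_def by blast
  obtain v where v: "v \<in> V" "before \<chi> {v} U"
    using is_lastE[OF assms(1,3,4)] by blast
  have "W \<noteq> U"
  proof
    assume "W = U"
    then show False
      using beforeD[OF v(2), of v w] beforeD[OF W(4), of w v] v(1) W(2) by simp
  qed
  with W show ?thesis
    unfolding nested_def by (intro bexI[of _ W] bexI[of _ w] bexI[of _ w']) auto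
qed

text \<open>A crossing of \<open>T\<close> with a block of the second partition is in particular a
  crossing with the set \<open>U\<close>, so it suffices to test \<open>T\<close> against
  \<open>U\<close> as a whole.\<close>

lemma BNC_glue:
  assumes "\<sigma> \<in> BNC \<chi> S" "\<tau> \<in> BNC \<chi> U" "S \<inter> U = {}"
    and cross: "\<And>T a b c d. \<lbrakk>T \<in> \<sigma>; a \<in> T; c \<in> T; b \<in> U; d \<in> U\<rbrakk> \<Longrightarrow>
      \<not> (key \<chi> a < key \<chi> b \<and> key \<chi> b < key \<chi> c \<and> key \<chi> c < key \<chi> d) \<and>
      \<not> (key \<chi> b < key \<chi> a \<and> key \<chi> a < key \<chi> d \<and> key \<chi> d < key \<chi> c)"
  shows "\<sigma> \<union> \<tau> \<in> BNC \<chi> (S \<union> U)"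
proof (rule BNC_key_I)
  note blk = BNC_block[OF assms(1)] BNC_block[OF assms(2)]
  show "finite (S \<union> U)" using BNC_finite assms(1,2) by auto
  show "\<Union> (\<sigma> \<union> \<tau>) = S \<union> U" using BNC_Union[OF assms(1)] BNC_Union[OF assms(2)] by auto
  show "{} \<notin> \<sigma> \<union> \<tau>" using blk(1,4) by blast
  show "V = W" if "V \<in> \<sigma> \<union> \<tau>" "W \<in> \<sigma> \<union> \<tau>" "x \<in> V" "x \<in> W" for V W x
    using that BNC_disjoint[OF assms(1)] BNC_disjoint[OF assms(2)] blk(3,6) assms(3) by blast
  fix V W a b c d
  assume *: "V \<in> \<sigma> \<union> \<tau>" "W \<in> \<sigma> \<union> \<tau>" "a \<in> V" "b \<in> W" "c \<in> V" "d \<in> W"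
    "key \<chi> a < key \<chi> b" "key \<chi> b < key \<chi> c" "key \<chi> c < key \<chi> d"
  consider "V \<in> \<sigma>" "W \<in> \<sigma>" | "V \<in> \<tau>" "W \<in> \<tau>" | "V \<in> \<sigma>" "W \<in> \<tau>" | "V \<in> \<tau>" "W \<in> \<sigma>"
    using * by blast
  then show "V = W"
  proof cases
    case 1 then show ?thesis using BNC_cross[OF assms(1) _ _ *(3-)] by blast
  next
    case 2 then show ?thesis using BNC_cross[OF assms(2) _ _ *(3-)] by blast
  next
    case 3
    then have "b \<in> U" "d \<in> U" using blk(6) * by auto
    then show ?thesis using cross[OF 3(1) *(3,5)] *(7-) by blast
  next
    case 4
    then have "a \<in> U" "c \<in> U" using blk(6) * by auto
    then show ?thesis using cross[OF 4(2) *(4,6)] *(7-) by blast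
  qed
qed

lemma BNC_refine:
  assumes "\<pi> \<in> BNC \<chi> P" "V \<in> \<pi>" "\<rho> \<in> BNC \<chi> V"
  shows "(\<pi> - {V}) \<union> \<rho> \<in> BNC \<chi> P"
proof -
  have "(\<pi> - {V}) \<union> \<rho> \<in> BNC \<chi> ((P - V) \<union> V)"
  proof (rule BNC_glue[OF BNC_remove[OF assms(1,2)] assms(3)])
    fix T a b c d
    assume *: "T \<in> \<pi> - {V}" "a \<in> T" "c \<in> T" "b \<in> V" "d \<in> V"
    then show "\<not> (key \<chi> a < key \<chi> b \<and> key \<chi> b < key \<chi> c \<and> key \<chi> c < key \<chi> d) \<and>
      \<not> (key \<chi> b < key \<chi> a \<and> key \<chi> a < key \<chi> d \<and> key \<chi> d < key \<chi> c)"
      using BNC_cross[OF assms(1) _ assms(2) *(2,4,3,5)] BNC_cross[OF assms(1,2) _ *(4,2,5,3)]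
      by blast
  qed auto
  then show ?thesis
    using BNC_block(3)[OF assms(1,2)] by (simp add: Un_absorb2)
qed

lemma BNC_restrict:
  assumes "\<pi> \<in> BNC \<chi> P" "V \<subseteq> P"
  shows "(\<lambda>W. V \<inter> W) ` \<pi> - {{}} \<in> BNC \<chi> V"
proof (rule BNC_key_I)
  show "finite V" using BNC_finite[OF assms(1)] assms(2) finite_subset by blast
  show "\<Union> ((\<lambda>W. V \<inter> W) ` \<pi> - {{}}) = V" using BNC_Union[OF assms(1)] assms(2) by blast
  show "X = Y" if "X \<in> (\<lambda>W. V \<inter> W) ` \<pi> - {{}}" "Y \<in> (\<lambda>W. V \<inter> W) ` \<pi> - {{}}" "x \<in> X" "x \<in> Y" for X Y x
    using that BNC_disjoint[OF assms(1)] by blast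
  show "X = Y" if *: "X \<in> (\<lambda>W. V \<inter> W) ` \<pi> - {{}}" "Y \<in> (\<lambda>W. V \<inter> W) ` \<pi> - {{}}"
    "a \<in> X" "b \<in> Y" "c \<in> X" "d \<in> Y" "key \<chi> a < key \<chi> b" "key \<chi> b < key \<chi> c" "key \<chi> c < key \<chi> d"
  for X Y a b c d
  proof -
    obtain X' Y' where XY: "X' \<in> \<pi>" "X = V \<inter> X'" "Y' \<in> \<pi>" "Y = V \<inter> Y'"
      using *(1,2) by blast
    then have "X' = Y'"
      using BNC_cross[OF assms(1) XY(1,3), of a b c d] * by blast
    with XY show ?thesis by simp
  qed
qed simp

lemma BNC_psubset:
  assumes "\<sigma> \<in> BNC \<chi> S" "\<sigma> \<noteq> {S}" "V \<in> \<sigma>"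
  shows "V \<subset> S"
proof (rule psubsetI)
  show "V \<noteq> S"
  proof
    assume "V = S"
    then have "W = S" if "W \<in> \<sigma>" for W
      using BNC_block[OF assms(1) that] BNC_disjoint[OF assms(1) that assms(3)] by blast
    then show False using assms(2,3) \<open>V = S\<close> by blast
  qed
qed (rule BNC_block(3)[OF assms(1,3)])

text \<open>Follows the recursion of \<open>ev\<close>, so that proofs about it only have to treat a
  final and a nested last block.\<close>

lemma BNC_last_induct [consumes 1, case_names empty step]:
  assumes "\<sigma> \<in> BNC \<chi> S"
    and "P {} {}"
    and "\<And>\<sigma> S U. \<sigma> \<in> BNC \<chi> S \<Longrightarrow> is_last \<chi> \<sigma> U \<Longrightarrow> \<sigma> - {U} \<in> BNC \<chi> (S - U) \<Longrightarrow>
      P (\<sigma> - {U}) (S - U) \<Longrightarrow> P \<sigma> S"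
  shows "P \<sigma> S"
  using assms(1)
proof (induction "card \<sigma>" arbitrary: \<sigma> S)
  case 0
  then have "\<sigma> = {}"
    using BNC_finite_blocks by fastforce
  then show ?case
    using 0 assms(2) BNC_empty_iff[of \<sigma> \<chi> S] by simp
next
  case (Suc k)
  then have "\<sigma> \<noteq> {}" by auto
  then obtain U where U: "is_last \<chi> \<sigma> U"
    using is_last_exists[OF Suc.prems] by blast
  have "card (\<sigma> - {U}) = k"
    using Suc.hyps(2) is_last_in[OF U] BNC_finite_blocks[OF Suc.prems] by simp
  then show ?case
    using Suc.hyps(1) BNC_remove[OF Suc.prems is_last_in[OF U]] assms(3)[OF Suc.prems U] by blast
qed

lemma last_pred:
  assumes "\<sigma> \<in> BNC \<chi> S" "is_last \<chi> \<sigma> U" "S - U \<noteq> {}"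
  obtains p where "is_pred \<chi> S U p"
proof -
  obtain s where s: "s \<in> S - U" using assms(3) by blast
  obtain W where W: "W \<in> \<sigma>" "s \<in> W"
    using BNC_obtain_block[OF assms(1)] s by blast
  obtain w where "w \<in> W" "before \<chi> {w} U"
    using is_lastE[OF assms(2) W(1)] W(2) s by blast
  then show ?thesis
    using is_pred_exists[OF BNC_finite[OF assms(1)], of w \<chi> U] BNC_block(3)[OF assms(1) W(1)] that
    by blast
qed

lemma before_not_nested:
  assumes "before \<chi> (S - U) U" "U \<noteq> {}" "\<sigma> \<in> BNC \<chi> (S - U)"
  shows "\<not> nested \<chi> \<sigma> U"
proof
  assume "nested \<chi> \<sigma> U"
  then obtain W w where W: "W \<in> \<sigma>" "w \<in> W" "before \<chi> U {w}"
    unfolding nested_def by blast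
  obtain u where "u \<in> U" using assms(2) by blast
  moreover have "w \<in> S - U" using W BNC_block(3)[OF assms(3)] by blast
  ultimately show False
    using beforeD[OF W(3), of u w] beforeD[OF assms(1), of w u] by simp
qed


section \<open>Nested evaluation\<close>

text \<open>The tensor product enters only through these rules. Additivity is recorded rather than
  linearity, since only plain sums are ever expanded inside an argument.\<close>

locale bifree_ops =
  fixes L R :: "'d::ring_1 \<Rightarrow> 'a::ring_1" and B :: "'d set"
  assumes B_0: "0 \<in> B" and B_1: "1 \<in> B"
    and B_add: "b \<in> B \<Longrightarrow> c \<in> B \<Longrightarrow> b + c \<in> B"
    and B_diff: "b \<in> B \<Longrightarrow> c \<in> B \<Longrightarrow> b - c \<in> B"
    and B_mult: "b \<in> B \<Longrightarrow> c \<in> B \<Longrightarrow> b * c \<in> B"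
    and L_1: "L 1 = 1" and R_1: "R 1 = 1"
    and L_add: "b \<in> B \<Longrightarrow> c \<in> B \<Longrightarrow> L (b + c) = L b + L c"
    and R_add: "b \<in> B \<Longrightarrow> c \<in> B \<Longrightarrow> R (b + c) = R b + R c"
    and L_mult: "b \<in> B \<Longrightarrow> c \<in> B \<Longrightarrow> L (b * c) = L b * L c"
    and R_mult: "b \<in> B \<Longrightarrow> c \<in> B \<Longrightarrow> R (b * c) = R c * R b"
    and LR_commute: "b \<in> B \<Longrightarrow> c \<in> B \<Longrightarrow> L b * R c = R c * L b"
begin

definition ins :: "(nat \<Rightarrow> side) \<Rightarrow> nat \<Rightarrow> 'd \<Rightarrow> (nat \<Rightarrow> 'a) \<Rightarrow> nat \<Rightarrow> 'a"
  where "ins \<chi> p c Z = Z(p := (case \<chi> p of Lft \<Rightarrow> Z p * L c | Rgt \<Rightarrow> R c * Z p))"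

definition adm :: "(nat \<Rightarrow> side) \<Rightarrow> nat set \<Rightarrow> (nat \<Rightarrow> 'a) \<Rightarrow> bool"
  where "adm \<chi> S Z \<longleftrightarrow> (\<forall>q\<in>S. Z q \<in> face L R B (\<chi> q))"

lemma ins_other [simp]: "q \<noteq> p \<Longrightarrow> ins \<chi> p c Z q = Z q"
  by (simp add: ins_def)

lemma ins_notin: "p \<notin> V \<Longrightarrow> x \<in> V \<Longrightarrow> ins \<chi> p c Z x = Z x"
  by (auto simp: ins_def)

text \<open>On the right, \<open>R c * R b = R (b * c)\<close> because \<open>R\<close> reverses
  products; so insertions compose in the same order on both sides.\<close>

lemma ins_ins: "b \<in> B \<Longrightarrow> c \<in> B \<Longrightarrow> ins \<chi> p c (ins \<chi> p b Z) = ins \<chi> p (b * c) Z"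
  by (auto simp: ins_def L_mult R_mult mult.assoc split: side.splits)

lemma ins_commute: "p \<noteq> q \<Longrightarrow> ins \<chi> p c (ins \<chi> q b Z) = ins \<chi> q b (ins \<chi> p c Z)"
  by (rule ext) (auto simp: ins_def split: side.splits)

lemma ins_add: "b \<in> B \<Longrightarrow> c \<in> B \<Longrightarrow> ins \<chi> p (b + c) Z = Z(p := ins \<chi> p b Z p + ins \<chi> p c Z p)"
  by (auto simp: ins_def L_add R_add algebra_simps split: side.splits)

lemma ins_same_upd: "ins \<chi> p c Z = Z(p := ins \<chi> p c Z p)"
  by (auto simp: ins_def)

lemma ins_upd_other: "p \<noteq> q \<Longrightarrow> ins \<chi> p c (Z(q := a)) = (ins \<chi> p c Z)(q := a)"
  by (rule ext) (auto simp: ins_def split: side.splits)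

lemma ins_upd_same_add:
  "ins \<chi> p c (Z(p := a + a')) = Z(p := ins \<chi> p c (Z(p := a)) p + ins \<chi> p c (Z(p := a')) p)"
  by (auto simp: ins_def algebra_simps split: side.splits)

lemma ins_upd_same: "ins \<chi> p c (Z(p := a)) = Z(p := ins \<chi> p c (Z(p := a)) p)"
  by (auto simp: ins_def split: side.splits)

lemma face_L: "b \<in> B \<Longrightarrow> L b \<in> face L R B Lft"
  by (simp add: face_def LR_commute)

lemma face_R: "b \<in> B \<Longrightarrow> R b \<in> face L R B Rgt"
  by (simp add: face_def LR_commute)

lemma face_mult: "x \<in> face L R B s \<Longrightarrow> y \<in> face L R B s \<Longrightarrow> x * y \<in> face L R B s"
  by (cases s) (simp_all add: face_def mult.assoc, simp_all flip: mult.assoc)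

lemma face_1: "1 \<in> face L R B s"
  by (cases s) (simp_all add: face_def)

lemma adm_ins: "adm \<chi> S Z \<Longrightarrow> c \<in> B \<Longrightarrow> adm \<chi> S (ins \<chi> p c Z)"
  using face_mult[OF _ face_L] face_mult[OF face_R]
  by (auto simp: adm_def ins_def split: side.splits)

lemma adm_mono: "adm \<chi> S Z \<Longrightarrow> T \<subseteq> S \<Longrightarrow> adm \<chi> T Z"
  by (auto simp: adm_def)

definition last_block :: "(nat \<Rightarrow> side) \<Rightarrow> nat set set \<Rightarrow> nat set"
  where "last_block \<chi> \<sigma> = (SOME U. is_last \<chi> \<sigma> U)"

lemma last_block_eq: "\<sigma> \<in> BNC \<chi> S \<Longrightarrow> is_last \<chi> \<sigma> U \<Longrightarrow> last_block \<chi> \<sigma> = U"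
  unfolding last_block_def by (rule some_equality) (use is_last_unique in blast)+

text \<open>
  The block with the largest \<open>\<prec>\<^sub>\<chi>\<close>-minimum is a \<open>\<chi>\<close>-interval; it is removed first.  If nothing comes after
  it, it contributes the right factor \<open>\<Phi> U Z\<close>; otherwise it lies inside another block and the
  inner functional \<open>\<Psi>\<close> is inserted after its predecessor.
\<close>

function ev :: "(nat set \<Rightarrow> (nat \<Rightarrow> 'a) \<Rightarrow> 'd) \<Rightarrow> (nat set \<Rightarrow> (nat \<Rightarrow> 'a) \<Rightarrow> 'd) \<Rightarrow> (nat \<Rightarrow> side) \<Rightarrow>
    nat set set \<Rightarrow> (nat \<Rightarrow> 'a) \<Rightarrow> 'd"
  where "ev \<Phi> \<Psi> \<chi> \<sigma> Z =
    (if \<sigma> \<notin> BNC \<chi> (\<Union>\<sigma>) \<or> last_block \<chi> \<sigma> \<notin> \<sigma> then 1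
     else let U = last_block \<chi> \<sigma> in
       if before \<chi> (\<Union>\<sigma> - U) U then ev \<Phi> \<Psi> \<chi> (\<sigma> - {U}) Z * \<Phi> U Z
       else ev \<Phi> \<Psi> \<chi> (\<sigma> - {U}) (ins \<chi> (chi_pred \<chi> (\<Union>\<sigma>) U) (\<Psi> U Z) Z))"
  by pat_completeness auto
termination
proof (relation "measure (\<lambda>(\<Phi>, \<Psi>, \<chi>, \<sigma>, Z). card \<sigma>)", goal_cases)
  case (2 \<Phi> \<Psi> \<chi> \<sigma> Z U)
  then have "card (\<sigma> - {U}) < card \<sigma>"
    by (intro card_Diff1_less) (auto dest: BNC_finite_blocks)
  then show ?case by simp
next
  case (3 \<Phi> \<Psi> \<chi> \<sigma> Z U)
  then have "card (\<sigma> - {U}) < card \<sigma>"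
    by (intro card_Diff1_less) (auto dest: BNC_finite_blocks)
  then show ?case by simp
qed auto

declare ev.simps [simp del]

text \<open>The default value of \<open>ev\<close> serves as the empty product.\<close>

lemma ev_empty [simp]: "ev \<Phi> \<Psi> \<chi> {} Z = 1"
  by (simp add: ev.simps)

lemma ev_final:
  assumes "\<sigma> \<in> BNC \<chi> S" "is_last \<chi> \<sigma> U" "before \<chi> (S - U) U"
  shows "ev \<Phi> \<Psi> \<chi> \<sigma> Z = ev \<Phi> \<Psi> \<chi> (\<sigma> - {U}) Z * \<Phi> U Z"
  by (subst ev.simps)
    (use assms in \<open>simp add: BNC_Union[OF assms(1)] last_block_eq[OF assms(1,2)] is_last_in\<close>)

lemma ev_nested:
  assumes "\<sigma> \<in> BNC \<chi> S" "is_last \<chi> \<sigma> U" "\<not> before \<chi> (S - U) U" "is_pred \<chi> S U p"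
  shows "ev \<Phi> \<Psi> \<chi> \<sigma> Z = ev \<Phi> \<Psi> \<chi> (\<sigma> - {U}) (ins \<chi> p (\<Psi> U Z) Z)"
proof -
  have "chi_pred \<chi> S U = p"
    using chi_pred_eq[OF _ _ assms(4)] BNC_block[OF assms(1) is_last_in[OF assms(2)]] by blast
  then show ?thesis
    by (subst ev.simps)
      (use assms in \<open>simp add: BNC_Union[OF assms(1)] last_block_eq[OF assms(1,2)] is_last_in\<close>)
qed

lemma ev_nestedE:
  assumes "\<sigma> \<in> BNC \<chi> S" "is_last \<chi> \<sigma> U" "\<not> before \<chi> (S - U) U"
  obtains p where "is_pred \<chi> S U p" "p \<in> S - U"
    "\<And>\<Phi> \<Psi> Z. ev \<Phi> \<Psi> \<chi> \<sigma> Z = ev \<Phi> \<Psi> \<chi> (\<sigma> - {U}) (ins \<chi> p (\<Psi> U Z) Z)"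
proof -
  have "S - U \<noteq> {}" using assms(3) by (auto simp: before_def)
  from last_pred[OF assms(1,2) this] obtain p where p: "is_pred \<chi> S U p" .
  then have "p \<in> S - U"
    using is_pred_notin[OF p] by (auto simp: is_pred_def)
  then show ?thesis using that p ev_nested[OF assms] by blast
qed

lemma ev_single:
  assumes "finite V" "V \<noteq> {}"
  shows "ev \<Phi> \<Psi> \<chi> {V} Z = \<Phi> V Z"
proof -
  have "ev \<Phi> \<Psi> \<chi> {V} Z = ev \<Phi> \<Psi> \<chi> ({V} - {V}) Z * \<Phi> V Z"
    by (rule ev_final[OF BNC_single[OF assms]]) (auto simp: is_last_def before_def)
  then show ?thesis by simp
qed

text \<open>Needed for the recursion of \<open>cum\<close>, which calls itself through
  \<open>ev\<close>: termination depends on knowing that the functionals are applied only to blocks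
  of a bi-non-crossing partition.\<close>

lemma ev_fun_cong [fundef_cong]:
  assumes "\<chi> = \<chi>'" "\<sigma> = \<sigma>'" "Z = Z'"
    and "\<And>V Z. \<sigma>' \<in> BNC \<chi>' (\<Union>\<sigma>') \<Longrightarrow> V \<in> \<sigma>' \<Longrightarrow> \<Phi> V Z = \<Phi>' V Z"
    and "\<And>V Z. \<sigma>' \<in> BNC \<chi>' (\<Union>\<sigma>') \<Longrightarrow> V \<in> \<sigma>' \<Longrightarrow> \<Psi> V Z = \<Psi>' V Z"
  shows "ev \<Phi> \<Psi> \<chi> \<sigma> Z = ev \<Phi>' \<Psi>' \<chi>' \<sigma>' Z'"
proof (cases "\<sigma> \<in> BNC \<chi> (\<Union>\<sigma>)")
  case True
  have eq: "\<forall>V\<in>\<sigma>. \<forall>Z. \<Phi> V Z = \<Phi>' V Z \<and> \<Psi> V Z = \<Psi>' V Z"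
    using assms True by blast
  have "ev \<Phi> \<Psi> \<chi> \<sigma> Z = ev \<Phi>' \<Psi>' \<chi> \<sigma> Z" if "\<sigma> \<in> BNC \<chi> S" for Z S
    using that eq
  proof (induction arbitrary: Z rule: BNC_last_induct)
    case (step \<sigma> S U)
    have U: "U \<in> \<sigma>" using step.hyps(2) is_last_in by blast
    show ?case
    proof (cases "before \<chi> (S - U) U")
      case True
      show ?thesis
        unfolding ev_final[OF step.hyps(1,2) True] using step U by simp
    next
      case False
      from ev_nestedE[OF step.hyps(1,2) this] obtain p where
        p: "\<And>\<Phi> \<Psi> Z. ev \<Phi> \<Psi> \<chi> \<sigma> Z = ev \<Phi> \<Psi> \<chi> (\<sigma> - {U}) (ins \<chi> p (\<Psi> U Z) Z)" by metis
      show ?thesis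
        unfolding p using step U by simp
    qed
  qed simp
  then show ?thesis using assms True by metis
next
  case False
  then show ?thesis using assms by (simp add: ev.simps)
qed

section \<open>Conditions on the functionals of single blocks\<close>

definition is_local :: "(nat set \<Rightarrow> (nat \<Rightarrow> 'a) \<Rightarrow> 'd) \<Rightarrow> bool"
  where "is_local \<Phi> \<longleftrightarrow> (\<forall>V Z Z'. (\<forall>x\<in>V. Z x = Z' x) \<longrightarrow> \<Phi> V Z = \<Phi> V Z')"

definition is_additive :: "(nat set \<Rightarrow> (nat \<Rightarrow> 'a) \<Rightarrow> 'd) \<Rightarrow> bool"
  where "is_additive \<Phi> \<longleftrightarrow> (\<forall>V Z x a a'. finite V \<longrightarrow> x \<in> V \<longrightarrow>
    \<Phi> V (Z(x := a + a')) = \<Phi> V (Z(x := a)) + \<Phi> V (Z(x := a')))"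

text \<open>The functionals whose values may be inserted. The last clause is a right module
  property: insertion after the last element of \<open>V\<close> is multiplication from the right.
  The independence of the order of removal rests on it.\<close>

definition is_inner :: "(nat \<Rightarrow> side) \<Rightarrow> (nat set \<Rightarrow> (nat \<Rightarrow> 'a) \<Rightarrow> 'd) \<Rightarrow> bool"
  where "is_inner \<chi> \<Psi> \<longleftrightarrow> is_local \<Psi> \<and> (\<forall>V Z. \<Psi> V Z \<in> B) \<and>
    (\<forall>V Z x c. finite V \<longrightarrow> adm \<chi> V Z \<longrightarrow> x \<in> V \<longrightarrow> (\<forall>v\<in>V. key \<chi> v \<le> key \<chi> x) \<longrightarrow> c \<in> B \<longrightarrow>
      \<Psi> V (ins \<chi> x c Z) = \<Psi> V Z * c)"

lemma is_additiveD: "is_additive \<Phi> \<Longrightarrow> finite V \<Longrightarrow> x \<in> V \<Longrightarrow>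
    \<Phi> V (Z(x := a + a')) = \<Phi> V (Z(x := a)) + \<Phi> V (Z(x := a'))"
  by (simp add: is_additive_def)

lemma is_localD: "is_local \<Phi> \<Longrightarrow> (\<And>x. x \<in> V \<Longrightarrow> Z x = Z' x) \<Longrightarrow> \<Phi> V Z = \<Phi> V Z'"
  unfolding is_local_def by blast

lemma is_local_ins: "is_local \<Phi> \<Longrightarrow> p \<notin> V \<Longrightarrow> \<Phi> V (ins \<chi> p c Z) = \<Phi> V Z"
  by (erule is_localD) (rule ins_notin)

lemma is_innerD:
  assumes "is_inner \<chi> \<Psi>"
  shows "is_local \<Psi>" "\<Psi> V Z \<in> B"
    "finite V \<Longrightarrow> adm \<chi> V Z \<Longrightarrow> x \<in> V \<Longrightarrow> (\<And>v. v \<in> V \<Longrightarrow> key \<chi> v \<le> key \<chi> x) \<Longrightarrow> c \<in> B \<Longrightarrow>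
      \<Psi> V (ins \<chi> x c Z) = \<Psi> V Z * c"
  using assms unfolding is_inner_def by blast+

lemma ev_cong:
  assumes "\<sigma> \<in> BNC \<chi> S" "is_local \<Phi>" "is_local \<Psi>" "\<And>x. x \<in> S \<Longrightarrow> Z x = Z' x"
  shows "ev \<Phi> \<Psi> \<chi> \<sigma> Z = ev \<Phi> \<Psi> \<chi> \<sigma> Z'"
  using assms(1,4)
proof (induction arbitrary: Z Z' rule: BNC_last_induct)
  case (step \<sigma> S U)
  have "U \<subseteq> S"
    using BNC_block(3)[OF step.hyps(1) is_last_in[OF step.hyps(2)]] .
  then have eq: "\<Phi> U Z = \<Phi> U Z'" "\<Psi> U Z = \<Psi> U Z'"
    using step.prems by (auto intro!: is_localD[OF assms(2)] is_localD[OF assms(3)])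
  show ?case
  proof (cases "before \<chi> (S - U) U")
    case True
    have "ev \<Phi> \<Psi> \<chi> (\<sigma> - {U}) Z = ev \<Phi> \<Psi> \<chi> (\<sigma> - {U}) Z'"
      by (rule step.IH) (use step.prems in auto)
    then show ?thesis
      unfolding ev_final[OF step.hyps(1,2) True] by (simp add: eq)
  next
    case False
    from ev_nestedE[OF step.hyps(1,2) this] obtain p where
      p: "\<And>\<Phi> \<Psi> Z. ev \<Phi> \<Psi> \<chi> \<sigma> Z = ev \<Phi> \<Psi> \<chi> (\<sigma> - {U}) (ins \<chi> p (\<Psi> U Z) Z)" by metis
    show ?thesis
      unfolding p eq by (rule step.IH) (use step.prems in \<open>auto simp: ins_def split: side.splits\<close>)
  qed
qed simp

lemma ev_ins_notin:
  assumes "\<sigma> \<in> BNC \<chi> S" "is_local \<Phi>" "is_local \<Psi>" "p \<notin> S"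
  shows "ev \<Phi> \<Psi> \<chi> \<sigma> (ins \<chi>' p c Z) = ev \<Phi> \<Psi> \<chi> \<sigma> Z"
  using ins_notin[OF assms(4)] by (rule ev_cong[OF assms(1-3)])

lemma ev_in_B:
  assumes "\<sigma> \<in> BNC \<chi> S" "\<And>V Z. \<Psi> V Z \<in> B"
  shows "ev \<Psi> \<Psi> \<chi> \<sigma> Z \<in> B"
  using assms(1)
proof (induction arbitrary: Z rule: BNC_last_induct)
  case (step \<sigma> S U)
  show ?case
  proof (cases "before \<chi> (S - U) U")
    case True
    show ?thesis
      unfolding ev_final[OF step.hyps(1,2) True] using step.IH assms(2) B_mult by blast
  next
    case False
    from ev_nestedE[OF step.hyps(1,2) this] obtain p where
      p: "\<And>\<Phi> \<Psi> Z. ev \<Phi> \<Psi> \<chi> \<sigma> Z = ev \<Phi> \<Psi> \<chi> (\<sigma> - {U}) (ins \<chi> p (\<Psi> U Z) Z)" by metis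
    show ?thesis
      unfolding p using step.IH by blast
  qed
qed (simp add: B_1)

lemma ev_additive:
  assumes "\<sigma> \<in> BNC \<chi> S" "is_local \<Phi>" "is_local \<Psi>" "is_additive \<Phi>" "is_additive \<Psi>"
    and "\<And>V Z. \<Psi> V Z \<in> B" "x \<in> S"
  shows "ev \<Phi> \<Psi> \<chi> \<sigma> (Z(x := a + a')) = ev \<Phi> \<Psi> \<chi> \<sigma> (Z(x := a)) + ev \<Phi> \<Psi> \<chi> \<sigma> (Z(x := a'))"
  using assms(1,7)
proof (induction arbitrary: Z x a a' rule: BNC_last_induct)
  case (step \<sigma> S U)
  have U: "finite U" "U \<subseteq> S"
    using BNC_block[OF step.hyps(1) is_last_in[OF step.hyps(2)]] by auto
  have add: "\<Phi> U (Z(x := a + a')) = \<Phi> U (Z(x := a)) + \<Phi> U (Z(x := a'))"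
    "\<Psi> U (Z(x := a + a')) = \<Psi> U (Z(x := a)) + \<Psi> U (Z(x := a'))" if "x \<in> U"
    using is_additiveD[OF _ U(1) that] assms(4,5) by blast+
  have same: "\<Phi> U (Z(x := b)) = \<Phi> U Z" "\<Psi> U (Z(x := b)) = \<Psi> U Z" if "x \<notin> U" for b
    using that by (auto intro!: is_localD[OF assms(2)] is_localD[OF assms(3)])
  have cong: "ev \<Phi> \<Psi> \<chi> (\<sigma> - {U}) (Y(x := b)) = ev \<Phi> \<Psi> \<chi> (\<sigma> - {U}) Y" if "x \<in> U" for b Y
    by (rule ev_cong[OF step.hyps(3) assms(2,3)]) (use that in auto)
  show ?case
  proof (cases "before \<chi> (S - U) U")
    case True
    note fin = ev_final[OF step.hyps(1,2) True]
    show ?thesis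
    proof (cases "x \<in> U")
      case False
      then have "x \<in> S - U" using step.prems by blast
      then show ?thesis
        unfolding fin same(1)[OF False] step.IH[OF \<open>x \<in> S - U\<close>] by (simp only: distrib_right)
    qed (simp only: fin add cong distrib_left)
  next
    case False
    from ev_nestedE[OF step.hyps(1,2) this] obtain p where pS: "p \<in> S - U" and
      p: "\<And>\<Phi> \<Psi> Z. ev \<Phi> \<Psi> \<chi> \<sigma> Z = ev \<Phi> \<Psi> \<chi> (\<sigma> - {U}) (ins \<chi> p (\<Psi> U Z) Z)" by metis
    show ?thesis
    proof (cases "x \<in> U")
      case True
      then have "x \<noteq> p" using pS by auto
      \<comment> \<open>The changed argument sits inside the inserted value, so additivity is
        transferred to the entry at \<open>p\<close>, where the induction hypothesis
        applies.\<close>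
      have "ev \<Phi> \<Psi> \<chi> (\<sigma> - {U}) (ins \<chi> p (b + c) Z) =
          ev \<Phi> \<Psi> \<chi> (\<sigma> - {U}) (ins \<chi> p b Z) + ev \<Phi> \<Psi> \<chi> (\<sigma> - {U}) (ins \<chi> p c Z)"
        if "b \<in> B" "c \<in> B" for b c
        unfolding ins_add[OF that] step.IH[OF pS] by (simp only: ins_same_upd[symmetric])
      then show ?thesis
        unfolding p add[OF True] ins_upd_other[OF \<open>x \<noteq> p\<close>[symmetric]] cong[OF True]
        using assms(6) by blast
    next
      case xU: False
      show ?thesis
      proof (cases "x = p")
        case True
        show ?thesis
          unfolding p True same(2)[OF xU, unfolded True]
          by (simp only: ins_upd_same_add step.IH[OF pS] ins_upd_same[symmetric])
      next
        case False
        then have "x \<in> S - U" using xU step.prems by blast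
        then show ?thesis
          unfolding p same[OF xU] ins_upd_other[OF False[symmetric]] by (rule step.IH)
      qed
    qed
  qed
qed simp

lemma ev_ins_add:
  assumes "\<sigma> \<in> BNC \<chi> S" "is_local \<Phi>" "is_local \<Psi>" "is_additive \<Phi>" "is_additive \<Psi>"
    and "\<And>V Z. \<Psi> V Z \<in> B" "p \<in> S" "b \<in> B" "c \<in> B"
  shows "ev \<Phi> \<Psi> \<chi> \<sigma> (ins \<chi>' p (b + c) Z) = ev \<Phi> \<Psi> \<chi> \<sigma> (ins \<chi>' p b Z) + ev \<Phi> \<Psi> \<chi> \<sigma> (ins \<chi>' p c Z)"
  unfolding ins_add[OF assms(8,9)] ev_additive[OF assms(1-7)] by (simp flip: ins_same_upd)

lemma B_sum: "(\<And>i. i \<in> I \<Longrightarrow> c i \<in> B) \<Longrightarrow> sum c I \<in> B"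
  by (induction I rule: infinite_finite_induct) (auto simp: B_0 B_add)

lemma ev_ins_sum:
  assumes "\<sigma> \<in> BNC \<chi> S" "is_local \<Phi>" "is_local \<Psi>" "is_additive \<Phi>" "is_additive \<Psi>"
    and "\<And>V Z. \<Psi> V Z \<in> B" "p \<in> S" "\<And>i. i \<in> I \<Longrightarrow> c i \<in> B"
  shows "ev \<Phi> \<Psi> \<chi> \<sigma> (ins \<chi>' p (sum c I) Z) = (\<Sum>i\<in>I. ev \<Phi> \<Psi> \<chi> \<sigma> (ins \<chi>' p (c i) Z))"
proof -
  \<comment> \<open>An additive map sends 0 to 0, by \<open>0 + 0 = 0\<close>; this starts the
    induction over \<open>I\<close>.\<close>
  have zero: "ev \<Phi> \<Psi> \<chi> \<sigma> (ins \<chi>' p 0 Z) = 0"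
    using ev_ins_add[OF assms(1-7) B_0 B_0, of \<chi>' Z] by simp
  show ?thesis
    using assms(8)
  proof (induction I rule: infinite_finite_induct)
    case (insert i I)
    then show ?case
      using ev_ins_add[OF assms(1-7), of "c i" "sum c I" \<chi>' Z] by (simp add: B_sum)
  qed (simp_all add: zero)
qed

text \<open>If the last block is final, it contains \<open>x\<close> and its right factor absorbs
  \<open>c\<close>. Otherwise \<open>x\<close> is neither in that block nor its predecessor, so
  \<open>c\<close> waits untouched in the remaining blocks.\<close>

lemma ev_rmod:
  assumes "\<sigma> \<in> BNC \<chi> S" "is_inner \<chi> \<Psi>" "adm \<chi> S Z"
    and "x \<in> S" "\<And>s. s \<in> S \<Longrightarrow> key \<chi> s \<le> key \<chi> x" "c \<in> B"
  shows "ev \<Psi> \<Psi> \<chi> \<sigma> (ins \<chi> x c Z) = ev \<Psi> \<Psi> \<chi> \<sigma> Z * c"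
  using assms(1,3-5)
proof (induction arbitrary: Z rule: BNC_last_induct)
  case (step \<sigma> S U)
  note \<Psi> = is_innerD[OF assms(2)]
  have U: "finite U" "U \<subseteq> S" "U \<noteq> {}"
    using BNC_block[OF step.hyps(1) is_last_in[OF step.hyps(2)]] by auto
  show ?case
  proof (cases "before \<chi> (S - U) U")
    case True
    have xU: "x \<in> U"
    proof (rule ccontr)
      assume "x \<notin> U"
      obtain u where "u \<in> U" using U by blast
      then show False
        using beforeD[OF True, of x u] step.prems(2) step.prems(3)[of u] U(2) \<open>x \<notin> U\<close> by auto
    qed
    have "\<Psi> U (ins \<chi> x c Z) = \<Psi> U Z * c"
      by (rule \<Psi>(3)[OF U(1) _ xU _ assms(6)])
        (use U step.prems adm_mono in auto)
    moreover have "ev \<Psi> \<Psi> \<chi> (\<sigma> - {U}) (ins \<chi> x c Z) = ev \<Psi> \<Psi> \<chi> (\<sigma> - {U}) Z"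
      by (rule ev_ins_notin[OF step.hyps(3) \<Psi>(1,1)]) (use xU in auto)
    ultimately show ?thesis
      unfolding ev_final[OF step.hyps(1,2) True] by (simp add: mult.assoc)
  next
    case False
    from ev_nestedE[OF step.hyps(1,2) this] obtain p where pS: "p \<in> S - U" and
      pred: "is_pred \<chi> S U p" and
      p: "\<And>\<Phi> \<Psi> Z. ev \<Phi> \<Psi> \<chi> \<sigma> Z = ev \<Phi> \<Psi> \<chi> (\<sigma> - {U}) (ins \<chi> p (\<Psi> U Z) Z)" by metis
    obtain u where u: "u \<in> U" using U by blast
    have "x \<noteq> p"
    proof
      assume "x = p"
      then show False
        using pred step.prems(3)[of u] u U(2) beforeD[of \<chi> "{p}" U p u] unfolding is_pred_def by auto
    qed
    moreover have xU: "x \<notin> U"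
    proof
      assume xU: "x \<in> U"
      have "before \<chi> {s} U" if "s \<in> S - U" for s
        using before_interval[OF is_last_interval[OF step.hyps(1,2)] that xU] step.prems(3)[of s] that xU
          key_eq_iff[of \<chi> s x] by (auto simp: order_le_less)
      with False show False by (auto simp: before_def)
    qed
    ultimately show ?thesis
      unfolding p is_local_ins[OF \<Psi>(1) xU] ins_commute[OF \<open>x \<noteq> p\<close>[symmetric]]
      by (intro step.IH) (use step.prems in \<open>auto intro: adm_ins adm_mono \<Psi>(2)\<close>)
  qed
qed simp

text \<open>The last block of the union is that of \<open>\<tau>\<close>. Putting \<open>S\<close>
  in front changes neither whether it is final nor, if it is nested, its predecessor.\<close>

lemma ev_append:
  assumes "\<sigma> \<in> BNC \<chi> S" "\<tau> \<in> BNC \<chi> T" "before \<chi> S T" "is_local \<Phi>" "is_local \<Psi>"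
  shows "\<sigma> \<union> \<tau> \<in> BNC \<chi> (S \<union> T) \<and> ev \<Phi> \<Psi> \<chi> (\<sigma> \<union> \<tau>) Z = ev \<Phi> \<Psi> \<chi> \<sigma> Z * ev \<Phi> \<Psi> \<chi> \<tau> Z"
  using assms(2,3)
proof (induction arbitrary: Z rule: BNC_last_induct)
  case (step \<tau> T U)
  have disj: "S \<inter> T = {}" using step.prems unfolding before_def by force
  have bnc: "\<sigma> \<union> \<tau> \<in> BNC \<chi> (S \<union> T)"
  proof (rule BNC_glue[OF assms(1) step.hyps(1) disj])
    fix V a b c d assume *: "V \<in> \<sigma>" "a \<in> V" "c \<in> V" "b \<in> T" "d \<in> T"
    then have "a \<in> S" "c \<in> S" using BNC_block(3)[OF assms(1)] by auto
    then show "\<not> (key \<chi> a < key \<chi> b \<and> key \<chi> b < key \<chi> c \<and> key \<chi> c < key \<chi> d) \<and>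
      \<not> (key \<chi> b < key \<chi> a \<and> key \<chi> a < key \<chi> d \<and> key \<chi> d < key \<chi> c)"
      using beforeD[OF step.prems, of c b] beforeD[OF step.prems, of a b] * by auto
  qed
  have U: "finite U" "U \<subseteq> T" "U \<noteq> {}" "U \<in> \<tau>"
    using BNC_block[OF step.hyps(1)] is_last_in[OF step.hyps(2)] by auto
  have "U \<notin> \<sigma>" using BNC_block[OF assms(1)] U disj by blast
  then have diff: "\<sigma> \<union> \<tau> - {U} = \<sigma> \<union> (\<tau> - {U})" "S \<union> T - U = S \<union> (T - U)"
    using U disj by auto
  have SU: "before \<chi> S U" using before_mono[OF step.prems _ U(2)] by blast
  have last: "is_last \<chi> (\<sigma> \<union> \<tau>) U"
    unfolding is_last_def
  proof (intro conjI ballI impI)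
    fix W assume W: "W \<in> \<sigma> \<union> \<tau>" "W \<noteq> U"
    show "\<exists>w\<in>W. before \<chi> {w} U"
    proof (cases "W \<in> \<sigma>")
      case True
      then obtain w where "w \<in> W" "w \<in> S" using BNC_block[OF assms(1)] by blast
      then show ?thesis using before_mono[OF SU, of "{w}" U] by blast
    next
      case False
      then show ?thesis using is_lastE[OF step.hyps(2)] W by (metis UnE)
    qed
  qed (use U in blast)
  have STU: "before \<chi> S (T - U)" using before_mono[OF step.prems] by blast
  have fin_iff: "before \<chi> (S \<union> T - U) U \<longleftrightarrow> before \<chi> (T - U) U"
    unfolding diff using SU by (auto simp: before_def)
  show ?case
  proof (cases "before \<chi> (T - U) U")
    case True
    show ?thesis
      using bnc ev_final[OF bnc last, of \<Phi> \<Psi> Z] ev_final[OF step.hyps(1,2) True, of \<Phi> \<Psi> Z]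
        step.IH[OF STU, of Z] True fin_iff
      unfolding diff by (simp add: mult.assoc)
  next
    case False
    from ev_nestedE[OF step.hyps(1,2) this] obtain p where pT: "p \<in> T - U" and
      pred: "is_pred \<chi> T U p" and
      p: "\<And>\<Phi> \<Psi> Z. ev \<Phi> \<Psi> \<chi> \<tau> Z = ev \<Phi> \<Psi> \<chi> (\<tau> - {U}) (ins \<chi> p (\<Psi> U Z) Z)" by metis
    have pred': "is_pred \<chi> (S \<union> T) U p"
      using pred beforeD[OF step.prems, of _ p] pT unfolding is_pred_def by fastforce
    have "p \<notin> S" using pT disj by blast
    then show ?thesis
      using bnc ev_nested[OF bnc last, of p \<Phi> \<Psi> Z] step.IH[OF STU, of "ins \<chi> p (\<Psi> U Z) Z"] False pred' p[of \<Phi> \<Psi> Z]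
        ev_ins_notin[OF assms(1,4,5), of p \<chi> "\<Psi> U Z" Z] fin_iff
      unfolding diff by simp
  qed
qed (use assms(1) in simp)

end

section \<open>Removing interval blocks in any order\<close>

context bifree_ops
begin

text \<open>The removal of \<open>V\<close> is moved past that of the last block \<open>U\<close>.
  They interfere only when the predecessor of \<open>U\<close> lies in \<open>V\<close>, and then
  the right module property of \<open>\<Psi>\<close> makes both orders agree. The final hypothesis
  guarantees that it is \<open>\<Psi>\<close> that \<open>ev\<close> would apply to
  \<open>V\<close>, or that the distinction is void.\<close>

lemma ev_remove:
  assumes "is_local \<Phi>" "is_inner \<chi> \<Psi>" "\<sigma> \<in> BNC \<chi> S" "V \<in> \<sigma>" "chi_interval \<chi> S V"
    and "is_pred \<chi> S V p" "adm \<chi> S Z" "\<Phi> = \<Psi> \<or> nested \<chi> (\<sigma> - {V}) V"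
  shows "ev \<Phi> \<Psi> \<chi> \<sigma> Z = ev \<Phi> \<Psi> \<chi> (\<sigma> - {V}) (ins \<chi> p (\<Psi> V Z) Z)"
  using assms(3-8)
proof (induction arbitrary: Z p rule: BNC_last_induct)
  case (step \<sigma> S U)
  note \<Psi> = is_innerD[OF assms(2)]
  note bnc = step.hyps(1) and lst = step.hyps(2)
  note V = BNC_block[OF bnc step.prems(1)] and U = BNC_block[OF bnc is_last_in[OF lst]]
  have pS: "p \<in> S" "p \<notin> V" and pV: "\<And>v. v \<in> V \<Longrightarrow> key \<chi> p < key \<chi> v"
    using step.prems(3) is_pred_notin unfolding is_pred_def before_def by blast+
  show ?case
  proof (cases "V = U")
    case True
    show ?thesis
    proof (cases "before \<chi> (S - U) U")
      case fin: True
      then have "\<Phi> = \<Psi>"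
        using step.prems(5) before_not_nested[OF fin U(1) step.hyps(3)] True by blast
      \<comment> \<open>\<open>p\<close> is the last index of \<open>S - U\<close>, so inserting
        there is multiplication from the right, which is what the final case of \<open>ev\<close>
        does.\<close>
      have "ev \<Psi> \<Psi> \<chi> (\<sigma> - {U}) (ins \<chi> p (\<Psi> U Z) Z) = ev \<Psi> \<Psi> \<chi> (\<sigma> - {U}) Z * \<Psi> U Z"
      proof (rule ev_rmod[OF step.hyps(3) assms(2) adm_mono[OF step.prems(4)]])
        show "key \<chi> s \<le> key \<chi> p" if "s \<in> S - U" for s
          using step.prems(3) that before_mono[OF fin, of "{s}" U] True unfolding is_pred_def by blast
      qed (use pS True \<Psi>(2) in auto)
      then show ?thesis
        unfolding ev_final[OF bnc lst fin] using True \<open>\<Phi> = \<Psi>\<close> by simp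
    next
      case False
      then show ?thesis
        using ev_nested[OF bnc lst False] step.prems(3) True by simp
    qed
  next
    case False
    obtain v0 where v0: "v0 \<in> V" "before \<chi> {v0} U"
      using is_lastE[OF lst step.prems(1) False] .
    have disj: "V \<inter> U = {}"
      using BNC_disjoint[OF bnc step.prems(1) is_last_in[OF lst]] False by blast
    \<comment> \<open>If an element of \<open>V\<close> came after \<open>U\<close>, the interval
      \<open>V\<close>, which contains \<open>v0\<close> before \<open>U\<close>, would contain
      \<open>U\<close>.\<close>
    have VU: "before \<chi> V U"
    proof (rule beforeI)
      fix v u assume vu: "v \<in> V" "u \<in> U"
      then have v: "v \<in> S - U" using V(3) disj by blast
      show "key \<chi> v < key \<chi> u"
        using interval_cases[OF is_last_interval[OF bnc lst] v]
      proof
        assume "before \<chi> U {v}"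
        then have "u \<in> V"
          using chi_intervalD[OF step.prems(2) v0(1) vu(1), of u] beforeD[OF v0(2), of v0 u]
            beforeD[of \<chi> U "{v}" u v] vu(2) U(3) by auto
        with vu disj show ?thesis by blast
      qed (use vu beforeD in blast)
    qed
    have pU: "p \<notin> U"
      using beforeD[OF VU v0(1), of p] pV[OF v0(1)] by auto
    have int: "chi_interval \<chi> (S - U) V"
      using chi_interval_mono[OF step.prems(2)] V(3) disj by blast
    have pred: "is_pred \<chi> (S - U) V p"
      using step.prems(3) pU unfolding is_pred_def by blast
    have nest: "\<Phi> = \<Psi> \<or> nested \<chi> (\<sigma> - {U} - {V}) V"
      using step.prems(5) nested_last[OF lst _ step.prems(1) False] by blast
    have V': "V \<in> \<sigma> - {U}" using step.prems(1) False by blast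
    note bncV = BNC_remove[OF bnc step.prems(1)]
    have lastV: "is_last \<chi> (\<sigma> - {V}) U"
      using is_last_remove[OF lst] False by blast
    have eqs: "\<sigma> - {V} - {U} = \<sigma> - {U} - {V}" "S - V - U = S - U - V"
      by auto
    define d where "d = \<Psi> V Z"
    define c where "c = \<Psi> U Z"
    have dB: "d \<in> B" "c \<in> B" using \<Psi>(2) by (simp_all add: d_def c_def)
    have c': "\<Psi> U (ins \<chi> p d Z) = c"
      unfolding c_def by (rule is_local_ins[OF \<Psi>(1) pU])
    note bnc2 = BNC_remove[OF step.hyps(3) V']
    show ?thesis
    proof (cases "before \<chi> (S - U) U")
      case True
      then have fin': "before \<chi> (S - V - U) U"
        by (rule before_mono) auto
      have "ev \<Phi> \<Psi> \<chi> (\<sigma> - {U}) Z = ev \<Phi> \<Psi> \<chi> (\<sigma> - {U} - {V}) (ins \<chi> p (\<Psi> V Z) Z)"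
        by (rule step.IH[OF V' int pred _ nest]) (rule adm_mono[OF step.prems(4)], blast)
      then show ?thesis
        unfolding ev_final[OF bnc lst True] ev_final[OF bncV lastV fin'] eqs
        by (simp add: is_local_ins[OF assms(1) pU])
    next
      case nfin: False
      from ev_nestedE[OF bnc lst this] obtain q where qS: "q \<in> S - U" and
        qpred: "is_pred \<chi> S U q" and
        q: "\<And>\<Phi> \<Psi> Z. ev \<Phi> \<Psi> \<chi> \<sigma> Z = ev \<Phi> \<Psi> \<chi> (\<sigma> - {U}) (ins \<chi> q (\<Psi> U Z) Z)" by metis
      have qmax: "key \<chi> s \<le> key \<chi> q" if "s \<in> S" "before \<chi> {s} U" for s
        using qpred that unfolding is_pred_def by blast
      have Vq: "key \<chi> v \<le> key \<chi> q" if "v \<in> V" for v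
        using qmax[of v] that V(3) before_mono[OF VU, of "{v}" U] by blast
      have IH: "ev \<Phi> \<Psi> \<chi> \<sigma> Z =
          ev \<Phi> \<Psi> \<chi> (\<sigma> - {U} - {V}) (ins \<chi> p (\<Psi> V (ins \<chi> q c Z)) (ins \<chi> q c Z))"
        unfolding q[of \<Phi> \<Psi> Z] c_def
        by (rule step.IH[OF V' int pred _ nest])
          (intro adm_ins adm_mono[OF step.prems(4)] \<Psi>(2), blast)
      have nfin': "\<not> before \<chi> (S - V - U) U"
      proof
        assume *: "before \<chi> (S - V - U) U"
        have "before \<chi> (S - U) U"
          using beforeD[OF *] beforeD[OF VU] by (intro beforeI) blast
        with nfin show False ..
      qed
      show ?thesis
      proof (cases "q \<in> V")
        case False
        then have "is_pred \<chi> (S - V) U q"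
          using qpred unfolding is_pred_def by blast
        moreover have "p \<noteq> q"
          using Vq[OF v0(1)] pV[OF v0(1)] by auto
        ultimately show ?thesis
          unfolding IH is_local_ins[OF \<Psi>(1) False] d_def[symmetric]
          using ev_nested[OF bncV lastV nfin', of q \<Phi> \<Psi> "ins \<chi> p d Z"]
          by (simp add: eqs c' ins_commute)
      next
        case True
        \<comment> \<open>With \<open>V\<close> gone, \<open>p\<close> precedes \<open>U\<close>: an
          index before \<open>U\<close> and after \<open>V\<close> would lie beyond
          \<open>q\<close>, the last index before \<open>U\<close>.\<close>
        have pred': "is_pred \<chi> (S - V) U p"
          unfolding is_pred_def
        proof (intro conjI ballI impI)
          show "p \<in> S - V" using pS by blast
          show "before \<chi> {p} U"
            using beforeD[OF VU v0(1)] pV[OF v0(1)] by (auto intro!: beforeI intro: less_trans)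
          fix s assume s: "s \<in> S - V" "before \<chi> {s} U"
          have "\<not> before \<chi> V {s}"
            using beforeD[of \<chi> V "{s}" q s] True qmax[of s] s by auto
          then have "before \<chi> {s} V"
            using interval_cases[OF step.prems(2) s(1)] by blast
          then show "key \<chi> s \<le> key \<chi> p"
            using step.prems(3) s(1) unfolding is_pred_def by blast
        qed
        \<comment> \<open>\<open>q\<close> is the last element of \<open>V\<close>, so the value of
          \<open>U\<close> leaves \<open>V\<close> as a right factor. Both orders of removal then
          insert \<open>d * c\<close> at \<open>p\<close>.\<close>
        have "\<Psi> V (ins \<chi> q c Z) = d * c"
          unfolding d_def
          by (rule \<Psi>(3)[OF V(2) adm_mono[OF step.prems(4) V(3)] True Vq dB(2)])
        then have "ev \<Phi> \<Psi> \<chi> \<sigma> Z = ev \<Phi> \<Psi> \<chi> (\<sigma> - {U} - {V}) (ins \<chi> p (d * c) Z)"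
          unfolding IH using True
          by (auto intro!: ev_cong[OF bnc2 assms(1) \<Psi>(1)] simp: ins_def split: side.splits)
        then show ?thesis
          using ev_nested[OF bncV lastV nfin' pred', of \<Phi> \<Psi> "ins \<chi> p d Z"]
          by (simp add: c' eqs ins_ins[OF dB] flip: d_def)
      qed
    qed
  qed
qed simp

text \<open>The blocks of \<open>\<tau>\<close> are removed from the union one at a time. As long as
  others remain, the insertions take place inside \<open>U\<close> exactly as in the evaluation of
  \<open>\<tau>\<close> alone; the last remaining block is inserted at \<open>p\<close>.\<close>

lemma ev_graft:
  assumes "is_local \<Phi>" "is_inner \<chi> \<Psi>" "\<sigma> \<in> BNC \<chi> S" "\<tau> \<in> BNC \<chi> U" "\<sigma> \<union> \<tau> \<in> BNC \<chi> (S \<union> U)"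
    and "S \<inter> U = {}" "U \<noteq> {}" "chi_interval \<chi> (S \<union> U) U" "is_pred \<chi> (S \<union> U) U p"
    and "adm \<chi> (S \<union> U) Z" "\<Phi> = \<Psi> \<or> nested \<chi> \<sigma> U"
  shows "ev \<Phi> \<Psi> \<chi> (\<sigma> \<union> \<tau>) Z = ev \<Phi> \<Psi> \<chi> \<sigma> (ins \<chi> p (ev \<Psi> \<Psi> \<chi> \<tau> Z) Z)"
  using assms(4-11)
proof (induction arbitrary: Z rule: BNC_last_induct)
  case (step \<tau> U V)
  note \<Psi> = is_innerD[OF assms(2)]
  note bnc = step.hyps(1) and lst = step.hyps(2)
  note V = BNC_block[OF bnc is_last_in[OF lst]]
  have V\<tau>: "V \<in> \<tau>" "V \<notin> \<sigma>"
    using is_last_in[OF lst] BNC_block[OF assms(3), of V] V step.prems(2) by blast+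
  have pS: "p \<in> S"
    using step.prems(5) is_pred_notin[OF step.prems(5)] unfolding is_pred_def by blast
  have diff: "\<sigma> \<union> \<tau> - {V} = \<sigma> \<union> (\<tau> - {V})" "S \<union> U - V = S \<union> (U - V)"
    using V\<tau> V(3) step.prems(2) by auto
  have intV: "chi_interval \<chi> (S \<union> U) V"
    using chi_interval_trans[OF step.prems(4) is_last_interval[OF bnc lst]] .
  have nestV: "\<Phi> = \<Psi> \<or> nested \<chi> (\<sigma> \<union> \<tau> - {V}) V"
  proof -
    have "nested \<chi> (\<sigma> \<union> \<tau> - {V}) V" if "nested \<chi> \<sigma> U"
    proof -
      obtain W w w' where "W \<in> \<sigma>" "w \<in> W" "w' \<in> W" "before \<chi> {w} U" "before \<chi> U {w'}"
        using \<open>nested \<chi> \<sigma> U\<close> unfolding nested_def by blast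
      then show ?thesis
        unfolding nested_def diff using V(3)
        by (intro bexI[of _ W] bexI[of _ w] bexI[of _ w'] conjI) (auto intro: before_mono)
    qed
    then show ?thesis using step.prems(7) by blast
  qed
  show ?case
  proof (cases "U - V = {}")
    case True
    then have UV: "U = V" "\<tau> = {V}"
      using V(3) BNC_empty_iff[OF step.hyps(3)] V\<tau> by auto
    show ?thesis
      using ev_remove[OF assms(1,2) step.prems(1) _ intV _ step.prems(6) nestV, of p] step.prems(5) V\<tau>
      by (simp add: UV ev_single[OF V(2,1)])
  next
    case False
    from last_pred[OF bnc lst False] obtain q where q: "is_pred \<chi> U V q" .
    have qU: "q \<in> U - V" using q is_pred_notin[OF q] by (auto simp: is_pred_def)
    \<comment> \<open>Since \<open>U\<close> is an interval, an index of \<open>S\<close> before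
      part of \<open>U\<close> is before all of it. Hence a predecessor within \<open>U\<close> is a
      predecessor in \<open>S \<union> U\<close>.\<close>
    have after: "key \<chi> s < key \<chi> x" if sx: "s \<in> S" "before \<chi> {s} V \<or> before \<chi> {s} (U - V)" "x \<in> U" for s x
    proof -
      obtain u where u: "u \<in> U" "key \<chi> s < key \<chi> u"
        using sx(2) V(1,3) False unfolding before_def by blast
      have s: "s \<in> S \<union> U - U" using sx(1) step.prems(2) by blast
      then have "before \<chi> {s} U"
        using interval_cases[OF step.prems(4) s] u beforeD by (metis order.asym singletonI)
      then show ?thesis using sx(3) beforeD by blast
    qed
    have q': "is_pred \<chi> (S \<union> U) V q"
      using q after[of _ q] qU unfolding is_pred_def by (auto intro: less_imp_le)
    define d where "d = \<Psi> V Z"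
    have dB: "d \<in> B" using \<Psi>(2) by (simp add: d_def)
    have "ev \<Phi> \<Psi> \<chi> (\<sigma> \<union> \<tau>) Z = ev \<Phi> \<Psi> \<chi> (\<sigma> \<union> (\<tau> - {V})) (ins \<chi> q d Z)"
      using ev_remove[OF assms(1,2) step.prems(1) _ intV q' step.prems(6) nestV] V\<tau>
      unfolding diff d_def by blast
    also have "\<dots> = ev \<Phi> \<Psi> \<chi> \<sigma> (ins \<chi> p (ev \<Psi> \<Psi> \<chi> (\<tau> - {V}) (ins \<chi> q d Z)) (ins \<chi> q d Z))"
    proof (rule step.IH)
      show "\<sigma> \<union> (\<tau> - {V}) \<in> BNC \<chi> (S \<union> (U - V))"
        using BNC_remove[OF step.prems(1), of V] V\<tau> unfolding diff by blast
      show "chi_interval \<chi> (S \<union> (U - V)) (U - V)"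
      proof (rule chi_intervalI)
        fix a b c assume *: "a \<in> U - V" "c \<in> U - V" "b \<in> S \<union> (U - V)"
          "key \<chi> a < key \<chi> b" "key \<chi> b < key \<chi> c"
        then have "b \<in> U"
          using chi_intervalD[OF step.prems(4), of a c b] by blast
        with * step.prems(2) show "b \<in> U - V" by blast
      qed blast
      show "is_pred \<chi> (S \<union> (U - V)) (U - V) p"
        unfolding is_pred_def
      proof (intro conjI ballI impI)
        show "before \<chi> {p} (U - V)"
          using step.prems(5) unfolding is_pred_def by (blast intro: before_mono)
        fix s assume s: "s \<in> S \<union> (U - V)" "before \<chi> {s} (U - V)"
        have "s \<notin> U - V" using s(2) unfolding before_def by auto
        then have "before \<chi> {s} U" "s \<in> S"
          using s after[of s] by (auto intro!: beforeI)
        then show "key \<chi> s \<le> key \<chi> p"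
          using step.prems(5) unfolding is_pred_def by blast
      qed (use pS in blast)
      show "adm \<chi> (S \<union> (U - V)) (ins \<chi> q d Z)"
        by (intro adm_ins adm_mono[OF step.prems(6)] dB) blast
      show "\<Phi> = \<Psi> \<or> nested \<chi> \<sigma> (U - V)"
        using step.prems(7) unfolding nested_def by (blast intro: before_mono)
    qed (use step.prems(2) False in auto)
    \<comment> \<open>\<open>ev_remove\<close> read backwards within \<open>\<tau>\<close> alone.
      Both functionals are \<open>\<Psi>\<close> there, so nothing has to be nested.\<close>
    also have "ev \<Psi> \<Psi> \<chi> (\<tau> - {V}) (ins \<chi> q d Z) = ev \<Psi> \<Psi> \<chi> \<tau> Z"
      unfolding d_def
      by (rule ev_remove[OF \<Psi>(1) assms(2) bnc V\<tau>(1) is_last_interval[OF bnc lst] q, symmetric])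
        (use adm_mono[OF step.prems(6)] in auto)
    also have "ev \<Phi> \<Psi> \<chi> \<sigma> (ins \<chi> p (ev \<Psi> \<Psi> \<chi> \<tau> Z) (ins \<chi> q d Z)) =
        ev \<Phi> \<Psi> \<chi> \<sigma> (ins \<chi> p (ev \<Psi> \<Psi> \<chi> \<tau> Z) Z)"
    proof (rule ev_cong[OF assms(3,1) \<Psi>(1)])
      fix x assume "x \<in> S"
      then have "x \<noteq> q" using qU step.prems(2) by blast
      then show "ins \<chi> p (ev \<Psi> \<Psi> \<chi> \<tau> Z) (ins \<chi> q d Z) x = ins \<chi> p (ev \<Psi> \<Psi> \<chi> \<tau> Z) Z x"
        by (cases "x = p") (auto simp: ins_def split: side.splits)
    qed
    finally show ?thesis .
  qed
qed simp

end

section \<open>Ordered products\<close>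

lemma oprod_empty [simp]: "oprod Z {} = 1"
  by (simp add: oprod_def)

lemma oprod_single [simp]: "oprod Z {x} = Z x"
  by (simp add: oprod_def)

lemma oprod_cong: "(\<And>x. x \<in> S \<Longrightarrow> Z x = Z' x) \<Longrightarrow> oprod Z S = oprod Z' S"
  unfolding oprod_def by (cases "finite S") (auto intro!: arg_cong[of _ _ prod_list])

lemma oprod_Un:
  assumes "finite A" "finite B" "\<And>a b. a \<in> A \<Longrightarrow> b \<in> B \<Longrightarrow> a < b"
  shows "oprod Z (A \<union> B) = oprod Z A * oprod Z B"
proof -
  have "sorted_list_of_set (A \<union> B) = sorted_list_of_set A @ sorted_list_of_set B"
    using assms by (intro sorted_distinct_set_unique) (auto simp: sorted_append intro: less_imp_le)
  then show ?thesis by (simp add: oprod_def)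
qed

lemma oprod_split:
  assumes "finite S" "x \<in> S"
  shows "oprod Z S = oprod Z {i \<in> S. i < x} * Z x * oprod Z {i \<in> S. x < i}"
proof -
  have S: "S = ({i \<in> S. i < x} \<union> {x}) \<union> {i \<in> S. x < i}"
    using assms(2) by auto
  have "oprod Z S = oprod Z ({i \<in> S. i < x} \<union> {x}) * oprod Z {i \<in> S. x < i}"
    by (subst S, rule oprod_Un) (auto simp: assms(1))
  also have "oprod Z ({i \<in> S. i < x} \<union> {x}) = oprod Z {i \<in> S. i < x} * oprod Z {x}"
    by (rule oprod_Un) (auto simp: assms(1))
  finally show ?thesis by simp
qed

lemma oprod_additive:
  fixes Z :: "nat \<Rightarrow> 'a::ring_1"
  assumes "finite S" "x \<in> S"
  shows "oprod (Z(x := a + a')) S = oprod (Z(x := a)) S + oprod (Z(x := a')) S"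
proof -
  have "oprod (Z(x := b)) {i \<in> S. i < x} = oprod Z {i \<in> S. i < x}"
    "oprod (Z(x := b)) {i \<in> S. x < i} = oprod Z {i \<in> S. x < i}" for b
    by (auto intro: oprod_cong)
  then show ?thesis
    by (simp add: oprod_split[OF assms] algebra_simps)
qed


section \<open>Cumulants\<close>

context bifree_ops
begin

lemma prod_list_face: "(\<And>x. x \<in> set xs \<Longrightarrow> x \<in> face L R B s) \<Longrightarrow> prod_list xs \<in> face L R B s"
  by (induction xs) (auto intro: face_1 face_mult)

lemma oprod_face: "(\<And>q. q \<in> S \<Longrightarrow> Z q \<in> face L R B s) \<Longrightarrow> oprod Z S \<in> face L R B s"
  unfolding oprod_def by (cases "finite S") (auto intro!: prod_list_face face_1)

text \<open>Outer blocks get the cumulants of \<open>G\<close>, nested ones those of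
  \<open>H\<close>. \<open>G = H = E\<close> gives the bi-free cumulants and \<open>G = F\<close>,
  \<open>H = E\<close> the conditional ones, so both are handled by the same lemmas.\<close>

function cum :: "(nat \<Rightarrow> side) \<Rightarrow> ('a \<Rightarrow> 'd) \<Rightarrow> ('a \<Rightarrow> 'd) \<Rightarrow> nat set \<Rightarrow> (nat \<Rightarrow> 'a) \<Rightarrow> 'd"
  where "cum \<chi> G H S Z = G (oprod Z S) -
    (\<Sum>\<sigma> \<in> BNC \<chi> S - {{S}}. ev (\<lambda>V Z. cum \<chi> G H V Z) (\<lambda>V Z. cum \<chi> H H V Z) \<chi> \<sigma> Z)"
  by pat_completeness auto
termination
proof (relation "measure (\<lambda>(\<chi>, G, H, S, Z). card S)", goal_cases)
  case (2 \<chi> G H S Z \<sigma> V)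
  then have "V \<subset> S" using BNC_psubset[of \<sigma> \<chi> S V] by blast
  then show ?case using 2 BNC_finite[of \<sigma> \<chi> S] by (simp add: psubset_card_mono)
next
  case (3 \<chi> G H S Z \<sigma> V)
  then have "V \<subset> S" using BNC_psubset[of \<sigma> \<chi> S V] by blast
  then show ?case using 3 BNC_finite[of \<sigma> \<chi> S] by (simp add: psubset_card_mono)
qed auto

declare cum.simps [simp del]

lemma cum_moment:
  assumes "finite S" "S \<noteq> {}"
  shows "G (oprod Z S) = (\<Sum>\<sigma>\<in>BNC \<chi> S. ev (cum \<chi> G H) (cum \<chi> H H) \<chi> \<sigma> Z)"
proof -
  have "(\<Sum>\<sigma>\<in>BNC \<chi> S. ev (cum \<chi> G H) (cum \<chi> H H) \<chi> \<sigma> Z) =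
      cum \<chi> G H S Z + (\<Sum>\<sigma>\<in>BNC \<chi> S - {{S}}. ev (cum \<chi> G H) (cum \<chi> H H) \<chi> \<sigma> Z)"
    by (subst sum.remove[OF finite_BNC BNC_single[OF assms]]) (simp add: ev_single assms)
  then show ?thesis
    by (simp add: cum.simps[of \<chi> G H S Z])
qed

text \<open>Truncation makes the properties of \<open>cum\<close> on proper subsets available to the lemmas on \<open>ev\<close>,
  which demand them for all sets.\<close>

definition trunc :: "nat set \<Rightarrow> (nat set \<Rightarrow> (nat \<Rightarrow> 'a) \<Rightarrow> 'd) \<Rightarrow> nat set \<Rightarrow> (nat \<Rightarrow> 'a) \<Rightarrow> 'd"
  where "trunc S \<Phi> V Z = (if V \<subset> S then \<Phi> V Z else 0)"

lemma cum_trunc: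
  "cum \<chi> G H S Z = G (oprod Z S) -
    (\<Sum>\<sigma> \<in> BNC \<chi> S - {{S}}. ev (trunc S (cum \<chi> G H)) (trunc S (cum \<chi> H H)) \<chi> \<sigma> Z)"
proof -
  have "ev (cum \<chi> G H) (cum \<chi> H H) \<chi> \<sigma> Z =
      ev (trunc S (cum \<chi> G H)) (trunc S (cum \<chi> H H)) \<chi> \<sigma> Z" if "\<sigma> \<in> BNC \<chi> S - {{S}}" for \<sigma>
    using that BNC_psubset[of \<sigma> \<chi> S] by (intro ev_fun_cong) (auto simp: trunc_def)
  then show ?thesis
    by (simp add: cum.simps[of \<chi> G H S Z])
qed

text \<open>For infinite \<open>S\<close> there are no partitions and the ordered product is empty.
  This covers the claims about \<open>cum\<close> that are made for arbitrary sets.\<close>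

lemma cum_infinite: "infinite S \<Longrightarrow> cum \<chi> G H S Z = G 1"
  by (simp add: cum.simps[of \<chi> G H S Z] BNC_def oprod_def)

lemma is_local_cum: "is_local (cum \<chi> G H)"
proof -
  \<comment> \<open>\<open>G\<close> is quantified because the induction hypothesis is needed both
    for \<open>cum \<chi> G H\<close> and for the inner \<open>cum \<chi> H H\<close>.\<close>
  have "\<forall>G Z Z'. (\<forall>x\<in>S. Z x = Z' x) \<longrightarrow> cum \<chi> G H S Z = cum \<chi> G H S Z'" for S
  proof (cases "finite S")
    case True
    then show ?thesis
    proof (induction S rule: finite_psubset_induct)
      case (psubset S)
      then have loc: "is_local (trunc S (cum \<chi> G H))" for G
        unfolding is_local_def trunc_def by simp
      show ?case
      proof (intro allI impI)
        fix G Z Z' assume *: "\<forall>x\<in>S. Z x = (Z' x :: 'a)"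
        have "ev (trunc S (cum \<chi> G H)) (trunc S (cum \<chi> H H)) \<chi> \<sigma> Z =
            ev (trunc S (cum \<chi> G H)) (trunc S (cum \<chi> H H)) \<chi> \<sigma> Z'" if "\<sigma> \<in> BNC \<chi> S" for \<sigma>
          using * by (intro ev_cong[OF that loc loc]) blast
        moreover have "oprod Z S = oprod Z' S" using * by (intro oprod_cong) blast
        ultimately show "cum \<chi> G H S Z = cum \<chi> G H S Z'"
          unfolding cum_trunc[of \<chi> G H S] by simp
      qed
    qed
  qed (simp add: cum_infinite)
  then show ?thesis unfolding is_local_def by blast
qed

definition mom :: "('a \<Rightarrow> 'd) \<Rightarrow> nat set \<Rightarrow> (nat \<Rightarrow> 'a) \<Rightarrow> 'd"
  where "mom G S Z = G (oprod Z S)"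

lemma is_local_mom: "is_local (mom G)"
  unfolding is_local_def mom_def using oprod_cong by metis

text \<open>By induction on the set, \<open>ev_rmod\<close> gives the right module property for
  every subtracted term; for the moment it is assumed.\<close>

lemma is_inner_cum:
  assumes "is_inner \<chi> (mom H)"
  shows "is_inner \<chi> (cum \<chi> H H)"
proof -
  note H = is_innerD[OF assms]
  have "(\<forall>Z. cum \<chi> H H S Z \<in> B) \<and> (\<forall>Z x c. adm \<chi> S Z \<longrightarrow> x \<in> S \<longrightarrow>
    (\<forall>v\<in>S. key \<chi> v \<le> key \<chi> x) \<longrightarrow> c \<in> B \<longrightarrow> cum \<chi> H H S (ins \<chi> x c Z) = cum \<chi> H H S Z * c)"
    if "finite S" for S
    using that
  proof (induction S rule: finite_psubset_induct)
    case (psubset S)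
    then have inn: "is_inner \<chi> (trunc S (cum \<chi> H H))"
      using is_local_cum unfolding is_inner_def is_local_def trunc_def
      by (auto simp: B_0)
    show ?case
    proof (intro conjI allI impI)
      fix Z
      show "cum \<chi> H H S Z \<in> B"
        unfolding cum_trunc[of \<chi> H H S Z]
        using H(2)[of S Z] is_innerD(2)[OF inn]
        by (auto simp: mom_def intro!: B_diff B_sum ev_in_B)
      fix x c assume *: "adm \<chi> S Z" "x \<in> S" "\<forall>v\<in>S. key \<chi> v \<le> key \<chi> x" "c \<in> B"
      have "ev (trunc S (cum \<chi> H H)) (trunc S (cum \<chi> H H)) \<chi> \<sigma> (ins \<chi> x c Z) =
          ev (trunc S (cum \<chi> H H)) (trunc S (cum \<chi> H H)) \<chi> \<sigma> Z * c" if "\<sigma> \<in> BNC \<chi> S" for \<sigma>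
        using * by (intro ev_rmod[OF that inn]) auto
      then show "cum \<chi> H H S (ins \<chi> x c Z) = cum \<chi> H H S Z * c"
        using H(3)[OF psubset.hyps(1) *(1,2) _ *(4)] *(3)
        by (simp add: cum_trunc[of \<chi> H H S] mom_def left_diff_distrib sum_distrib_right)
    qed
  qed
  note fin = this
  have "cum \<chi> H H S Z \<in> B" for S Z
    using fin H(2)[of "{}" Z] by (cases "finite S") (auto simp: cum_infinite mom_def)
  then show ?thesis
    using is_local_cum fin unfolding is_inner_def by simp
qed

text \<open>Needed for \<open>ev_subst\<close>, where a sum over partitions is inserted into an
  entry and has to be expanded.\<close>

lemma is_additive_cum:
  assumes "\<And>x y. G (x + y) = G x + G y" "\<And>x y. H (x + y) = H x + H y" "is_inner \<chi> (mom H)"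
  shows "is_additive (cum \<chi> G H)"
proof -
  have "\<forall>G. (\<forall>x y. G (x + y) = G x + G y) \<longrightarrow> (\<forall>Z x a a'. x \<in> S \<longrightarrow>
    cum \<chi> G H S (Z(x := a + a')) = cum \<chi> G H S (Z(x := a)) + cum \<chi> G H S (Z(x := a')))"
    if "finite S" for S
    using that
  proof (induction S rule: finite_psubset_induct)
    case (psubset S)
    have loc: "is_local (trunc S (cum \<chi> G H))" for G
      using is_local_cum unfolding is_local_def trunc_def by simp
    have add: "is_additive (trunc S (cum \<chi> G H))" if "\<And>x y. G (x + y) = G x + G y" for G
      unfolding is_additive_def trunc_def
    proof (intro allI impI)
      fix V :: "nat set" and Z x a a' assume "finite V" "x \<in> V"
      then show "(if V \<subset> S then cum \<chi> G H V (Z(x := a + a')) else 0) =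
          (if V \<subset> S then cum \<chi> G H V (Z(x := a)) else 0) + (if V \<subset> S then cum \<chi> G H V (Z(x := a')) else 0)"
        using psubset.IH[rule_format, of V G x Z a a'] that by (simp del: fun_upd_apply)
    qed
    have inB: "trunc S (cum \<chi> H H) V Z \<in> B" for V Z
      using is_innerD(2)[OF is_inner_cum[OF assms(3)]] by (simp add: trunc_def B_0)
    show ?case
    proof (intro allI impI)
      fix G :: "'a \<Rightarrow> 'd" and Z x a a' assume *: "\<forall>x y. G (x + y) = G x + G y" "x \<in> S"
      let ?ev = "ev (trunc S (cum \<chi> G H)) (trunc S (cum \<chi> H H)) \<chi>"
      have addG: "is_additive (trunc S (cum \<chi> G H))" by (rule add) (use * in blast)
      have "?ev \<sigma> (Z(x := a + a')) = ?ev \<sigma> (Z(x := a)) + ?ev \<sigma> (Z(x := a'))"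
        if "\<sigma> \<in> BNC \<chi> S" for \<sigma>
        by (rule ev_additive[OF that loc loc addG add[OF assms(2)] inB *(2)])
      then show "cum \<chi> G H S (Z(x := a + a')) = cum \<chi> G H S (Z(x := a)) + cum \<chi> G H S (Z(x := a'))"
        unfolding cum_trunc[of \<chi> G H S] oprod_additive[OF psubset.hyps(1) *(2)]
        using * by (simp add: sum.distrib)
    qed
  qed
  then show ?thesis
    using assms(1) unfolding is_additive_def by (simp del: fun_upd_apply)
qed

end

section \<open>Grouping of indices\<close>

text \<open>Any \<open>g\<close> that is monotone in the usual order is allowed. The grouping of the
  theorem is one instance; the identity is another and yields the moment-cumulant formula.\<close>

locale grouping = bifree_ops L R B
  for L R :: "'d::ring_1 \<Rightarrow> 'a::ring_1" and B :: "'d set" +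
  fixes \<chi> \<chi>' :: "nat \<Rightarrow> side" and g :: "nat \<Rightarrow> nat" and N :: "nat set"
  assumes finite_N: "finite N"
    and \<chi>'_eq: "q \<in> N \<Longrightarrow> \<chi>' q = \<chi> (g q)"
    and g_mono: "q \<in> N \<Longrightarrow> q' \<in> N \<Longrightarrow> q \<le> q' \<Longrightarrow> g q \<le> g q'"
begin

definition hat :: "nat set \<Rightarrow> nat set"
  where "hat V = {q \<in> N. g q \<in> V}"

definition group_prod :: "(nat \<Rightarrow> 'a) \<Rightarrow> nat \<Rightarrow> 'a"
  where "group_prod Z p = oprod Z (hat {p})"

lemma finite_hat: "finite (hat V)"
  using finite_N by (simp add: hat_def)

lemma hat_Un: "hat (V \<union> W) = hat V \<union> hat W"
  by (auto simp: hat_def)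

lemma hat_Diff: "hat (V - W) = hat V - hat W"
  by (auto simp: hat_def)

lemma hat_mono: "V \<subseteq> W \<Longrightarrow> hat V \<subseteq> hat W"
  by (auto simp: hat_def)

lemma hat_disjoint: "V \<inter> W = {} \<Longrightarrow> hat V \<inter> hat W = {}"
  by (auto simp: hat_def)

lemma hat_nonempty: "V \<subseteq> g ` N \<Longrightarrow> V \<noteq> {} \<Longrightarrow> hat V \<noteq> {}"
  by (auto simp: hat_def)

lemma hat_in: "x \<in> hat V \<Longrightarrow> g x \<in> V" "x \<in> hat V \<Longrightarrow> x \<in> N"
  by (auto simp: hat_def)

lemma hat_subset_iff: "V \<subseteq> g ` N \<Longrightarrow> hat V \<subseteq> hat W \<longleftrightarrow> V \<subseteq> W"
  by (auto simp: hat_def)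

text \<open>Sides are constant on groups, and the chi-order follows the usual order on the left and
  reverses it on the right, for indices and for groups alike; so \<open>g\<close> is monotone for
  the chi-orders too.\<close>

lemma key_less:
  assumes "x \<in> N" "y \<in> N" "key \<chi> (g x) < key \<chi> (g y)"
  shows "key \<chi>' x < key \<chi>' y"
proof -
  have "x < y" if "g x < g y" using g_mono[OF assms(2,1)] that by force
  moreover have "y < x" if "g y < g x" using g_mono[OF assms(1,2)] that by force
  ultimately show ?thesis
    using assms(3) \<chi>'_eq[OF assms(1)] \<chi>'_eq[OF assms(2)]
    unfolding chi_less_key[symmetric] chi_less_def by (auto split: side.splits)
qed

lemma key_le:
  "x \<in> N \<Longrightarrow> y \<in> N \<Longrightarrow> key \<chi>' x \<le> key \<chi>' y \<Longrightarrow> key \<chi> (g x) \<le> key \<chi> (g y)"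
  using key_less[of y x] by force

lemma before_hat: "before \<chi> V W \<Longrightarrow> before \<chi>' (hat V) (hat W)"
  unfolding before_def hat_def using key_less by blast

text \<open>The groups are consecutive in the usual order, so concatenating them gives the full
  product. This is why a moment of the whole word does not see the grouping.\<close>

lemma oprod_hat:
  assumes "finite P"
  shows "oprod (group_prod Z) P = oprod Z (hat P)"
  using assms
proof (induction P rule: finite_linorder_max_induct)
  case (insert b A)
  have "oprod (group_prod Z) (A \<union> {b}) = oprod (group_prod Z) A * group_prod Z b"
    using insert.hyps by (subst oprod_Un) auto
  moreover have "oprod Z (hat (A \<union> {b})) = oprod Z (hat A) * oprod Z (hat {b})"
    unfolding hat_Un
  proof (rule oprod_Un[OF finite_hat finite_hat])
    fix x y assume "x \<in> hat A" "y \<in> hat {b}"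
    then have "x \<in> N" "y \<in> N" "g x < g y" using insert.hyps by (auto simp: hat_def)
    then show "x < y" using g_mono[of y x] by force
  qed
  moreover have "group_prod Z b = oprod Z (hat {b})"
    by (simp add: group_prod_def)
  ultimately show ?case
    using insert.IH by simp
qed (simp add: hat_def)

lemma adm_group_prod: "adm \<chi>' (hat S) Z \<Longrightarrow> adm \<chi> S (group_prod Z)"
  unfolding adm_def group_prod_def
  by (auto intro!: oprod_face simp: hat_def) (metis \<chi>'_eq)

text \<open>The chi-last index of a group is its largest index on the left and its smallest on the
  right. The inserted operator therefore stands at the right end, respectively the left end, of the
  product.\<close>

lemma group_prod_ins:
  assumes "x \<in> hat {p}" "\<And>y. y \<in> hat {p} \<Longrightarrow> key \<chi>' y \<le> key \<chi>' x"
  shows "group_prod (ins \<chi>' x c Z) = ins \<chi> p c (group_prod Z)"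
proof
  fix p'
  show "group_prod (ins \<chi>' x c Z) p' = ins \<chi> p c (group_prod Z) p'"
  proof (cases "p' = p")
    case False
    then have "x \<notin> hat {p'}" using assms(1) by (auto simp: hat_def)
    then have "oprod (ins \<chi>' x c Z) (hat {p'}) = oprod Z (hat {p'})"
      by (intro oprod_cong ins_notin)
    then show ?thesis using False by (simp add: group_prod_def)
  next
    case True
    have side: "\<chi>' y = \<chi> p" if "y \<in> hat {p}" for y
      using that \<chi>'_eq by (auto simp: hat_def)
    have less: "\<not> chi_less \<chi>' x y" if "y \<in> hat {p}" for y
      using assms(2)[OF that] by (simp add: chi_less_key)
    let ?H = "hat {p}"
    have cong: "oprod (ins \<chi>' x c Z) {i \<in> ?H. i < x} = oprod Z {i \<in> ?H. i < x}"
      "oprod (ins \<chi>' x c Z) {i \<in> ?H. x < i} = oprod Z {i \<in> ?H. x < i}"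
      by (auto intro: oprod_cong)
    have "oprod (ins \<chi>' x c Z) ?H = (case \<chi> p of Lft \<Rightarrow> oprod Z ?H * L c | Rgt \<Rightarrow> R c * oprod Z ?H)"
    proof (cases "\<chi> p")
      case Lft
      have "{i \<in> ?H. x < i} = {}"
        using less side assms(1) Lft by (auto simp: chi_less_def)
      then have "oprod Z {i \<in> ?H. x < i} = 1" by (simp only: oprod_empty)
      moreover have "ins \<chi>' x c Z x = Z x * L c"
        using side[OF assms(1)] Lft by (simp add: ins_def)
      ultimately show ?thesis
        using Lft by (simp add: oprod_split[OF finite_hat assms(1)] cong mult.assoc)
    next
      case Rgt
      have "{i \<in> ?H. i < x} = {}"
        using less side assms(1) Rgt by (auto simp: chi_less_def)
      then have "oprod Z {i \<in> ?H. i < x} = 1" by (simp only: oprod_empty)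
      moreover have "ins \<chi>' x c Z x = R c * Z x"
        using side[OF assms(1)] Rgt by (simp add: ins_def)
      ultimately show ?thesis
        using Rgt by (simp add: oprod_split[OF finite_hat assms(1)] cong mult.assoc)
    qed
    then show ?thesis
      using True by (simp add: group_prod_def ins_def[of \<chi> p c "group_prod Z"] split: side.split)
  qed
qed

section \<open>Refinements chosen block by block\<close>

definition block_sets :: "(nat set \<Rightarrow> nat set set set) \<Rightarrow> nat set set \<Rightarrow> nat set set set"
  where "block_sets D \<pi> = {\<sigma> \<in> BNC \<chi>' (hat (\<Union>\<pi>)). (\<forall>T\<in>\<sigma>. \<exists>V\<in>\<pi>. T \<subseteq> hat V) \<and>
    (\<forall>V\<in>\<pi>. {T \<in> \<sigma>. T \<subseteq> hat V} \<in> D V)}"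

lemma block_sets_Union:
  assumes "\<pi> \<in> BNC \<chi> P" "\<sigma> \<in> BNC \<chi>' (hat P)" "\<forall>T\<in>\<sigma>. \<exists>V\<in>\<pi>. T \<subseteq> hat V" "V \<in> \<pi>"
  shows "{T \<in> \<sigma>. T \<subseteq> hat V} \<in> BNC \<chi>' (hat V)"
proof -
  have "\<Union>{T \<in> \<sigma>. T \<subseteq> hat V} = hat V"
  proof (intro equalityI subsetI)
    fix x assume x: "x \<in> hat V"
    then have "x \<in> hat P" using hat_mono BNC_block(3)[OF assms(1,4)] by blast
    then obtain T where T: "T \<in> \<sigma>" "x \<in> T" using BNC_obtain_block[OF assms(2)] by blast
    then obtain V' where V': "V' \<in> \<pi>" "T \<subseteq> hat V'" using assms(3) by blast
    then have "V' = V"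
      using BNC_disjoint[OF assms(1) V'(1) assms(4), of "g x"] x T by (auto simp: hat_def)
    with T V' show "x \<in> \<Union>{T \<in> \<sigma>. T \<subseteq> hat V}" by blast
  qed blast
  then show ?thesis
    using BNC_subset[OF assms(2), of "{T \<in> \<sigma>. T \<subseteq> hat V}"] by auto
qed

text \<open>A crossing of \<open>T\<close> inside \<open>hat V\<close> with \<open>hat U\<close> is
  carried by \<open>g\<close> to a crossing of \<open>V\<close> with \<open>U\<close>. The
  comparisons stay strict because \<open>V\<close> and \<open>U\<close> have no group in
  common.\<close>

lemma block_sets_glue:
  assumes "\<pi> \<in> BNC \<chi> P" "U \<in> \<pi>" "\<sigma> \<in> block_sets D (\<pi> - {U})" "\<tau> \<in> BNC \<chi>' (hat U)"
  shows "\<sigma> \<in> BNC \<chi>' (hat (P - U))" "\<sigma> \<union> \<tau> \<in> BNC \<chi>' (hat P)"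
    "T \<in> \<sigma> \<Longrightarrow> T \<inter> hat U = {}"
proof -
  have "\<Union>(\<pi> - {U}) = P - U"
    using BNC_Union[OF BNC_remove[OF assms(1,2)]] .
  then show \<sigma>: "\<sigma> \<in> BNC \<chi>' (hat (P - U))"
    using assms(3) by (simp add: block_sets_def)
  then show disj: "T \<inter> hat U = {}" if "T \<in> \<sigma>" for T
    using BNC_block(3)[OF \<sigma> that] by (auto simp: hat_def)
  have "\<sigma> \<union> \<tau> \<in> BNC \<chi>' (hat (P - U) \<union> hat U)"
  proof (rule BNC_glue[OF \<sigma> assms(4)])
    fix T a b c d assume *: "T \<in> \<sigma>" "a \<in> T" "c \<in> T" "b \<in> hat U" "d \<in> hat U"
    obtain V where V: "V \<in> \<pi>" "V \<noteq> U" "T \<subseteq> hat V"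
      using assms(3) *(1) unfolding block_sets_def by blast
    have N: "a \<in> N" "b \<in> N" "c \<in> N" "d \<in> N" "g a \<in> V" "g c \<in> V" "g b \<in> U" "g d \<in> U"
      using * V(3) by (auto simp: hat_def)
    have neq: "g v \<noteq> g u" if "g v \<in> V" "g u \<in> U" for v u
      using BNC_disjoint[OF assms(1) V(1) assms(2)] V(2) that by metis
    have lt: "key \<chi> (g x) < key \<chi> (g y)" if "key \<chi>' x < key \<chi>' y" "g x \<noteq> g y" "x \<in> N" "y \<in> N" for x y
      using key_le[OF that(3,4)] that(1,2) by (auto simp: order_le_less)
    note n = neq[OF N(5,7)] neq[OF N(5,8)] neq[OF N(6,7)] neq[OF N(6,8)]
    show "\<not> (key \<chi>' a < key \<chi>' b \<and> key \<chi>' b < key \<chi>' c \<and> key \<chi>' c < key \<chi>' d) \<and>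
      \<not> (key \<chi>' b < key \<chi>' a \<and> key \<chi>' a < key \<chi>' d \<and> key \<chi>' d < key \<chi>' c)"
      using BNC_cross[OF assms(1) V(1) assms(2) N(5,7,6,8)] BNC_cross[OF assms(1,2) V(1) N(7,5,8,6)]
        lt[of a b] lt[of b c] lt[of c d] lt[of b a] lt[of a d] lt[of d c] n N V(2) by metis
  qed (auto simp: hat_def)
  then show "\<sigma> \<union> \<tau> \<in> BNC \<chi>' (hat P)"
    using BNC_block(3)[OF assms(1,2)] by (simp add: Un_absorb2 flip: hat_Un)
qed

text \<open>A member of \<open>block_sets D \<pi>\<close> amounts to a choice of one element of
  \<open>D V\<close> for each \<open>V\<close>. Splitting off the part inside \<open>hat U\<close>
  inverts the union with the choice for \<open>U\<close>.\<close>

lemma block_sets_remove: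
  assumes "\<pi> \<in> BNC \<chi> P" "P \<subseteq> g ` N" "U \<in> \<pi>" "\<And>V. V \<in> \<pi> \<Longrightarrow> D V \<subseteq> BNC \<chi>' (hat V)"
  shows "(\<Sum>\<sigma>\<in>block_sets D \<pi>. f \<sigma>) = (\<Sum>\<sigma>\<in>block_sets D (\<pi> - {U}). \<Sum>\<tau>\<in>D U. f (\<sigma> \<union> \<tau>))"
proof -
  note bnc' = BNC_remove[OF assms(1,3)]
  have Un: "\<Union>\<pi> = P" "\<Union>(\<pi> - {U}) = P - U"
    using BNC_Union[OF assms(1)] BNC_Union[OF bnc'] by auto
  have hU: "hat U \<noteq> {}" using hat_nonempty BNC_block[OF assms(1,3)] assms(2) by blast
  have \<tau>U: "T \<subseteq> hat U" "T \<noteq> {}" if "\<tau> \<in> D U" "T \<in> \<tau>" for T \<tau>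
    using that assms(3,4) BNC_block by blast+
  have disj: "hat V \<inter> hat U = {}" if "V \<in> \<pi> - {U}" for V
    using BNC_disjoint[OF assms(1) _ assms(3), of V] that by (intro hat_disjoint) blast
  have "(\<Sum>\<sigma>\<in>block_sets D (\<pi> - {U}). \<Sum>\<tau>\<in>D U. f (\<sigma> \<union> \<tau>)) =
      (\<Sum>(\<sigma>, \<tau>)\<in>block_sets D (\<pi> - {U}) \<times> D U. f (\<sigma> \<union> \<tau>))"
    by (rule sum.cartesian_product)
  also have "\<dots> = (\<Sum>\<sigma>\<in>block_sets D \<pi>. f \<sigma>)"
  proof (rule sum.reindex_bij_witness[where j = "\<lambda>(\<sigma>, \<tau>). \<sigma> \<union> \<tau>"
        and i = "\<lambda>\<sigma>. ({T \<in> \<sigma>. \<not> T \<subseteq> hat U}, {T \<in> \<sigma>. T \<subseteq> hat U})"])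
    fix x assume "x \<in> block_sets D (\<pi> - {U}) \<times> D U"
    then obtain \<sigma> \<tau> where x: "x = (\<sigma>, \<tau>)" "\<sigma> \<in> block_sets D (\<pi> - {U})" "\<tau> \<in> D U" by blast
    have \<tau>: "\<tau> \<in> BNC \<chi>' (hat U)" using x(3) assms(3,4) by blast
    note glue = block_sets_glue[OF assms(1,3) x(2) \<tau>]
    have ne: "\<not> T \<subseteq> hat U" if "T \<in> \<sigma>" for T
      using glue(3)[OF that] BNC_block(1)[OF glue(1) that] by blast
    have eq: "{T \<in> \<sigma> \<union> \<tau>. \<not> T \<subseteq> hat U} = \<sigma>" "{T \<in> \<sigma> \<union> \<tau>. T \<subseteq> hat U} = \<tau>"
      using ne \<tau>U(1)[OF x(3)] by blast+
    then show "(case case x of (\<sigma>, \<tau>) \<Rightarrow> \<sigma> \<union> \<tau> of \<sigma> \<Rightarrow> ({T \<in> \<sigma>. \<not> T \<subseteq> hat U}, {T \<in> \<sigma>. T \<subseteq> hat U})) = x"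
      by (simp add: x(1))
    have "{T \<in> \<sigma> \<union> \<tau>. T \<subseteq> hat V} \<in> D V" if "V \<in> \<pi>" for V
    proof (cases "V = U")
      case False
      then have V: "V \<in> \<pi> - {U}" using that by blast
      have "\<not> T \<subseteq> hat V" if "T \<in> \<tau>" for T
        using disj[OF V] \<tau>U[OF x(3) that] by blast
      then have "{T \<in> \<sigma> \<union> \<tau>. T \<subseteq> hat V} = {T \<in> \<sigma>. T \<subseteq> hat V}" by blast
      then show ?thesis using x(2) V unfolding block_sets_def by auto
    qed (use eq x(3) in simp)
    moreover have "\<exists>V\<in>\<pi>. T \<subseteq> hat V" if "T \<in> \<sigma> \<union> \<tau>" for T
      using that x(2) \<tau>U(1)[OF x(3)] assms(3) unfolding block_sets_def by blast
    ultimately show "(case x of (\<sigma>, \<tau>) \<Rightarrow> \<sigma> \<union> \<tau>) \<in> block_sets D \<pi>"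
      unfolding block_sets_def using glue(2) x(1) Un by simp
  next
    fix \<sigma> assume \<sigma>: "\<sigma> \<in> block_sets D \<pi>"
    then have bnc: "\<sigma> \<in> BNC \<chi>' (hat P)" and fin: "\<forall>T\<in>\<sigma>. \<exists>V\<in>\<pi>. T \<subseteq> hat V"
      and D: "\<And>V. V \<in> \<pi> \<Longrightarrow> {T \<in> \<sigma>. T \<subseteq> hat V} \<in> D V"
      unfolding block_sets_def Un by blast+
    have sub: "{T \<in> \<sigma>. T \<subseteq> hat U} \<in> BNC \<chi>' (hat U)"
      using block_sets_Union[OF assms(1) bnc fin assms(3)] .
    have rest: "\<exists>V\<in>\<pi> - {U}. T \<subseteq> hat V" if "T \<in> \<sigma>" "\<not> T \<subseteq> hat U" for T
      using fin that by blast
    have rest': "\<not> T \<subseteq> hat U" if "T \<in> \<sigma>" "V \<in> \<pi> - {U}" "T \<subseteq> hat V" for T V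
      using disj[OF that(2)] that(3) BNC_block(1)[OF bnc that(1)] by blast
    have "\<Union>{T \<in> \<sigma>. \<not> T \<subseteq> hat U} = hat (P - U)"
    proof
      show "\<Union>{T \<in> \<sigma>. \<not> T \<subseteq> hat U} \<subseteq> hat (P - U)"
      proof (rule Sup_least)
        fix T assume "T \<in> {T \<in> \<sigma>. \<not> T \<subseteq> hat U}"
        then obtain V where "V \<in> \<pi> - {U}" "T \<subseteq> hat V" using rest by blast
        then show "T \<subseteq> hat (P - U)"
          using hat_mono[OF BNC_block(3)[OF bnc']] by blast
      qed
      show "hat (P - U) \<subseteq> \<Union>{T \<in> \<sigma>. \<not> T \<subseteq> hat U}"
        using BNC_Union[OF bnc] BNC_Union[OF sub] unfolding hat_Diff by blast
    qed
    then have "{T \<in> \<sigma>. \<not> T \<subseteq> hat U} \<in> BNC \<chi>' (hat (P - U))"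
      using BNC_subset[OF bnc, of "{T \<in> \<sigma>. \<not> T \<subseteq> hat U}"] by auto
    moreover have "{T \<in> {T \<in> \<sigma>. \<not> T \<subseteq> hat U}. T \<subseteq> hat V} \<in> D V" if "V \<in> \<pi> - {U}" for V
    proof -
      have "{T \<in> {T \<in> \<sigma>. \<not> T \<subseteq> hat U}. T \<subseteq> hat V} = {T \<in> \<sigma>. T \<subseteq> hat V}"
        using rest'[OF _ that] by blast
      then show ?thesis using D that by auto
    qed
    ultimately have "{T \<in> \<sigma>. \<not> T \<subseteq> hat U} \<in> block_sets D (\<pi> - {U})"
      unfolding block_sets_def Un using rest by blast
    then show "(case \<sigma> of \<sigma> \<Rightarrow> ({T \<in> \<sigma>. \<not> T \<subseteq> hat U}, {T \<in> \<sigma>. T \<subseteq> hat U})) \<in> block_sets D (\<pi> - {U}) \<times> D U"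
      using D[OF assms(3)] by simp
    show "(case ({T \<in> \<sigma>. \<not> T \<subseteq> hat U}, {T \<in> \<sigma>. T \<subseteq> hat U}) of (\<sigma>, \<tau>) \<Rightarrow> \<sigma> \<union> \<tau>) = \<sigma>"
      by auto
  qed auto
  finally show ?thesis by simp
qed

lemma chi_interval_hat:
  assumes "chi_interval \<chi> P U" "U \<subseteq> P"
  shows "chi_interval \<chi>' (hat P) (hat U)"
proof (rule chi_intervalI)
  fix a b c assume *: "a \<in> hat U" "c \<in> hat U" "b \<in> hat P" "key \<chi>' a < key \<chi>' b" "key \<chi>' b < key \<chi>' c"
  then have N: "a \<in> N" "b \<in> N" "c \<in> N" "g a \<in> U" "g c \<in> U" "g b \<in> P" by (auto simp: hat_def)
  have "key \<chi> (g a) \<le> key \<chi> (g b)" "key \<chi> (g b) \<le> key \<chi> (g c)"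
    using key_le N * by auto
  then have "g b \<in> U"
    using chi_intervalD[OF assms(1) N(4,5,6)] N by (auto simp: order_le_less)
  then show "b \<in> hat U" using N by (simp add: hat_def)
qed (rule hat_mono[OF assms(2)])

text \<open>Groups before \<open>p\<close> stay before every index of group \<open>p\<close>, so
  only the chi-last index of that group can be the predecessor of \<open>hat U\<close>.\<close>

lemma is_pred_hat:
  assumes "is_pred \<chi> P U p" "chi_interval \<chi> P U" "U \<noteq> {}" "U \<subseteq> g ` N"
    and "x \<in> hat {p}" "\<And>y. y \<in> hat {p} \<Longrightarrow> key \<chi>' y \<le> key \<chi>' x"
  shows "is_pred \<chi>' (hat P) (hat U) x"
  unfolding is_pred_def
proof (intro conjI ballI impI)
  have p: "p \<in> P" "before \<chi> {p} U" using assms(1) by (auto simp: is_pred_def)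
  show "x \<in> hat P" using assms(5) p by (auto simp: hat_def)
  show "before \<chi>' {x} (hat U)"
    using before_mono[OF before_hat[OF p(2)]] assms(5) by blast
  fix s assume s: "s \<in> hat P" "before \<chi>' {s} (hat U)"
  obtain u where u: "u \<in> hat U" using hat_nonempty[OF assms(4,3)] by blast
  have gs: "g s \<in> P - U"
    using s beforeD[OF s(2), of s s] by (auto simp: hat_def)
  have "\<not> before \<chi> U {g s}"
    using beforeD[OF s(2), of s u] key_less[of u s] u s(1) unfolding before_def hat_def by force
  then have "before \<chi> {g s} U" using interval_cases[OF assms(2) gs] by blast
  then have le: "key \<chi> (g s) \<le> key \<chi> p" using assms(1) gs unfolding is_pred_def by blast
  show "key \<chi>' s \<le> key \<chi>' x"
  proof (cases "g s = p")
    case True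
    then show ?thesis using assms(6)[of s] s(1) by (simp add: hat_def)
  next
    case False
    then have "key \<chi> (g s) < key \<chi> (g x)"
      using le hat_in(1)[OF assms(5)] by (auto simp: order_le_less)
    then show ?thesis using key_less[of s x] s(1) assms(5) by (auto simp: hat_def)
  qed
qed

text \<open>Assumption \<open>span\<close> ensures that whatever is nested in a block \<open>V\<close> of \<open>\<pi>\<close> stays nested after
  refining \<open>V\<close>; otherwise the inner functional \<open>\<Psi>\<close> would turn into an outer one.\<close>

lemma ev_subst:
  assumes \<Phi>: "is_local \<Phi>" "is_additive \<Phi>" and \<Psi>: "is_inner \<chi>' \<Psi>" "is_additive \<Psi>"
    and \<pi>: "\<pi> \<in> BNC \<chi> P" "P \<subseteq> g ` N" and Z: "adm \<chi>' (hat P) Z"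
    and D: "\<And>V. V \<in> \<pi> \<Longrightarrow> D V \<subseteq> BNC \<chi>' (hat V)"
    and \<Theta>: "\<And>V Z. V \<in> \<pi> \<Longrightarrow> adm \<chi>' (hat V) Z \<Longrightarrow> \<Theta> V (group_prod Z) = (\<Sum>\<tau>\<in>D V. ev \<Phi> \<Psi> \<chi>' \<tau> Z)"
    and \<theta>: "\<And>V Z. V \<in> \<pi> \<Longrightarrow> adm \<chi>' (hat V) Z \<Longrightarrow> \<theta> V (group_prod Z) = (\<Sum>\<tau>\<in>D V. ev \<Psi> \<Psi> \<chi>' \<tau> Z)"
    and span: "\<And>V \<tau> v v' r. \<Phi> \<noteq> \<Psi> \<Longrightarrow> V \<in> \<pi> \<Longrightarrow> \<tau> \<in> D V \<Longrightarrow> v \<in> V \<Longrightarrow> v' \<in> V \<Longrightarrow>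
      key \<chi> v < r \<Longrightarrow> r < key \<chi> v' \<Longrightarrow> r \<notin> key \<chi> ` V \<Longrightarrow>
      \<exists>T\<in>\<tau>. \<exists>t\<in>T. \<exists>t'\<in>T. key \<chi> (g t) < r \<and> r < key \<chi> (g t')"
  shows "ev \<Theta> \<theta> \<chi> \<pi> (group_prod Z) = (\<Sum>\<sigma>\<in>block_sets D \<pi>. ev \<Phi> \<Psi> \<chi>' \<sigma> Z)"
  using \<pi> Z D \<Theta> \<theta> span
proof (induction arbitrary: Z rule: BNC_last_induct)
  case empty
  have "block_sets D {} = {{}}"
    unfolding block_sets_def using BNC_empty_iff by (auto simp: hat_def)
  then show ?case by simp
next
  case (step \<pi> P U)
  note bnc = step.hyps(1) and lst = step.hyps(2)
  note U\<pi> = is_last_in[OF lst]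
  note U = BNC_block[OF bnc U\<pi>]
  note inn = is_innerD[OF \<Psi>(1)]
  have hU: "hat U \<noteq> {}" using hat_nonempty U step.prems(1) by blast
  have DU: "D U \<subseteq> BNC \<chi>' (hat U)" using step.prems(3) U\<pi> by blast
  have admU: "adm \<chi>' (hat U) Z" and admPU: "adm \<chi>' (hat (P - U)) Z"
    using U(3) by (auto intro!: adm_mono[OF step.prems(2)] hat_mono)
  have IH: "ev \<Theta> \<theta> \<chi> (\<pi> - {U}) (group_prod Z') = (\<Sum>\<sigma>\<in>block_sets D (\<pi> - {U}). ev \<Phi> \<Psi> \<chi>' \<sigma> Z')"
    if "adm \<chi>' (hat (P - U)) Z'" for Z'
    by (rule step.IH[OF _ that]) (use step.prems in blast)+
  note rem = block_sets_remove[OF bnc step.prems(1) U\<pi> step.prems(3)]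
  note glue = block_sets_glue[OF bnc U\<pi> _ subsetD[OF DU]]
  show ?case
  proof (cases "before \<chi> (P - U) U")
    case True
    have "ev \<Theta> \<theta> \<chi> \<pi> (group_prod Z) = (\<Sum>\<sigma>\<in>block_sets D (\<pi> - {U}). ev \<Phi> \<Psi> \<chi>' \<sigma> Z) * (\<Sum>\<tau>\<in>D U. ev \<Phi> \<Psi> \<chi>' \<tau> Z)"
      unfolding ev_final[OF bnc lst True] IH[OF admPU] step.prems(4)[OF U\<pi> admU] ..
    also have "\<dots> = (\<Sum>\<sigma>\<in>block_sets D (\<pi> - {U}). \<Sum>\<tau>\<in>D U. ev \<Phi> \<Psi> \<chi>' (\<sigma> \<union> \<tau>) Z)"
      unfolding sum_product
    proof (intro sum.cong refl)
      fix \<sigma> \<tau> assume *: "\<sigma> \<in> block_sets D (\<pi> - {U})" "\<tau> \<in> D U"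
      show "ev \<Phi> \<Psi> \<chi>' \<sigma> Z * ev \<Phi> \<Psi> \<chi>' \<tau> Z = ev \<Phi> \<Psi> \<chi>' (\<sigma> \<union> \<tau>) Z"
        using ev_append[OF glue(1)[OF *] subsetD[OF DU *(2)] before_hat[OF True] \<Phi>(1) inn(1)] by simp
    qed
    finally show ?thesis
      using rem[where f = "\<lambda>\<sigma>. ev \<Phi> \<Psi> \<chi>' \<sigma> Z"] by simp
  next
    case False
    from ev_nestedE[OF bnc lst this] obtain p where pPU: "p \<in> P - U" and pred: "is_pred \<chi> P U p"
      and p: "\<And>\<Phi> \<Psi> Z. ev \<Phi> \<Psi> \<chi> \<pi> Z = ev \<Phi> \<Psi> \<chi> (\<pi> - {U}) (ins \<chi> p (\<Psi> U Z) Z)" by metis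
    have hp: "finite (hat {p})" "hat {p} \<noteq> {}"
      using finite_hat hat_nonempty[of "{p}"] pPU step.prems(1) by auto
    \<comment> \<open>The index of group \<open>p\<close> at which an insertion becomes an insertion
      at \<open>p\<close> in the products, by \<open>group_prod_ins\<close>.\<close>
    define x where "x = chi_Max \<chi>' (hat {p})"
    have x: "x \<in> hat {p}" "\<And>y. y \<in> hat {p} \<Longrightarrow> key \<chi>' y \<le> key \<chi>' x"
      unfolding x_def using chi_Max_key[OF hp] by auto
    have xPU: "x \<in> hat (P - U)" using x(1) pPU by (auto simp: hat_def)
    have int: "chi_interval \<chi> P U" using is_last_interval[OF bnc lst] .
    have evB: "ev \<Psi> \<Psi> \<chi>' \<tau> Z \<in> B" if "\<tau> \<in> D U" for \<tau>
      using ev_in_B[OF subsetD[OF DU that]] inn(2) by blast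
    have eqP: "hat (P - U) \<union> hat U = hat P"
      using U(3) hat_Un[of "P - U" U] by (simp add: Un_absorb2)
    have "ev \<Theta> \<theta> \<chi> \<pi> (group_prod Z) =
        ev \<Theta> \<theta> \<chi> (\<pi> - {U}) (group_prod (ins \<chi>' x (\<Sum>\<tau>\<in>D U. ev \<Psi> \<Psi> \<chi>' \<tau> Z) Z))"
      unfolding p step.prems(5)[OF U\<pi> admU] by (subst group_prod_ins[OF x]) simp_all
    also have "\<dots> = (\<Sum>\<sigma>\<in>block_sets D (\<pi> - {U}). ev \<Phi> \<Psi> \<chi>' \<sigma> (ins \<chi>' x (\<Sum>\<tau>\<in>D U. ev \<Psi> \<Psi> \<chi>' \<tau> Z) Z))"
      by (intro IH adm_ins admPU B_sum evB)
    also have "\<dots> = (\<Sum>\<sigma>\<in>block_sets D (\<pi> - {U}). \<Sum>\<tau>\<in>D U. ev \<Phi> \<Psi> \<chi>' (\<sigma> \<union> \<tau>) Z)"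
    proof (rule sum.cong[OF refl])
      fix \<sigma> assume \<sigma>: "\<sigma> \<in> block_sets D (\<pi> - {U})"
      have \<sigma>': "\<sigma> \<in> BNC \<chi>' (hat (P - U))"
        using \<sigma> BNC_Union[OF step.hyps(3)] by (simp add: block_sets_def)
      \<comment> \<open>Some block \<open>W\<close> of \<open>\<pi>\<close> encloses
        \<open>U\<close>. With the cut \<open>r\<close> placed at an element of \<open>U\<close>,
        \<open>span\<close> yields a block \<open>T\<close> inside \<open>hat W\<close> with
        elements on both sides of the cut; as \<open>U\<close> is an interval, \<open>T\<close>
        encloses all of \<open>hat U\<close>.\<close>
      have nest: "\<Phi> = \<Psi> \<or> nested \<chi>' \<sigma> (hat U)"
      proof (cases "\<Phi> = \<Psi>")
        case neq: False
        obtain W w w' where W: "W \<in> \<pi> - {U}" "w \<in> W" "w' \<in> W" "before \<chi> {w} U" "before \<chi> U {w'}"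
          using last_nested[OF bnc lst False] unfolding nested_def by blast
        obtain u where u: "u \<in> U" using U(1) by blast
        have "key \<chi> u \<notin> key \<chi> ` W"
          using BNC_disjoint[OF bnc _ U\<pi>, of W u] W(1) u by auto
        moreover have "{T \<in> \<sigma>. T \<subseteq> hat W} \<in> D W"
          using \<sigma> W(1) by (simp add: block_sets_def)
        ultimately obtain T t t' where T: "T \<in> \<sigma>" "T \<subseteq> hat W" "t \<in> T" "t' \<in> T"
          "key \<chi> (g t) < key \<chi> u" "key \<chi> u < key \<chi> (g t')"
          using step.prems(6)[OF neq _ _ W(2,3), of _ "key \<chi> u"] W(1) beforeD[OF W(4) _ u] beforeD[OF W(5) u]
          by blast
        have "g t \<in> P - U" "g t' \<in> P - U"
          using T BNC_block(3)[OF step.hyps(3) W(1)] by (auto simp: hat_def)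
        then have "before \<chi> {g t} U" "before \<chi> U {g t'}"
          using before_interval[OF int _ u T(5)] after_interval[OF int _ u T(6)] by auto
        note bef = this
        have "t \<in> hat {g t}" "t' \<in> hat {g t'}"
          using T(2-4) by (auto simp: hat_def)
        then have "before \<chi>' {t} (hat U)" "before \<chi>' (hat U) {t'}"
          using before_mono[OF before_hat[OF bef(1)], of "{t}" "hat U"]
            before_mono[OF before_hat[OF bef(2)], of "hat U" "{t'}"] by auto
        then show ?thesis unfolding nested_def using T by blast
      qed simp
      \<comment> \<open>Additivity takes the inserted sum apart; each summand is then the graft of
        one \<open>\<tau>\<close> into \<open>\<sigma>\<close>.\<close>
      have "ev \<Phi> \<Psi> \<chi>' \<sigma> (ins \<chi>' x (\<Sum>\<tau>\<in>D U. ev \<Psi> \<Psi> \<chi>' \<tau> Z) Z) =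
          (\<Sum>\<tau>\<in>D U. ev \<Phi> \<Psi> \<chi>' \<sigma> (ins \<chi>' x (ev \<Psi> \<Psi> \<chi>' \<tau> Z) Z))"
        using ev_ins_sum[OF \<sigma>' \<Phi>(1) inn(1) \<Phi>(2) \<Psi>(2) inn(2) xPU evB] .
      also have "\<dots> = (\<Sum>\<tau>\<in>D U. ev \<Phi> \<Psi> \<chi>' (\<sigma> \<union> \<tau>) Z)"
      proof (rule sum.cong[OF refl])
        fix \<tau> assume \<tau>: "\<tau> \<in> D U"
        show "ev \<Phi> \<Psi> \<chi>' \<sigma> (ins \<chi>' x (ev \<Psi> \<Psi> \<chi>' \<tau> Z) Z) = ev \<Phi> \<Psi> \<chi>' (\<sigma> \<union> \<tau>) Z"
        proof (rule ev_graft[OF \<Phi>(1) \<Psi>(1) \<sigma>' subsetD[OF DU \<tau>] _ _ hU _ _ _ nest, symmetric], unfold eqP)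
          show "\<sigma> \<union> \<tau> \<in> BNC \<chi>' (hat P)" using glue(2)[OF \<sigma> \<tau>] .
          show "hat (P - U) \<inter> hat U = {}" by (rule hat_disjoint) blast
          show "chi_interval \<chi>' (hat P) (hat U)" using chi_interval_hat[OF int U(3)] .
          show "is_pred \<chi>' (hat P) (hat U) x"
            using is_pred_hat[OF pred int U(1) _ x] U(3) step.prems(1) by blast
        qed (rule step.prems(2))
      qed
      finally show "ev \<Phi> \<Psi> \<chi>' \<sigma> (ins \<chi>' x (\<Sum>\<tau>\<in>D U. ev \<Psi> \<Psi> \<chi>' \<tau> Z) Z) =
          (\<Sum>\<tau>\<in>D U. ev \<Phi> \<Psi> \<chi>' (\<sigma> \<union> \<tau>) Z)" .
    qed
    finally show ?thesis
      using rem[where f = "\<lambda>\<sigma>. ev \<Phi> \<Psi> \<chi>' \<sigma> Z"] by simp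
  qed
qed

end

section \<open>Cumulants with products as entries\<close>

context grouping
begin

text \<open>The partitions \<open>\<tau>\<close> of \<open>hat V\<close> whose join with the partition into groups is the one-block
  partition.\<close>

definition connecting :: "nat set \<Rightarrow> nat set set set"
  where "connecting V = {\<tau> \<in> BNC \<chi>' (hat V). \<forall>\<rho>\<in>BNC \<chi> V. (\<forall>T\<in>\<tau>. \<exists>W\<in>\<rho>. T \<subseteq> hat W) \<longrightarrow> \<rho> = {V}}"

lemma connectingD:
  "\<tau> \<in> connecting V \<Longrightarrow> \<rho> \<in> BNC \<chi> V \<Longrightarrow> (\<And>T. T \<in> \<tau> \<Longrightarrow> \<exists>W\<in>\<rho>. T \<subseteq> hat W) \<Longrightarrow> \<rho> = {V}"
  unfolding connecting_def by blast

text \<open>If no block of \<open>\<tau>\<close> straddled \<open>r\<close>, cutting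
  \<open>V\<close> at \<open>r\<close> would give a bi-non-crossing partition with two blocks into
  whose hats \<open>\<tau>\<close> fits, contrary to \<open>connecting\<close>.\<close>

lemma connecting_span:
  assumes \<tau>: "\<tau> \<in> connecting V" and V: "finite V"
    and v: "v \<in> V" "v' \<in> V" "key \<chi> v < r" "r < key \<chi> v'" "r \<notin> key \<chi> ` V"
  shows "\<exists>T\<in>\<tau>. \<exists>t\<in>T. \<exists>t'\<in>T. key \<chi> (g t) < r \<and> r < key \<chi> (g t')"
proof (rule ccontr)
  assume no: "\<not> ?thesis"
  define V1 where "V1 = {v \<in> V. key \<chi> v < r}"
  define V2 where "V2 = {v \<in> V. r < key \<chi> v}"
  have VV: "V1 \<union> V2 = V" using v(5) by (auto simp: V1_def V2_def)
  have bnc: "{V1} \<union> {V2} \<in> BNC \<chi> (V1 \<union> V2)"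
  proof (rule BNC_glue)
    show "{V1} \<in> BNC \<chi> V1" "{V2} \<in> BNC \<chi> V2"
      using v(1-4) V by (auto simp: V1_def V2_def intro!: BNC_single)
  qed (auto simp: V1_def V2_def)
  have "\<exists>W\<in>{V1} \<union> {V2}. T \<subseteq> hat W" if T: "T \<in> \<tau>" for T
  proof -
    have "\<tau> \<in> BNC \<chi>' (hat V)" using \<tau> by (simp add: connecting_def)
    then have "T \<subseteq> hat V" using T by (rule BNC_block(3))
    then have T12: "t \<in> hat V1 \<or> t \<in> hat V2" if "t \<in> T" for t
      using that VV unfolding hat_def by blast
    show ?thesis
    proof (cases "\<exists>t\<in>T. r < key \<chi> (g t)")
      case True
      then have "T \<subseteq> hat V2" using no T T12 by (auto simp: hat_def V1_def)
      then show ?thesis by blast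
    next
      case False
      then have "T \<subseteq> hat V1" using T12 by (auto simp: hat_def V2_def)
      then show ?thesis by blast
    qed
  qed
  then have "{V1} \<union> {V2} = {V}"
    using connectingD[OF \<tau>] bnc unfolding VV by blast
  then have "V1 = V" by auto
  then have "v' \<in> V1" using v(2) by simp
  with v(4) show False by (simp add: V1_def)
qed

lemma block_sets_single: "block_sets connecting {P} = connecting P"
proof -
  have "{T \<in> \<sigma>. T \<subseteq> hat P} = \<sigma>" if "\<sigma> \<in> BNC \<chi>' (hat P)" for \<sigma>
    using BNC_block(3)[OF that] by blast
  moreover have "\<sigma> \<in> BNC \<chi>' (hat P)" if "\<sigma> \<in> connecting P" for \<sigma>
    using that by (simp add: connecting_def)
  ultimately show ?thesis
    unfolding block_sets_def using BNC_block(3) by auto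
qed

text \<open>Among the partitions of \<open>P\<close> into whose hats \<open>\<sigma>\<close> fits,
  take one with the most blocks. If its part over some \<open>V\<close> were not connecting,
  \<open>V\<close> could be refined and the number of blocks would grow.\<close>

lemma block_sets_connecting_cover:
  assumes "P \<subseteq> g ` N" "\<sigma> \<in> BNC \<chi>' (hat P)"
  obtains \<pi> where "\<pi> \<in> BNC \<chi> P" "\<sigma> \<in> block_sets connecting \<pi>"
proof -
  have finP: "finite P" using assms(1) finite_N finite_surj by blast
  define Q where "Q = {\<pi> \<in> BNC \<chi> P. \<forall>T\<in>\<sigma>. \<exists>V\<in>\<pi>. T \<subseteq> hat V}"
  have "finite Q" unfolding Q_def by simp
  moreover have "Q \<noteq> {}"
  proof (cases "P = {}")
    case True
    then have "{} \<in> Q"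
      using assms(2) BNC_empty_iff[OF assms(2)] by (simp add: Q_def hat_def)
    then show ?thesis by blast
  next
    case False
    then have "{P} \<in> Q"
      using BNC_single[OF finP] BNC_block(3)[OF assms(2)] by (auto simp: Q_def)
    then show ?thesis by blast
  qed
  ultimately obtain \<pi> where "\<pi> \<in> Q" and max: "Max (card ` Q) = card \<pi>"
    by (rule obtains_MAX)
  have \<pi>: "card \<rho> \<le> card \<pi>" if "\<rho> \<in> Q" for \<rho>
    unfolding max[symmetric] using \<open>finite Q\<close> that by simp
  from \<open>\<pi> \<in> Q\<close> have bnc: "\<pi> \<in> BNC \<chi> P" and fin: "\<forall>T\<in>\<sigma>. \<exists>V\<in>\<pi>. T \<subseteq> hat V" by (auto simp: Q_def)
  have "{T \<in> \<sigma>. T \<subseteq> hat V} \<in> connecting V" if V: "V \<in> \<pi>" for V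
    unfolding connecting_def
  proof (intro CollectI conjI ballI impI)
    show "{T \<in> \<sigma>. T \<subseteq> hat V} \<in> BNC \<chi>' (hat V)"
      by (rule block_sets_Union[OF bnc assms(2) fin V])
    fix \<rho> assume \<rho>: "\<rho> \<in> BNC \<chi> V" "\<forall>T\<in>{T \<in> \<sigma>. T \<subseteq> hat V}. \<exists>W\<in>\<rho>. T \<subseteq> hat W"
    have "\<exists>W\<in>(\<pi> - {V}) \<union> \<rho>. T \<subseteq> hat W" if "T \<in> \<sigma>" for T
    proof -
      obtain W where "W \<in> \<pi>" "T \<subseteq> hat W" using fin \<open>T \<in> \<sigma>\<close> by blast
      then show ?thesis using \<rho>(2) \<open>T \<in> \<sigma>\<close> by (cases "W = V") blast+
    qed
    then have "(\<pi> - {V}) \<union> \<rho> \<in> Q"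
      using BNC_refine[OF bnc V \<rho>(1)] by (simp add: Q_def)
    then have le: "card ((\<pi> - {V}) \<union> \<rho>) \<le> card \<pi>" by (rule \<pi>)
    have "(\<pi> - {V}) \<inter> \<rho> = {}"
    proof (rule ccontr)
      assume "(\<pi> - {V}) \<inter> \<rho> \<noteq> {}"
      then obtain X where X: "X \<in> \<pi>" "X \<noteq> V" "X \<in> \<rho>" by blast
      then show False
        using BNC_block[OF \<rho>(1) X(3)] BNC_disjoint[OF bnc X(1) V] by blast
    qed
    then have "card (\<pi> - {V}) + card \<rho> \<le> card \<pi>"
      using le card_Un_disjoint[of "\<pi> - {V}" \<rho>] BNC_finite_blocks[OF bnc] BNC_finite_blocks[OF \<rho>(1)] by simp
    moreover have "card \<pi> = Suc (card (\<pi> - {V}))"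
      using card_Suc_Diff1[of \<pi> V] BNC_finite_blocks[OF bnc] V by simp
    ultimately have "card \<rho> \<le> Suc 0" by simp
    moreover have "\<rho> \<noteq> {}" using BNC_empty_iff[OF \<rho>(1)] BNC_block(1)[OF bnc V] by simp
    ultimately have "card \<rho> = Suc 0"
      using BNC_finite_blocks[OF \<rho>(1)] by (simp add: le_Suc_eq)
    then obtain X where "\<rho> = {X}" by (auto simp: card_Suc_eq)
    then show "\<rho> = {V}" using BNC_Union[OF \<rho>(1)] by simp
  qed
  then have "\<sigma> \<in> block_sets connecting \<pi>"
    using assms(2) fin BNC_Union[OF bnc] by (simp add: block_sets_def)
  then show ?thesis using that bnc by blast
qed

text \<open>The trace of \<open>\<pi>'\<close> on a block \<open>V\<close> of \<open>\<pi>\<close>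
  is a partition into whose hats the part of \<open>\<sigma>\<close> over \<open>V\<close> fits.
  That part is connecting, so the trace is one block and \<open>V\<close> lies in a block of
  \<open>\<pi>'\<close>.\<close>

lemma block_sets_connecting_finer:
  assumes "\<pi> \<in> BNC \<chi> P" "\<pi>' \<in> BNC \<chi> P"
    and "\<sigma> \<in> block_sets connecting \<pi>" "\<sigma> \<in> block_sets connecting \<pi>'"
  shows "finer \<pi> \<pi>'"
  unfolding finer_def
proof
  fix V assume V: "V \<in> \<pi>"
  let ?\<rho> = "(\<lambda>W. V \<inter> W) ` \<pi>' - {{}}"
  have \<tau>: "{T \<in> \<sigma>. T \<subseteq> hat V} \<in> connecting V" using assms(3) V by (simp add: block_sets_def)
  have \<sigma>: "\<sigma> \<in> BNC \<chi>' (hat P)" using assms(3) BNC_Union[OF assms(1)] by (simp add: block_sets_def)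
  have "?\<rho> = {V}"
  proof (rule connectingD[OF \<tau> BNC_restrict[OF assms(2) BNC_block(3)[OF assms(1) V]]])
    fix T assume T: "T \<in> {T \<in> \<sigma>. T \<subseteq> hat V}"
    then obtain W where W: "W \<in> \<pi>'" "T \<subseteq> hat W" using assms(4) unfolding block_sets_def by blast
    have "T \<subseteq> hat (V \<inter> W)" using T W by (auto simp: hat_def)
    moreover have "T \<noteq> {}" using T BNC_block(1)[OF \<sigma>] by blast
    ultimately have "V \<inter> W \<noteq> {}" by (auto simp: hat_def)
    with \<open>T \<subseteq> hat (V \<inter> W)\<close> W show "\<exists>W\<in>?\<rho>. T \<subseteq> hat W" by blast
  qed
  then have "V \<in> (\<lambda>W. V \<inter> W) ` \<pi>'" by (metis DiffD1 singletonI)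
  then obtain W where "W \<in> \<pi>'" "V = V \<inter> W" by (rule imageE)
  then show "\<exists>W\<in>\<pi>'. V \<subseteq> W" by (intro bexI[of _ W]) auto
qed

text \<open>Each \<open>\<sigma>\<close> belongs to exactly one \<open>\<pi>\<close>: existence is
  \<open>block_sets_connecting_cover\<close>, uniqueness follows from antisymmetry of
  refinement.\<close>

lemma sum_block_sets_connecting:
  assumes "P \<subseteq> g ` N"
  shows "(\<Sum>\<sigma>\<in>BNC \<chi>' (hat P). f \<sigma>) = (\<Sum>\<pi>\<in>BNC \<chi> P. \<Sum>\<sigma>\<in>block_sets connecting \<pi>. f \<sigma>)"
proof -
  have sub: "block_sets connecting \<pi> \<subseteq> BNC \<chi>' (hat P)" if "\<pi> \<in> BNC \<chi> P" for \<pi>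
    using BNC_Union[OF that] by (auto simp: block_sets_def)
  have "BNC \<chi>' (hat P) = (\<Union>\<pi>\<in>BNC \<chi> P. block_sets connecting \<pi>)"
    using sub block_sets_connecting_cover[OF assms] by blast
  moreover have "sum f (\<Union>\<pi>\<in>BNC \<chi> P. block_sets connecting \<pi>) =
      (\<Sum>\<pi>\<in>BNC \<chi> P. \<Sum>\<sigma>\<in>block_sets connecting \<pi>. f \<sigma>)"
  proof (rule sum.UNION_disjoint)
    show "\<forall>\<pi>\<in>BNC \<chi> P. finite (block_sets connecting \<pi>)"
      using finite_subset[OF sub finite_BNC] by blast
    show "\<forall>\<pi>\<in>BNC \<chi> P. \<forall>\<pi>'\<in>BNC \<chi> P. \<pi> \<noteq> \<pi>' \<longrightarrow>
        block_sets connecting \<pi> \<inter> block_sets connecting \<pi>' = {}"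
    proof (intro ballI impI equals0I)
      fix \<pi> \<pi>' \<sigma> assume \<pi>: "\<pi> \<in> BNC \<chi> P" "\<pi>' \<in> BNC \<chi> P" "\<pi> \<noteq> \<pi>'"
        and "\<sigma> \<in> block_sets connecting \<pi> \<inter> block_sets connecting \<pi>'"
      then show False
        using finer_antisym[OF \<pi>(1,2)] block_sets_connecting_finer[OF \<pi>(1,2)]
          block_sets_connecting_finer[OF \<pi>(2,1)] by blast
    qed
  qed simp
  ultimately show ?thesis by simp
qed

lemma cum_group_prod:
  assumes "\<And>x y. G (x + y) = G x + G y" "\<And>x y. H (x + y) = H x + H y" "is_inner \<chi>' (mom H)"
    and "P \<subseteq> g ` N" "P \<noteq> {}" "adm \<chi>' (hat P) Z"
  shows "cum \<chi> G H P (group_prod Z) = (\<Sum>\<sigma>\<in>connecting P. ev (cum \<chi>' G H) (cum \<chi>' H H) \<chi>' \<sigma> Z)"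
proof -
  have "finite P" using assms(4) finite_N finite_surj by blast
  then have "\<forall>G Z. (\<forall>x y. G (x + y) = G x + G y) \<longrightarrow> P \<subseteq> g ` N \<longrightarrow> P \<noteq> {} \<longrightarrow> adm \<chi>' (hat P) Z \<longrightarrow>
    cum \<chi> G H P (group_prod Z) = (\<Sum>\<sigma>\<in>connecting P. ev (cum \<chi>' G H) (cum \<chi>' H H) \<chi>' \<sigma> Z)"
  proof (induction P rule: finite_psubset_induct)
    case (psubset P)
    show ?case
    proof (intro allI impI)
      fix G :: "'a \<Rightarrow> 'd" and Z
      assume G: "\<forall>x y. G (x + y) = G x + G y" and P: "P \<subseteq> g ` N" "P \<noteq> {}" and Z: "adm \<chi>' (hat P) Z"
      let ?ev = "ev (cum \<chi>' G H) (cum \<chi>' H H) \<chi>'"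
      \<comment> \<open>Blocks of \<open>\<pi>\<close> are proper subsets of \<open>P\<close>, so
        the induction hypothesis provides the two substitution rules that \<open>ev_subst\<close>
        asks for, one for \<open>G\<close> and one for \<open>H\<close>.\<close>
      have ev: "ev (cum \<chi> G H) (cum \<chi> H H) \<chi> \<pi> (group_prod Z) = (\<Sum>\<sigma>\<in>block_sets connecting \<pi>. ?ev \<sigma> Z)"
        if \<pi>: "\<pi> \<in> BNC \<chi> P - {{P}}" for \<pi>
      proof (rule ev_subst)
        show "is_local (cum \<chi>' G H)" by (rule is_local_cum)
        show "is_additive (cum \<chi>' G H)" "is_additive (cum \<chi>' H H)"
          using is_additive_cum assms(2,3) G by blast+
        show "is_inner \<chi>' (cum \<chi>' H H)" using is_inner_cum assms(3) .
        show "\<pi> \<in> BNC \<chi> P" using \<pi> by blast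
        show "connecting V \<subseteq> BNC \<chi>' (hat V)" for V unfolding connecting_def by blast
        fix V assume V: "V \<in> \<pi>"
        then have sub: "V \<subset> P" using \<pi> BNC_psubset by blast
        have ne: "V \<noteq> {}" "finite V" using V \<pi> BNC_block by blast+
        have IH: "cum \<chi> G' H V (group_prod Z') = (\<Sum>\<sigma>\<in>connecting V. ev (cum \<chi>' G' H) (cum \<chi>' H H) \<chi>' \<sigma> Z')"
          if "\<forall>x y. G' (x + y) = G' x + G' y" "adm \<chi>' (hat V) Z'" for G' Z'
          using psubset.IH[OF sub] that sub P(1) ne by auto
        show "cum \<chi> G H V (group_prod Z') = (\<Sum>\<sigma>\<in>connecting V. ev (cum \<chi>' G H) (cum \<chi>' H H) \<chi>' \<sigma> Z')"
          "cum \<chi> H H V (group_prod Z') = (\<Sum>\<sigma>\<in>connecting V. ev (cum \<chi>' H H) (cum \<chi>' H H) \<chi>' \<sigma> Z')"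
          if "adm \<chi>' (hat V) Z'" for Z'
          using IH[OF _ that] G assms(2) by blast+
        show "\<exists>T\<in>\<tau>. \<exists>t\<in>T. \<exists>t'\<in>T. key \<chi> (g t) < r \<and> r < key \<chi> (g t')"
          if "\<tau> \<in> connecting V" "v \<in> V" "v' \<in> V" "key \<chi> v < r" "r < key \<chi> v'" "r \<notin> key \<chi> ` V" for \<tau> v v' r
          using connecting_span[OF that(1) ne(2) that(2-)] .
      qed (fact P Z)+
      have "G (oprod (group_prod Z) P) = (\<Sum>\<sigma>\<in>BNC \<chi>' (hat P). ?ev \<sigma> Z)"
        unfolding oprod_hat[OF psubset.hyps(1)]
        by (rule cum_moment[OF finite_hat hat_nonempty[OF P]])
      also have "\<dots> = (\<Sum>\<pi>\<in>BNC \<chi> P. \<Sum>\<sigma>\<in>block_sets connecting \<pi>. ?ev \<sigma> Z)"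
        by (rule sum_block_sets_connecting[OF P(1)])
      \<comment> \<open>The term for the one-block partition is the sum over
        \<open>connecting P\<close>. The others are exactly the terms subtracted in the definition
        of \<open>cum\<close>.\<close>
      also have "\<dots> = (\<Sum>\<sigma>\<in>connecting P. ?ev \<sigma> Z) +
          (\<Sum>\<pi>\<in>BNC \<chi> P - {{P}}. ev (cum \<chi> G H) (cum \<chi> H H) \<chi> \<pi> (group_prod Z))"
        by (subst sum.remove[OF finite_BNC BNC_single[OF psubset.hyps(1) P(2)]])
          (simp only: block_sets_single ev cong: sum.cong)
      finally show "cum \<chi> G H P (group_prod Z) = (\<Sum>\<sigma>\<in>connecting P. ?ev \<sigma> Z)"
        by (simp add: cum.simps[of \<chi> G H P])
    qed
  qed
  then show ?thesis using assms by blast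
qed

end

section \<open>Moments\<close>

locale bifree_space = bifree_ops L R B
  for L R :: "'d::ring_1 \<Rightarrow> 'a::ring_1" and B :: "'d set" +
  fixes E :: "'a \<Rightarrow> 'd"
  assumes E_add: "E (x + y) = E x + E y"
    and E_1: "E 1 = 1"
    and E_B: "E x \<in> B"
    and E_bimodule: "b \<in> B \<Longrightarrow> c \<in> B \<Longrightarrow> E (L b * R c * x) = b * E x * c"
    and E_left_right: "b \<in> B \<Longrightarrow> E (x * L b) = E (x * R b)"
begin

lemma E_L: "b \<in> B \<Longrightarrow> E (L b * x) = b * E x"
  using E_bimodule[of b 1 x] B_1 by (simp add: R_1)

lemma E_R: "b \<in> B \<Longrightarrow> E (R b * x) = E x * b"
  using E_bimodule[of 1 b x] B_1 by (simp add: L_1)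

lemma Lft_commute: "x \<in> face L R B Lft \<Longrightarrow> b \<in> B \<Longrightarrow> x * R b = R b * x"
  by (simp add: face_def)

lemma Rgt_commute: "x \<in> face L R B Rgt \<Longrightarrow> b \<in> B \<Longrightarrow> x * L b = L b * x"
  by (simp add: face_def)

text \<open>The operator \<open>T\<close> in \<open>moment\<close>, for a block with minimum
  \<open>m\<close>.\<close>

definition side_op :: "(nat \<Rightarrow> side) \<Rightarrow> nat \<Rightarrow> 'd \<Rightarrow> 'a"
  where "side_op \<chi> m b = (case \<chi> m of Lft \<Rightarrow> L b | Rgt \<Rightarrow> R b)"

lemma side_op_face: "b \<in> B \<Longrightarrow> side_op \<chi> m b \<in> face L R B (\<chi> m)"
  by (auto simp: side_op_def face_L face_R split: side.split)

lemma E_side_op: "b \<in> B \<Longrightarrow> E (side_op \<chi> m b) = b"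
  using E_L[of b 1] E_R[of b 1] by (auto simp: side_op_def E_1 split: side.split)

lemma oprod_face_side:
  assumes "adm \<chi> S Z" "\<And>i. i \<in> T \<Longrightarrow> i \<in> S \<and> \<chi> i = s"
  shows "oprod Z T \<in> face L R B s"
proof (rule oprod_face)
  fix q assume "q \<in> T"
  with assms show "Z q \<in> face L R B s" unfolding adm_def by metis
qed

section \<open>How moments absorb scalar operators\<close>

lemma oprod_insert_split:
  assumes "finite W" "m \<notin> W"
  shows "oprod Z (insert m W) = oprod Z {i \<in> W. i < m} * Z m * oprod Z {i \<in> W. m < i}"
    and "oprod Z W = oprod Z {i \<in> W. i < m} * oprod Z {i \<in> W. m < i}"
proof -
  have "{i \<in> insert m W. i < m} = {i \<in> W. i < m}" "{i \<in> insert m W. m < i} = {i \<in> W. m < i}"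
    by auto
  then show "oprod Z (insert m W) = oprod Z {i \<in> W. i < m} * Z m * oprod Z {i \<in> W. m < i}"
    using oprod_split[of "insert m W" m Z] assms(1) by simp
  have "W = {i \<in> W. i < m} \<union> {i \<in> W. m < i}" using assms(2) by (force simp: not_less order_le_less)
  then have "oprod Z W = oprod Z ({i \<in> W. i < m} \<union> {i \<in> W. m < i})" by simp
  also have "\<dots> = oprod Z {i \<in> W. i < m} * oprod Z {i \<in> W. m < i}"
    using assms(1) by (intro oprod_Un) auto
  finally show "oprod Z W = oprod Z {i \<in> W. i < m} * oprod Z {i \<in> W. m < i}" .
qed

lemma oprod_ins:
  assumes "finite V" "x \<in> V"
  shows "oprod (ins \<chi> x c Z) V = oprod Z {i \<in> V. i < x} * ins \<chi> x c Z x * oprod Z {i \<in> V. x < i}"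
proof -
  have "oprod (ins \<chi> x c Z) {i \<in> V. i < x} = oprod Z {i \<in> V. i < x}"
    "oprod (ins \<chi> x c Z) {i \<in> V. x < i} = oprod Z {i \<in> V. x < i}"
    by (auto intro: oprod_cong)
  then show ?thesis using oprod_split[OF assms, of "ins \<chi> x c Z"] by simp
qed

text \<open>If the chi-last index is a left one, all entries are left: \<open>L c\<close> at the end
  may be replaced by \<open>R c\<close>, which commutes to the front. If it is a right one, only
  left entries stand before it, and \<open>R c\<close> commutes with them.\<close>

lemma mom_rmod:
  assumes "finite V" "adm \<chi> V Z" "x \<in> V" "\<forall>v\<in>V. key \<chi> v \<le> key \<chi> x" "c \<in> B"
  shows "mom E V (ins \<chi> x c Z) = mom E V Z * c"
proof -
  let ?A = "oprod Z {i \<in> V. i < x}" and ?C = "oprod Z {i \<in> V. x < i}"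
  have less: "\<not> chi_less \<chi> x v" if "v \<in> V" for v
    using assms(4) that by (auto simp: chi_less_key not_less)
  have split: "oprod Z V = ?A * Z x * ?C" by (rule oprod_split[OF assms(1,3)])
  show ?thesis
  proof (cases "\<chi> x")
    case Lft
    have side: "\<chi> v = Lft" if "v \<in> V" for v
      using less[OF that] Lft by (auto simp: chi_less_def split: side.splits)
    have "{i \<in> V. x < i} = {}" using less side Lft by (auto simp: chi_less_def)
    then have C: "?C = 1" by (simp only: oprod_empty)
    have "oprod Z V \<in> face L R B Lft" using side by (intro oprod_face_side[OF assms(2)]) auto
    then have "E (oprod Z V * L c) = E (oprod Z V) * c"
      using assms(5) by (simp add: E_left_right Lft_commute E_R)
    moreover have "ins \<chi> x c Z x = Z x * L c" using Lft by (simp add: ins_def)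
    ultimately show ?thesis
      by (simp add: mom_def oprod_ins[OF assms(1,3)] split C mult.assoc)
  next
    case Rgt
    have "\<chi> v = Lft" if "v \<in> V" "v < x" for v
      using less[OF that(1)] that(2) Rgt by (auto simp: chi_less_def split: side.splits)
    then have "?A \<in> face L R B Lft" by (intro oprod_face_side[OF assms(2)]) auto
    then have "?A * (R c * Z x) * ?C = R c * (?A * Z x * ?C)"
      using assms(5) by (simp add: Lft_commute flip: mult.assoc)
    moreover have "ins \<chi> x c Z x = R c * Z x" using Rgt by (simp add: ins_def)
    ultimately show ?thesis
      using assms(5) by (simp add: mom_def oprod_ins[OF assms(1,3)] split E_R)
  qed
qed

lemma is_inner_mom: "is_inner \<chi> (mom E)"
  unfolding is_inner_def using is_local_mom mom_rmod E_B by (auto simp: mom_def)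

text \<open>A left operator at the chi-first index has only right entries before it and commutes to
  the front. If \<open>m\<close> is a right index, everything else is right with a smaller index;
  the operator stands at the end, and \<open>E_left_right\<close> makes it a left one.\<close>

lemma mom_insert_first:
  assumes "finite W" "m \<notin> W" "adm \<chi> W Z" "\<And>w. w \<in> W \<Longrightarrow> key \<chi> m < key \<chi> w"
    and "b \<in> B" "Z m = side_op \<chi> m b"
  shows "mom E (insert m W) Z = b * mom E W Z"
proof -
  let ?A = "oprod Z {i \<in> W. i < m}" and ?C = "oprod Z {i \<in> W. m < i}"
  note split = oprod_insert_split[OF assms(1,2), of Z]
  have less: "chi_less \<chi> m w" if "w \<in> W" for w
    using assms(4) that by (simp add: chi_less_key)
  have "\<chi> w = Rgt" if "w \<in> W" "w < m" for w
    using less[OF that(1)] that(2) by (auto simp: chi_less_def split: side.splits)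
  then have A: "?A \<in> face L R B Rgt" by (intro oprod_face_side[OF assms(3)]) auto
  show ?thesis
  proof (cases "\<chi> m")
    case Lft
    have "?A * L b * ?C = L b * (?A * ?C)"
      using A assms(5) by (simp add: Rgt_commute mult.assoc)
    then show ?thesis
      using Lft assms(5,6) by (simp add: mom_def split side_op_def E_L)
  next
    case Rgt
    have "{i \<in> W. m < i} = {}"
      using less Rgt by (fastforce simp: chi_less_def split: side.splits)
    then have C: "?C = 1" by (simp only: oprod_empty)
    have "E (?A * R b) = b * E ?A"
      using A assms(5) by (simp add: Rgt_commute E_L flip: E_left_right)
    then show ?thesis
      using Rgt assms(6) by (simp add: mom_def split side_op_def C)
  qed
qed

text \<open>No index of \<open>W\<close> lies between \<open>x\<close> and \<open>m\<close> in the
  chi-order. When both are on one side, the factors between them in the product are thus from the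
  other side and commute with the operator.\<close>

lemma mom_insert_after:
  assumes "finite W" "m \<notin> W" "adm \<chi> W Z" "x \<in> W" "key \<chi> x < key \<chi> m"
    and x: "\<And>w. w \<in> W \<Longrightarrow> key \<chi> w < key \<chi> m \<Longrightarrow> key \<chi> w \<le> key \<chi> x"
    and "b \<in> B" "Z m = side_op \<chi> m b"
  shows "mom E (insert m W) Z = mom E W (ins \<chi> x b Z)"
proof -
  let ?P = "{i \<in> W. i < m}" and ?Q = "{i \<in> W. m < i}"
  have xm: "x \<noteq> m" "chi_less \<chi> x m" using assms(2,4,5) by (auto simp: chi_less_key)
  have between: "\<not> (chi_less \<chi> x w \<and> chi_less \<chi> w m)" if "w \<in> W" for w
    using x[OF that] by (auto simp: chi_less_key)
  note split = oprod_insert_split[OF assms(1,2), of Z]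
  note ins = oprod_ins[OF assms(1,4), of \<chi> b Z]
  have fin: "finite ?P" "finite ?Q" using assms(1) by auto
  have dich: "i < m \<or> m < i" if "i \<in> W" for i
    using that assms(2) by (metis linorder_neqE_nat)
  consider "\<chi> m = Lft" "\<chi> x = Lft" | "\<chi> m = Rgt" "\<chi> x = Rgt" | "\<chi> m = Rgt" "\<chi> x = Lft"
    using xm(2) by (auto simp: chi_less_def split: side.splits)
  then show ?thesis
  proof cases
    case 1
    let ?C = "{i \<in> W. x < i \<and> i < m}"
    have lt: "x < m" using xm 1 by (simp add: chi_less_def)
    have "\<chi> w = Rgt" if "w \<in> W" "x < w" "w < m" for w
      using between[OF that(1)] that(2,3) 1 by (auto simp: chi_less_def split: side.splits)
    then have C: "oprod Z ?C \<in> face L R B Rgt" by (intro oprod_face_side[OF assms(3)]) auto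
    have sets: "{i \<in> ?P. i < x} = {i \<in> W. i < x}" "{i \<in> ?P. x < i} = ?C" "{i \<in> W. x < i} = ?C \<union> ?Q"
      using lt dich by (auto intro: less_trans)
    have P: "oprod Z ?P = oprod Z {i \<in> W. i < x} * Z x * oprod Z ?C"
      using oprod_split[OF fin(1), of x Z] lt assms(4) unfolding sets by simp
    have Q: "oprod Z {i \<in> W. x < i} = oprod Z ?C * oprod Z ?Q"
      unfolding sets using assms(1) by (intro oprod_Un) auto
    have "oprod Z ?C * L b = L b * oprod Z ?C" using Rgt_commute[OF C assms(7)] .
    then have "oprod Z {i \<in> W. i < x} * Z x * oprod Z ?C * L b * oprod Z ?Q =
        oprod Z {i \<in> W. i < x} * (Z x * L b) * (oprod Z ?C * oprod Z ?Q)"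
      by (simp add: mult.assoc flip: mult.assoc[of "oprod Z ?C" "L b"])
    then show ?thesis
      unfolding mom_def split(1) ins P Q using 1 assms(8) by (simp add: side_op_def ins_def)
  next
    case 2
    let ?C = "{i \<in> W. m < i \<and> i < x}"
    have lt: "m < x" using xm 2 by (simp add: chi_less_def)
    have "\<chi> w = Lft" if "w \<in> W" "m < w" "w < x" for w
      using between[OF that(1)] that(2,3) 2 by (auto simp: chi_less_def split: side.splits)
    then have C: "oprod Z ?C \<in> face L R B Lft" by (intro oprod_face_side[OF assms(3)]) auto
    have sets: "{i \<in> ?Q. x < i} = {i \<in> W. x < i}" "{i \<in> ?Q. i < x} = ?C" "{i \<in> W. i < x} = ?P \<union> ?C"
      using lt dich by (auto intro: less_trans)
    have Q: "oprod Z ?Q = oprod Z ?C * Z x * oprod Z {i \<in> W. x < i}"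
      using oprod_split[OF fin(2), of x Z] lt assms(4) unfolding sets by simp
    have P: "oprod Z {i \<in> W. i < x} = oprod Z ?P * oprod Z ?C"
      unfolding sets using assms(1) by (intro oprod_Un) auto
    have "oprod Z ?C * R b = R b * oprod Z ?C" using Lft_commute[OF C assms(7)] .
    then have "oprod Z ?P * R b * (oprod Z ?C * Z x * oprod Z {i \<in> W. x < i}) =
        oprod Z ?P * oprod Z ?C * (R b * Z x) * oprod Z {i \<in> W. x < i}"
      by (simp add: mult.assoc flip: mult.assoc[of "oprod Z ?C" "R b"])
    then show ?thesis
      unfolding mom_def split(1) ins P Q using 2 assms(8) by (simp add: side_op_def ins_def)
  next
    \<comment> \<open>Here \<open>x\<close> is the last left index of \<open>W\<close>, and all
      right indices of \<open>W\<close> are smaller than \<open>m\<close>. So \<open>R b\<close>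
      from position \<open>m\<close> and \<open>L b\<close> from position \<open>x\<close> both move
      to the right end, where \<open>E\<close> does not distinguish them.\<close>
    case 3
    have "\<chi> w = Lft" if "w \<in> W" "m < w" for w
      using between[OF that(1)] that(2) 3 by (auto simp: chi_less_def split: side.splits)
    then have Q: "oprod Z ?Q \<in> face L R B Lft" by (intro oprod_face_side[OF assms(3)]) auto
    have "\<chi> w = Rgt" if "w \<in> W" "x < w" for w
      using between[OF that(1)] that(2) 3 by (auto simp: chi_less_def split: side.splits)
    then have C: "oprod Z {i \<in> W. x < i} \<in> face L R B Rgt" by (intro oprod_face_side[OF assms(3)]) auto
    have "oprod Z ?P * R b * oprod Z ?Q = oprod Z W * R b"
      unfolding split(2) using Lft_commute[OF Q assms(7)] by (simp add: mult.assoc)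
    moreover have "oprod Z {i \<in> W. i < x} * (Z x * L b) * oprod Z {i \<in> W. x < i} = oprod Z W * L b"
      unfolding oprod_split[OF assms(1,4), of Z] using Rgt_commute[OF C assms(7)] by (simp add: mult.assoc)
    ultimately show ?thesis
      unfolding mom_def split(1) ins using 3 assms(7,8) by (simp add: side_op_def ins_def E_left_right)
  qed
qed

section \<open>Nested evaluation of moments and scalar entries\<close>

abbreviation evM :: "(nat \<Rightarrow> side) \<Rightarrow> nat set set \<Rightarrow> (nat \<Rightarrow> 'a) \<Rightarrow> 'd"
  where "evM \<equiv> ev (mom E) (mom E)"

lemmas evM_remove = ev_remove[OF is_local_mom is_inner_mom _ _ _ _ _ disjI1[OF refl]]
lemmas evM_append = ev_append[OF _ _ _ is_local_mom is_local_mom]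

lemma chi_interval_single: "m \<in> S \<Longrightarrow> chi_interval \<chi> S {m}"
  by (rule chi_intervalI) auto

lemma BNC_insert_single:
  assumes "\<sigma> \<in> BNC \<chi> S" "m \<notin> S"
  shows "insert {m} \<sigma> \<in> BNC \<chi> (insert m S)"
proof -
  have "\<sigma> \<union> {{m}} \<in> BNC \<chi> (S \<union> {m})"
    using assms(2) by (intro BNC_glue[OF assms(1) BNC_single]) auto
  then show ?thesis by simp
qed

text \<open>If \<open>W\<close> has an index before \<open>m\<close>, the scalar is inserted after
  the last such index; otherwise it is a left factor. The merged block behaves in the same way by
  \<open>mom_insert_after\<close> and \<open>mom_insert_first\<close>.\<close>

lemma evM_pair:
  assumes "finite W" "W \<noteq> {}" "m \<notin> W" "adm \<chi> (insert m W) Z" "b \<in> B" "Z m = side_op \<chi> m b"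
  shows "evM \<chi> {W, {m}} Z = mom E (insert m W) Z"
proof -
  have adm: "adm \<chi> W Z" using assms(4) by (rule adm_mono) blast
  have m: "mom E {m} Z = b" using assms(5,6) by (simp add: mom_def E_side_op)
  have ne: "W \<noteq> {m}" using assms(3) by blast
  show ?thesis
  proof (cases "\<exists>w\<in>W. key \<chi> w < key \<chi> m")
    case True
    then obtain w where "w \<in> W" "before \<chi> {w} {m}" by (auto simp: before_def)
    then obtain x where x: "is_pred \<chi> (insert m W) {m} x"
      using is_pred_exists[of "insert m W" w] assms(1) by blast
    have "insert {m} {W} \<in> BNC \<chi> (insert m W)"
      using BNC_insert_single[OF BNC_single] assms(1-3) by blast
    then have "evM \<chi> {W, {m}} Z = evM \<chi> ({W, {m}} - {{m}}) (ins \<chi> x (mom E {m} Z) Z)"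
      by (intro evM_remove[OF _ _ chi_interval_single x assms(4)]) (simp_all add: insert_commute)
    also have "{W, {m}} - {{m}} = {W}" using ne by blast
    also have "evM \<chi> {W} (ins \<chi> x (mom E {m} Z) Z) = mom E W (ins \<chi> x b Z)"
      by (simp add: ev_single assms(1,2) m)
    also have "\<dots> = mom E (insert m W) Z"
    proof (rule mom_insert_after[OF assms(1,3) adm _ _ _ assms(5,6), symmetric])
      show "x \<in> W" using x is_pred_notin[OF x] by (auto simp: is_pred_def)
    qed (use x in \<open>auto simp: is_pred_def before_def\<close>)
    finally show ?thesis .
  next
    case False
    have first: "key \<chi> m < key \<chi> w" if "w \<in> W" for w
    proof -
      have "w \<noteq> m" using that assms(3) by blast
      then show ?thesis using False that key_eq_iff[of \<chi> w m] by (metis linorder_neqE)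
    qed
    have "evM \<chi> ({{m}} \<union> {W}) Z = evM \<chi> {{m}} Z * evM \<chi> {W} Z"
      by (rule evM_append[THEN conjunct2, OF BNC_single BNC_single])
        (use assms(1,2) first in \<open>auto simp: before_def\<close>)
    also have "\<dots> = b * mom E W Z"
      by (simp add: ev_single assms(1,2) m)
    also have "\<dots> = mom E (insert m W) Z"
      by (rule mom_insert_first[OF assms(1,3) adm first assms(5,6), symmetric])
    also have "{{m}} \<union> {W} = {W, {m}}" by blast
    finally show ?thesis .
  qed
qed

text \<open>Other blocks are removed while they are last. Once \<open>W\<close> itself is last, the
  pair replacing it is grafted as a whole, and \<open>evM_pair\<close> shows that it has the value
  of \<open>W\<close>.\<close>

lemma evM_split_scalar:
  assumes "\<sigma> \<in> BNC \<chi> S" "W \<in> \<sigma>" "m \<in> W" "W \<noteq> {m}" "adm \<chi> S Z" "b \<in> B" "Z m = side_op \<chi> m b"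
  shows "evM \<chi> ((\<sigma> - {W}) \<union> {W - {m}, {m}}) Z = evM \<chi> \<sigma> Z"
  using assms
proof (induction arbitrary: Z b rule: BNC_last_induct)
  case (step \<sigma> S U)
  note bnc = step.hyps(1) and lst = step.hyps(2)
  note W = BNC_block[OF bnc step.prems(1)]
  let ?\<tau> = "{W - {m}, {m}}"
  have "insert {m} {W - {m}} \<in> BNC \<chi> (insert m (W - {m}))"
    using step.prems(2,3) W by (intro BNC_insert_single BNC_single) auto
  then have \<tau>: "?\<tau> \<in> BNC \<chi> W"
    using step.prems(2) by (simp add: insert_commute insert_absorb)
  have bnc1: "(\<sigma> - {W}) \<union> ?\<tau> \<in> BNC \<chi> S" by (rule BNC_refine[OF bnc step.prems(1) \<tau>])
  have pair: "evM \<chi> ?\<tau> Z = mom E W Z"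
  proof -
    have "insert m (W - {m}) = W" using step.prems(2) by blast
    then show ?thesis
      using evM_pair[of "W - {m}" m \<chi> Z b] step.prems W adm_mono[OF step.prems(4) W(3)] by auto
  qed
  note U = BNC_block[OF bnc is_last_in[OF lst]]
  have int: "chi_interval \<chi> S U" using is_last_interval[OF bnc lst] .
  show ?case
  proof (cases "S - U = {}")
    case True
    then have "U = S" using U(3) by blast
    then have eq: "U = W" "\<sigma> = {W}"
      using BNC_psubset[OF bnc _ is_last_in[OF lst]] step.prems(1) by auto
    then show ?thesis using pair W by (simp add: ev_single)
  next
    case False
    from last_pred[OF bnc lst False] obtain p where p: "is_pred \<chi> S U p" .
    define c where "c = mom E U Z"
    have cB: "c \<in> B" by (simp add: c_def mom_def E_B)
    have rem: "evM \<chi> \<sigma> Z = evM \<chi> (\<sigma> - {U}) (ins \<chi> p c Z)"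
      unfolding c_def by (rule evM_remove[OF bnc is_last_in[OF lst] int p step.prems(4)])
    show ?thesis
    proof (cases "U = W")
      case True
      have SW: "S - W \<union> W = S" "S \<union> W = S" using W(3) by auto
      have "evM \<chi> ((\<sigma> - {W}) \<union> ?\<tau>) Z = evM \<chi> (\<sigma> - {W}) (ins \<chi> p (evM \<chi> ?\<tau> Z) Z)"
        by (rule ev_graft[OF is_local_mom is_inner_mom BNC_remove[OF bnc step.prems(1)] \<tau>])
          (use bnc1 W int p step.prems(4) True in \<open>auto simp: SW\<close>)
      then show ?thesis using rem True pair by (simp add: c_def)
    next
      case neq: False
      have disj: "W \<inter> U = {}"
        using BNC_disjoint[OF bnc step.prems(1) is_last_in[OF lst]] neq by blast
      have U\<tau>: "U \<notin> ?\<tau>" using disj U(1) step.prems(2) by auto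
      have "evM \<chi> ((\<sigma> - {W}) \<union> ?\<tau>) Z = evM \<chi> ((\<sigma> - {W}) \<union> ?\<tau> - {U}) (ins \<chi> p c Z)"
        unfolding c_def
        by (rule evM_remove[OF bnc1 _ int p step.prems(4)]) (use is_last_in[OF lst] neq in blast)
      also have "(\<sigma> - {W}) \<union> ?\<tau> - {U} = (\<sigma> - {U} - {W}) \<union> ?\<tau>"
        using U\<tau> by blast
      also have "evM \<chi> \<dots> (ins \<chi> p c Z) = evM \<chi> (\<sigma> - {U}) (ins \<chi> p c Z)"
      proof (rule step.IH)
        show "adm \<chi> (S - U) (ins \<chi> p c Z)"
          by (intro adm_ins adm_mono[OF step.prems(4)] cB) blast
        \<comment> \<open>If the removed block is inserted at \<open>m\<close> itself, the entry
          there is still a scalar operator, with \<open>b * c\<close> in place of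
          \<open>b\<close>.\<close>
        show "(if p = m then b * c else b) \<in> B" using step.prems(5) cB B_mult by simp
        show "ins \<chi> p c Z m = side_op \<chi> m (if p = m then b * c else b)"
          using step.prems(5,6) cB by (auto simp: ins_def side_op_def L_mult R_mult split: side.split)
      qed (use step.prems neq in auto)
      finally show ?thesis using rem by simp
    qed
  qed
qed simp

text \<open>Since \<open>V\<close> is an interval, the same index outside \<open>V\<close> precedes
  \<open>V\<close> and \<open>m\<close>, so both partitions insert the same value there. If there is
  none, the value is a left factor in both.\<close>

lemma evM_collapse:
  assumes "\<pi> \<in> BNC \<chi> S" "V \<in> \<pi>" "chi_interval \<chi> S V" "m \<in> V" "adm \<chi> S Z"
  shows "evM \<chi> \<pi> Z = evM \<chi> (insert {m} (\<pi> - {V})) (Z(m := side_op \<chi> m (mom E V Z)))"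
proof -
  note V = BNC_block[OF assms(1,2)]
  note bncV = BNC_remove[OF assms(1,2)]
  define b where "b = mom E V Z"
  define Z' where "Z' = Z(m := side_op \<chi> m b)"
  have bB: "b \<in> B" by (simp add: b_def mom_def E_B)
  have mS: "m \<notin> S - V" "m \<in> S" using assms(4) V(3) by auto
  have b': "mom E {m} Z' = b" using bB by (simp add: Z'_def mom_def E_side_op)
  have bnc': "insert {m} (\<pi> - {V}) \<in> BNC \<chi> (insert m (S - V))"
    by (rule BNC_insert_single[OF bncV mS(1)])
  have adm': "adm \<chi> (insert m (S - V)) Z'"
    using assms(5) mS side_op_face[OF bB] by (auto simp: adm_def Z'_def)
  have mV: "{m} \<notin> \<pi> - {V}" using BNC_block(3)[OF bncV] mS(1) by blast
  have V': "(\<pi> - {V}) \<union> {V} = \<pi>" using assms(2) by blast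
  show ?thesis
  proof (cases "\<exists>s\<in>S. before \<chi> {s} V")
    case True
    then obtain p where p: "is_pred \<chi> S V p"
      using is_pred_exists[OF BNC_finite[OF assms(1)]] by blast
    have pV: "p \<in> S - V" using p is_pred_notin[OF p] by (auto simp: is_pred_def)
    have p': "is_pred \<chi> (insert m (S - V)) {m} p"
      unfolding is_pred_def
    proof (intro conjI ballI impI)
      show "before \<chi> {p} {m}" using p assms(4) by (auto simp: is_pred_def before_def)
      fix s assume s: "s \<in> insert m (S - V)" "before \<chi> {s} {m}"
      then have "s \<in> S - V" by (auto simp: before_def)
      then have "before \<chi> {s} V"
        using before_interval[OF assms(3) _ assms(4), of s] s(2) by (auto simp: before_def)
      then show "key \<chi> s \<le> key \<chi> p"
        using p \<open>s \<in> S - V\<close> unfolding is_pred_def by blast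
    qed (use pV in blast)
    have "evM \<chi> (insert {m} (\<pi> - {V})) Z' = evM \<chi> (insert {m} (\<pi> - {V}) - {{m}}) (ins \<chi> p b Z')"
      using evM_remove[OF bnc' _ chi_interval_single p' adm'] b' by simp
    also have "insert {m} (\<pi> - {V}) - {{m}} = \<pi> - {V}" using mV by blast
    also have "evM \<chi> (\<pi> - {V}) (ins \<chi> p b Z') = evM \<chi> (\<pi> - {V}) (ins \<chi> p b Z)"
      by (rule ev_cong[OF bncV is_local_mom is_local_mom])
        (use mS pV in \<open>auto simp: ins_def Z'_def split: side.split\<close>)
    also have "\<dots> = evM \<chi> \<pi> Z"
      unfolding b_def by (rule evM_remove[OF assms(1-3) p assms(5), symmetric])
    finally show ?thesis by (simp only: Z'_def b_def)
  next
    case False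
    have after: "before \<chi> V (S - V)"
      unfolding before_def using interval_cases[OF assms(3)] False beforeD by blast
    have "evM \<chi> ({V} \<union> (\<pi> - {V})) Z = b * evM \<chi> (\<pi> - {V}) Z"
      using evM_append[THEN conjunct2, OF BNC_single bncV after] V by (simp add: ev_single b_def)
    moreover have "evM \<chi> ({{m}} \<union> (\<pi> - {V})) Z' = b * evM \<chi> (\<pi> - {V}) Z'"
      using evM_append[THEN conjunct2, OF BNC_single bncV before_mono[OF after], of "{m}"] assms(4)
      by (simp add: ev_single b')
    moreover have "evM \<chi> (\<pi> - {V}) Z' = evM \<chi> (\<pi> - {V}) Z"
      by (rule ev_cong[OF bncV is_local_mom is_local_mom]) (use mS in \<open>auto simp: Z'_def\<close>)
    ultimately show ?thesis
      using V' by (simp add: Un_commute flip: b_def Z'_def)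
  qed
qed

end

section \<open>The block with the largest minimum in the usual order\<close>

definition is_top :: "nat set set \<Rightarrow> nat set \<Rightarrow> bool"
  where "is_top \<pi> V \<longleftrightarrow> V \<in> \<pi> \<and> (\<forall>W\<in>\<pi>. W \<noteq> V \<longrightarrow> Min W < Min V)"

lemma is_top_arg_max:
  assumes "is_top \<pi> V"
  shows "arg_max_on Min \<pi> = V"
  unfolding arg_max_on_def arg_max_def
proof (rule some_equality)
  show "is_arg_max Min (\<lambda>W. W \<in> \<pi>) V"
    using assms by (auto simp: is_top_def is_arg_max_def)
  show "W = V" if "is_arg_max Min (\<lambda>W. W \<in> \<pi>) W" for W
    using assms that by (auto simp: is_top_def is_arg_max_def)
qed

lemma is_top_exists:
  assumes "\<pi> \<in> BNC \<chi> S" "\<rho> \<subseteq> \<pi>" "\<rho> \<noteq> {}"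
  obtains V where "is_top \<rho> V"
proof -
  have fin: "finite \<rho>" using BNC_finite_blocks[OF assms(1)] assms(2) finite_subset by blast
  obtain V where V: "V \<in> \<rho>" "Max (Min ` \<rho>) = Min V"
    using obtains_MAX[OF fin assms(3)] by blast
  have "Min W < Min V" if W: "W \<in> \<rho>" "W \<noteq> V" for W
  proof -
    have "Min W \<le> Min V" unfolding V(2)[symmetric] using fin W by simp
    moreover have "Min W \<in> W" "Min V \<in> V"
      using BNC_block(1,2)[OF assms(1) subsetD[OF assms(2)]] W(1) V(1) by (blast intro: Min_in)+
    then have "Min W \<noteq> Min V"
      using BNC_disjoint[OF assms(1) subsetD[OF assms(2) W(1)] subsetD[OF assms(2) V(1)], of "Min W"] W(2)
      by auto
    ultimately show ?thesis by simp
  qed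
  then show ?thesis using that V by (auto simp: is_top_def)
qed

lemma is_top_in: "is_top \<pi> V \<Longrightarrow> V \<in> \<pi>"
  by (simp add: is_top_def)

text \<open>Indices below \<open>Min V\<close> lie outside the \<open>\<prec>\<^sub>\<chi>\<close>-convex hull of \<open>V\<close>, so a block with smaller minimum
  that meets this hull would cross \<open>V\<close>.\<close>

lemma is_top_interval:
  assumes "\<pi> \<in> BNC \<chi> S" "V \<in> \<pi>"
    and W: "\<And>W. W \<in> \<pi> \<Longrightarrow> W \<noteq> V \<Longrightarrow> Min W < Min V \<or> (\<exists>w\<in>W. \<forall>v\<in>V. key \<chi> w < key \<chi> v)"
  shows "chi_interval \<chi> S V"
proof (rule chi_intervalI)
  show "V \<subseteq> S" using BNC_block(3)[OF assms(1,2)] .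
  note V = BNC_block[OF assms(1,2)]
  fix a b c assume *: "a \<in> V" "c \<in> V" "b \<in> S" "key \<chi> a < key \<chi> b" "key \<chi> b < key \<chi> c"
  obtain W where W': "W \<in> \<pi>" "b \<in> W" using BNC_obtain_block[OF assms(1) *(3)] .
  show "b \<in> V"
  proof (rule ccontr)
    assume "b \<notin> V"
    then have neq: "W \<noteq> V" using W' by blast
    have outside: "(\<forall>v\<in>V. key \<chi> w < key \<chi> v) \<or> (\<forall>v\<in>V. key \<chi> v < key \<chi> w)" if "w < Min V" for w
    proof -
      have "w < v" if "v \<in> V" for v using \<open>w < Min V\<close> Min_le[OF V(2) that] by linarith
      then show ?thesis
        unfolding chi_less_key[symmetric] chi_less_def by (cases "\<chi> w") (auto split: side.splits)
    qed
    have "Min W \<in> W" using BNC_block[OF assms(1) W'(1)] by simp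
    then obtain w where w: "w \<in> W" "(\<forall>v\<in>V. key \<chi> w < key \<chi> v) \<or> (\<forall>v\<in>V. key \<chi> v < key \<chi> w)"
      using W[OF W'(1) neq] outside by blast
    then show False
      using BNC_cross[OF assms(1) W'(1) assms(2) w(1) *(1) W'(2) *(2)]
        BNC_cross[OF assms(1,2) W'(1) *(1) W'(2) *(2) w(1)] * neq by blast
  qed
qed

section \<open>The recursion of the moments\<close>

context bifree_space
begin

abbreviation mo :: "(nat \<Rightarrow> side) \<Rightarrow> nat set set \<Rightarrow> (nat \<Rightarrow> 'a) \<Rightarrow> 'd"
  where "mo \<equiv> moment L R E"

lemma moment_single: "card \<pi> \<le> 1 \<Longrightarrow> mo \<chi> \<pi> Z = E (oprod Z (\<Union>\<pi>))"
  by (simp add: moment.simps)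

lemma BNC_card_le_1:
  assumes "\<pi> \<in> BNC \<chi> S" "V \<in> \<pi>"
  shows "card \<pi> \<le> 1 \<longleftrightarrow> S - V = {}"
proof
  assume "card \<pi> \<le> 1"
  then have "\<pi> = {V}"
    using assms(2) card_le_Suc0_iff_eq[OF BNC_finite_blocks[OF assms(1)]] by auto
  then show "S - V = {}" using BNC_Union[OF assms(1)] by simp
next
  assume "S - V = {}"
  then have "\<pi> - {V} = {}" using BNC_empty_iff[OF BNC_remove[OF assms]] by simp
  then have "\<pi> = {V}" using assms(2) by blast
  then show "card \<pi> \<le> 1" by simp
qed

text \<open>The two cases of the recursion of the moments, with the data it chooses: in \<open>mo_mid\<close>, \<open>W\<close> is the
  block whose spine is adjacent to \<open>Min V\<close>.\<close>

definition mo_end :: "nat set \<Rightarrow> nat set \<Rightarrow> nat \<Rightarrow> bool"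
  where "mo_end S V q \<longleftrightarrow> V = {i \<in> S. Min V \<le> i} \<and> q \<in> S \<and> q < Min V \<and> (\<forall>i\<in>S. i < Min V \<longrightarrow> i \<le> q)"

definition mo_mid :: "(nat \<Rightarrow> side) \<Rightarrow> nat set set \<Rightarrow> nat set \<Rightarrow> nat set \<Rightarrow> nat \<Rightarrow> nat set \<Rightarrow> nat \<Rightarrow> bool"
  where "mo_mid \<chi> \<pi> S V w W k \<longleftrightarrow> w \<in> S - V \<and> Min V < w \<and>
    (\<forall>i\<in>S - V. Min V < i \<longrightarrow> (case \<chi> (Min V) of Lft \<Rightarrow> key \<chi> w \<le> key \<chi> i | Rgt \<Rightarrow> key \<chi> i \<le> key \<chi> w)) \<and>
    W \<in> \<pi> \<and> w \<in> W \<and> k \<in> W \<and> Min V < k \<and> (\<forall>j\<in>W. Min V < j \<longrightarrow> k \<le> j)"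

lemma mo_cases:
  assumes "\<pi> \<in> BNC \<chi> S" "is_top \<pi> V" "S - V \<noteq> {}"
  obtains q where "mo_end S V q" | w W k where "mo_mid \<chi> \<pi> S V w W k"
proof -
  note V = BNC_block[OF assms(1) is_top_in[OF assms(2)]]
  have m: "Min V \<in> V" using V by simp
  have fin: "finite S" using BNC_finite[OF assms(1)] .
  show ?thesis
  proof (cases "V = {i \<in> S. Min V \<le> i}")
    case True
    let ?I = "{i \<in> S. i < Min V}"
    have I: "finite ?I" "?I \<noteq> {}"
      using fin assms(3) True by (auto simp: not_le) (metis (mono_tags, lifting) mem_Collect_eq not_le)
    have "mo_end S V (Max ?I)"
      unfolding mo_end_def using True Max_in[OF I] Max_ge[OF I(1)] by auto
    then show ?thesis by (rule that(1))
  next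
    case False
    let ?X = "{i \<in> S - V. Min V < i}"
    have "finite ?X" using fin by simp
    moreover have "?X \<noteq> {}"
    proof -
      obtain i where "i \<in> S" "Min V \<le> i" "i \<notin> V"
        using False V(3) Min_le[OF V(2)] by blast
      moreover have "i \<noteq> Min V" using m \<open>i \<notin> V\<close> by auto
      ultimately show ?thesis by auto
    qed
    ultimately have X: "finite ?X" "?X \<noteq> {}" .
    define w where "w = (case \<chi> (Min V) of Lft \<Rightarrow> chi_Min \<chi> ?X | Rgt \<Rightarrow> chi_Max \<chi> ?X)"
    have w: "w \<in> ?X" "\<And>i. i \<in> ?X \<Longrightarrow> (case \<chi> (Min V) of Lft \<Rightarrow> key \<chi> w \<le> key \<chi> i | Rgt \<Rightarrow> key \<chi> i \<le> key \<chi> w)"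
      using chi_Min_key[OF X, where \<chi> = \<chi>] chi_Max_key[OF X, where \<chi> = \<chi>]
      by (auto simp: w_def split: side.split)
    obtain W where W: "W \<in> \<pi>" "w \<in> W" using BNC_obtain_block[OF assms(1), of w] w(1) by blast
    let ?K = "{j \<in> W. Min V < j}"
    have K: "finite ?K" "?K \<noteq> {}" using BNC_block(2)[OF assms(1) W(1)] W(2) w(1) by auto
    have "mo_mid \<chi> \<pi> S V w W (Min ?K)"
      unfolding mo_mid_def using w W Min_in[OF K] Min_le[OF K(1)] by auto
    then show ?thesis by (rule that(2))
  qed
qed

lemma moment_end:
  assumes "\<pi> \<in> BNC \<chi> S" "is_top \<pi> V" "mo_end S V q"
  shows "mo \<chi> \<pi> Z = mo \<chi> (\<pi> - {V}) (Z(q := Z q * side_op \<chi> (Min V) (E (oprod Z V))))"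
proof -
  note V = BNC_block[OF assms(1) is_top_in[OF assms(2)]]
  have q: "V = {i \<in> S. Min V \<le> i}" "q \<in> S" "q < Min V" "\<And>i. i \<in> S \<Longrightarrow> i < Min V \<Longrightarrow> i \<le> q"
    using assms(3) by (auto simp: mo_end_def)
  have "q \<notin> V" using Min_le[OF V(2), of q] q(3) by force
  then have card: "\<not> card \<pi> \<le> 1"
    using BNC_card_le_1[OF assms(1) is_top_in[OF assms(2)]] q(2) by blast
  have "Max {i \<in> S. i < Min V} = q"
    by (rule Max_eqI) (use q BNC_finite[OF assms(1)] in auto)
  then show ?thesis
    using card q(1)
    by (subst moment.simps) (simp add: is_top_arg_max[OF assms(2)] BNC_Union[OF assms(1)] side_op_def Let_def)
qed

lemma moment_mid:
  assumes "\<pi> \<in> BNC \<chi> S" "is_top \<pi> V" "mo_mid \<chi> \<pi> S V w W k"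
  shows "mo \<chi> \<pi> Z = mo \<chi> (\<pi> - {V}) (Z(k := side_op \<chi> (Min V) (E (oprod Z V)) * Z k))"
proof -
  let ?X = "{i \<in> S. Min V < i} - V"
  have w: "w \<in> S - V" "Min V < w" "W \<in> \<pi>" "w \<in> W" "k \<in> W" "Min V < k"
    "\<And>j. j \<in> W \<Longrightarrow> Min V < j \<Longrightarrow> k \<le> j"
    and ext: "\<And>i. i \<in> S - V \<Longrightarrow> Min V < i \<Longrightarrow>
      (case \<chi> (Min V) of Lft \<Rightarrow> key \<chi> w \<le> key \<chi> i | Rgt \<Rightarrow> key \<chi> i \<le> key \<chi> w)"
    using assms(3) by (auto simp: mo_mid_def)
  have card: "\<not> card \<pi> \<le> 1"
    using BNC_card_le_1[OF assms(1) is_top_in[OF assms(2)]] w(1) by blast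
  have neq: "V \<noteq> {i \<in> S. Min V \<le> i}" using w(1,2) by (metis (mono_tags, lifting) DiffE less_imp_le mem_Collect_eq)
  have "(case \<chi> (Min V) of Lft \<Rightarrow> chi_Min \<chi> ?X | Rgt \<Rightarrow> chi_Max \<chi> ?X) = w"
  proof (cases "\<chi> (Min V)")
    case Lft
    have "chi_Min \<chi> ?X = w" by (rule chi_Min_eq) (use w ext Lft in auto)
    with Lft show ?thesis by simp
  next
    case Rgt
    have "chi_Max \<chi> ?X = w" by (rule chi_Max_eq) (use w ext Rgt in auto)
    with Rgt show ?thesis by simp
  qed
  moreover have "block_of \<pi> w = W" using block_of_eq[OF BNC_partition[OF assms(1)] w(3,4)] .
  moreover have "Min {j \<in> W. Min V < j} = k"
    by (rule Min_eqI) (use w BNC_block(2)[OF assms(1) w(3)] in auto)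
  ultimately show ?thesis
    using card neq
    by (subst moment.simps) (simp add: is_top_arg_max[OF assms(2)] BNC_Union[OF assms(1)] side_op_def Let_def)
qed

lemma moment_cong:
  assumes "\<pi> \<in> BNC \<chi> S" "\<And>x. x \<in> S \<Longrightarrow> Z x = Z' x"
  shows "mo \<chi> \<pi> Z = mo \<chi> \<pi> Z'"
  using assms
proof (induction "card \<pi>" arbitrary: \<pi> S Z Z')
  case 0
  then show ?case using oprod_cong[of S Z Z'] BNC_Union[OF "0.prems"(1)] by (simp add: moment_single)
next
  case (Suc n)
  then have "\<pi> \<noteq> {}" by auto
  then obtain V where V: "is_top \<pi> V" using is_top_exists[OF Suc.prems(1) subset_refl] by blast
  note V\<pi> = is_top_in[OF V]
  have n: "n = card (\<pi> - {V})" using Suc.hyps(2) BNC_finite_blocks[OF Suc.prems(1)] V\<pi> by simp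
  note IH = Suc.hyps(1)[OF n BNC_remove[OF Suc.prems(1) V\<pi>]]
  have b: "oprod Z V = oprod Z' V"
    by (rule oprod_cong) (use Suc.prems(2) BNC_block(3)[OF Suc.prems(1) V\<pi>] in auto)
  show ?case
  proof (cases "S - V = {}")
    case True
    then have "card \<pi> \<le> 1" using BNC_card_le_1[OF Suc.prems(1) V\<pi>] by simp
    then show ?thesis
      using oprod_cong[of S Z Z'] Suc.prems(2) BNC_Union[OF Suc.prems(1)] by (simp add: moment_single)
  next
    case False
    from mo_cases[OF Suc.prems(1) V False] show ?thesis
    proof cases
      case (1 q)
      have "q \<in> S" using 1 by (simp add: mo_end_def)
      then show ?thesis
        unfolding moment_end[OF Suc.prems(1) V 1] b using Suc.prems(2) by (intro IH) auto
    next
      case (2 w W k)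
      have "k \<in> S" using 2 BNC_block(3)[OF Suc.prems(1)] by (auto simp: mo_mid_def)
      then show ?thesis
        unfolding moment_mid[OF Suc.prems(1) V 2] b using Suc.prems(2) by (intro IH) auto
    qed
  qed
qed

definition adjacent :: "(nat \<Rightarrow> side) \<Rightarrow> nat set \<Rightarrow> nat \<Rightarrow> nat \<Rightarrow> bool"
  where "adjacent \<chi> S m w \<longleftrightarrow> (\<forall>s\<in>S. \<not> (key \<chi> m < key \<chi> s \<and> key \<chi> s < key \<chi> w) \<and>
    \<not> (key \<chi> w < key \<chi> s \<and> key \<chi> s < key \<chi> m))"

text \<open>No index of \<open>S\<close> lies strictly between \<open>m\<close> and
  \<open>w0\<close>, so replacing \<open>m\<close> by \<open>w0\<close> does not change comparisons
  with other blocks; a crossing with \<open>insert m W\<close> would be one with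
  \<open>W\<close>.\<close>

lemma BNC_insert_adjacent:
  assumes "\<sigma> \<in> BNC \<chi> S" "W \<in> \<sigma>" "m \<notin> S" "w0 \<in> W" "adjacent \<chi> S m w0"
  shows "insert (insert m W) (\<sigma> - {W}) \<in> BNC \<chi> (insert m S)"
proof -
  note W = BNC_block[OF assms(1,2)]
  have "(\<sigma> - {W}) \<union> {insert m W} \<in> BNC \<chi> ((S - W) \<union> insert m W)"
  proof (rule BNC_glue[OF BNC_remove[OF assms(1,2)] BNC_single])
    fix T a b c d assume *: "T \<in> \<sigma> - {W}" "a \<in> T" "c \<in> T" "b \<in> insert m W" "d \<in> insert m W"
    define r where "r x = (if x = m then w0 else x)" for x
    have r: "r b \<in> W" "r d \<in> W" using * assms(4) by (auto simp: r_def)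
    have lt: "key \<chi> s < key \<chi> x \<longleftrightarrow> key \<chi> s < key \<chi> (r x)" "key \<chi> x < key \<chi> s \<longleftrightarrow> key \<chi> (r x) < key \<chi> s"
      if "s \<in> T" for s x
    proof -
      have s: "s \<in> S" "s \<noteq> w0" "s \<noteq> m"
        using that * BNC_block(3)[OF assms(1)] assms(3,4) BNC_disjoint[OF assms(1) _ assms(2)] by blast+
      then have "key \<chi> s \<noteq> key \<chi> w0" "key \<chi> s \<noteq> key \<chi> m" by simp_all
      then show "key \<chi> s < key \<chi> x \<longleftrightarrow> key \<chi> s < key \<chi> (r x)" "key \<chi> x < key \<chi> s \<longleftrightarrow> key \<chi> (r x) < key \<chi> s"
        using assms(5) s(1) unfolding adjacent_def r_def by (auto simp: not_less order_le_less)
    qed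
    show "\<not> (key \<chi> a < key \<chi> b \<and> key \<chi> b < key \<chi> c \<and> key \<chi> c < key \<chi> d) \<and>
        \<not> (key \<chi> b < key \<chi> a \<and> key \<chi> a < key \<chi> d \<and> key \<chi> d < key \<chi> c)"
      using BNC_cross[OF assms(1) _ assms(2) *(2) r(1) *(3) r(2)]
        BNC_cross[OF assms(1,2) _ r(1) *(2) r(2) *(3)] *(1) lt[OF *(2)] lt[OF *(3)] by blast
  qed (use W assms(3) in auto)
  moreover have "(S - W) \<union> insert m W = insert m S" using W(3) by blast
  ultimately show ?thesis by simp
qed

lemma Min_insert_greater:
  assumes "finite W" "W \<noteq> {}" "Min W < m"
  shows "Min (insert m W) = Min W"
  using assms by simp

text \<open>The alternatives are the two cases of the recursion of the moments: an operator placed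
  in front of the first later entry of \<open>W\<close>, or behind the last entry.\<close>

lemma oprod_merge:
  assumes "finite W" "m \<notin> W" "k \<in> W" "\<And>x. x \<in> W \<Longrightarrow> x \<noteq> k \<Longrightarrow> Z1 x = Z2 x"
    and "(m < k \<and> (\<forall>j\<in>W. m < j \<longrightarrow> k \<le> j) \<and> Z1 k = Z2 m * Z2 k) \<or>
      (k < m \<and> (\<forall>j\<in>W. j \<le> k) \<and> Z1 k = Z2 k * Z2 m)"
  shows "oprod Z1 W = oprod Z2 (insert m W)"
proof -
  have "oprod Z1 {i \<in> W. i < k} = oprod Z2 {i \<in> W. i < k}" "oprod Z1 {i \<in> W. k < i} = oprod Z2 {i \<in> W. k < i}"
    using assms(4) by (auto intro!: oprod_cong)
  then have 1: "oprod Z1 W = oprod Z2 {i \<in> W. i < k} * Z1 k * oprod Z2 {i \<in> W. k < i}"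
    using oprod_split[OF assms(1,3), of Z1] by simp
  note 2 = oprod_insert_split(1)[OF assms(1,2), of Z2]
  from assms(5) show ?thesis
  proof
    assume *: "m < k \<and> (\<forall>j\<in>W. m < j \<longrightarrow> k \<le> j) \<and> Z1 k = Z2 m * Z2 k"
    have sets: "{i \<in> W. i < k} = {i \<in> W. i < m}" "{i \<in> W. m < i} = {k} \<union> {i \<in> W. k < i}"
      using * assms(2,3) by (auto simp: not_less order_le_less intro: linorder_neqE_nat)
    have "oprod Z2 {i \<in> W. m < i} = Z2 k * oprod Z2 {i \<in> W. k < i}"
      unfolding sets(2) using assms(1) by (subst oprod_Un) auto
    then show ?thesis unfolding 1 2 sets(1) using * by (simp add: mult.assoc)
  next
    assume *: "k < m \<and> (\<forall>j\<in>W. j \<le> k) \<and> Z1 k = Z2 k * Z2 m"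
    have sets: "{i \<in> W. i < m} = {i \<in> W. i < k} \<union> {k}" "{i \<in> W. m < i} = {}" "{i \<in> W. k < i} = {}"
      using * assms(2,3) by force+
    have "oprod Z2 {i \<in> W. i < m} = oprod Z2 {i \<in> W. i < k} * Z2 k"
      unfolding sets(1) using assms(1) by (subst oprod_Un) auto
    then show ?thesis unfolding 1 2 sets(2,3) using * by (simp add: mult.assoc)
  qed
qed

text \<open>The operator that the recursion of the moments multiplies to \<open>Z k\<close> may instead be carried
  by an additional index \<open>m\<close>, so that all arguments stay in their faces.\<close>

lemma moment_merge:
  assumes "\<sigma> \<in> BNC \<chi> S" "W \<in> \<sigma>" "m \<notin> S" "insert (insert m W) (\<sigma> - {W}) \<in> BNC \<chi> (insert m S)"
    and "\<And>V. V \<in> \<sigma> \<Longrightarrow> Min V < m" "w0 \<in> W" "adjacent \<chi> S m w0" "k \<in> W"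
    and "(m < k \<and> m < w0 \<and> (\<forall>j\<in>W. m < j \<longrightarrow> k \<le> j) \<and> Z1 k = Z2 m * Z2 k) \<or>
      (k < m \<and> w0 = k \<and> (\<forall>j\<in>S. j \<le> k) \<and> Z1 k = Z2 k * Z2 m)"
    and "\<And>x. x \<in> S \<Longrightarrow> x \<noteq> k \<Longrightarrow> Z1 x = Z2 x"
  shows "mo \<chi> \<sigma> Z1 = mo \<chi> (insert (insert m W) (\<sigma> - {W})) Z2"
  using assms
proof (induction "card \<sigma>" arbitrary: \<sigma> S Z1 Z2 k)
  case 0
  then show ?case using BNC_finite_blocks by fastforce
next
  case (Suc n)
  note bnc = Suc.prems(1) and W\<sigma> = Suc.prems(2) and mS = Suc.prems(3) and bnc2 = Suc.prems(4)
    and mins = Suc.prems(5) and w0 = Suc.prems(6) and adj = Suc.prems(7) and kW = Suc.prems(8)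
    and rel = Suc.prems(9) and same = Suc.prems(10)
  let ?W = "insert m W"
  let ?\<sigma> = "insert ?W (\<sigma> - {W})"
  note W = BNC_block[OF bnc W\<sigma>]
  have mW: "m \<notin> W" using mS W(3) by blast
  have kS: "k \<in> S" using kW W(3) by blast
  have W2: "?W \<notin> \<sigma> - {W}" using BNC_block(3)[OF bnc] mS by blast
  have MinW: "Min ?W = Min W" using Min_insert_greater[OF W(2,1) mins[OF W\<sigma>]] .
  have prodW: "oprod Z1 W = oprod Z2 ?W"
    by (rule oprod_merge[OF W(2) mW kW]) (use same rel W(3) in blast)+
  obtain V where V: "is_top \<sigma> V" using is_top_exists[OF bnc subset_refl] W\<sigma> by blast
  note V\<sigma> = is_top_in[OF V] and Vb = BNC_block[OF bnc is_top_in[OF V]]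
  have n: "n = card (\<sigma> - {V})" using Suc.hyps(2) BNC_finite_blocks[OF bnc] V\<sigma> by simp
  show ?case
  proof (cases "S - W = {}")
    case True
    then have c: "card \<sigma> \<le> 1" using BNC_card_le_1[OF bnc W\<sigma>] by simp
    then have "\<sigma> = {W}" using W\<sigma> card_le_Suc0_iff_eq[OF BNC_finite_blocks[OF bnc]] by auto
    then show ?thesis using prodW by (simp add: moment_single)
  next
    case SW: False
    show ?thesis
    proof (cases "V = W")
      case True
      \<comment> \<open>The blocks \<open>W\<close> and \<open>insert m W\<close> are removed
        together. By \<open>prodW\<close> they have the same value, and since \<open>m\<close>
        disappears with them, both recursions continue with the same data.\<close>
      have top2: "is_top ?\<sigma> ?W"
        using V MinW unfolding True is_top_def by auto
      have diff: "?\<sigma> - {?W} = \<sigma> - {W}" using W2 by blast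
      have mMin: "Min W < m" using mins[OF W\<sigma>] .
      have cong: "mo \<chi> (\<sigma> - {W}) (Z1(x := f (Z1 x))) = mo \<chi> (\<sigma> - {W}) (Z2(x := f (Z2 x)))" for x f
      proof (rule moment_cong[OF BNC_remove[OF bnc W\<sigma>]])
        fix y assume y: "y \<in> S - W"
        then have "Z1 y = Z2 y" using same[of y] kW by blast
        then show "(Z1(x := f (Z1 x))) y = (Z2(x := f (Z2 x))) y" by auto
      qed
      have ne: "S - V \<noteq> {}" using SW True by simp
      from mo_cases[OF bnc V ne] show ?thesis
      proof cases
        case (1 q)
        then have q: "mo_end S W q" using True by simp
        then have "?W = insert m {i \<in> S. Min W \<le> i}"
          unfolding mo_end_def by (intro arg_cong[where f = "insert m"]) (elim conjE)
        also have "\<dots> = {i \<in> insert m S. Min W \<le> i}" using mMin by auto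
        finally have "mo_end (insert m S) ?W q"
          using q mMin unfolding mo_end_def MinW by (intro conjI) auto
        then show ?thesis
          using moment_end[OF bnc2 top2, of q Z2] moment_end[OF bnc V, of q Z1] q
            cong[of q "\<lambda>z. z * side_op \<chi> (Min W) (E (oprod Z1 W))"]
          unfolding True MinW diff prodW by simp
      next
        case (2 w W' k')
        then have w: "mo_mid \<chi> \<sigma> S W w W' k'" using True by simp
        then have "w \<in> S - W" "W' \<in> \<sigma>" "w \<in> W'" by (auto simp: mo_mid_def)
        then have "W' \<in> ?\<sigma>" "w \<in> insert m S - ?W" using mS by auto
        moreover have "insert m S - ?W = S - W" using mS mW by blast
        ultimately have "mo_mid \<chi> ?\<sigma> (insert m S) ?W w W' k'"
          using w unfolding mo_mid_def MinW by simp
        then show ?thesis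
          using moment_mid[OF bnc2 top2, of w W' k' Z2] moment_mid[OF bnc V, of w W' k' Z1] w
            cong[of k' "\<lambda>z. side_op \<chi> (Min W) (E (oprod Z1 W)) * z"]
          unfolding True MinW diff prodW by simp
      qed
    next
      case VW: False
      have disj: "V \<inter> W = {}" using BNC_disjoint[OF bnc V\<sigma> W\<sigma>] VW by blast
      have mV: "m \<notin> V" using mS Vb(3) by blast
      have top2: "is_top ?\<sigma> V"
        using V W\<sigma> VW MinW unfolding is_top_def by auto
      define mv where "mv = Min V"
      have mvm: "mv < m" using mins[OF V\<sigma>] by (simp add: mv_def)
      have mvV: "mv \<in> V" using Vb by (simp add: mv_def)
      have w0S: "w0 \<in> S - V" using w0 W(3) disj by blast
      have mvw0: "mv < w0"
      proof -
        have "mv \<le> k \<and> mv \<noteq> k" if "\<forall>j\<in>S. j \<le> k"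
          using that mvV Vb(3) disj kW by blast
        then show ?thesis using rel mvm by (auto simp: order_le_less)
      qed
      have b: "oprod Z1 V = oprod Z2 V"
        by (rule oprod_cong) (use same Vb(3) disj kW in blast)
      define T where "T = side_op \<chi> mv (E (oprod Z2 V))"
      have not_end: "\<not> mo_end S V q" for q
        using w0S mvw0 by (auto simp: mo_end_def mv_def)
      obtain w W' k' where mid: "mo_mid \<chi> \<sigma> S V w W' k'"
        using mo_cases[OF bnc V] w0S not_end by blast
      have w: "w \<in> S - V" "mv < w" "W' \<in> \<sigma>" "w \<in> W'" "k' \<in> W'" "mv < k'"
        "\<And>j. j \<in> W' \<Longrightarrow> mv < j \<Longrightarrow> k' \<le> j"
        and ext: "\<And>i. i \<in> S - V \<Longrightarrow> mv < i \<Longrightarrow>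
          (case \<chi> mv of Lft \<Rightarrow> key \<chi> w \<le> key \<chi> i | Rgt \<Rightarrow> key \<chi> i \<le> key \<chi> w)"
        using mid by (auto simp: mo_mid_def mv_def)
      have k'S: "k' \<in> S" using w(3,5) BNC_block(3)[OF bnc] by blast
      define W2' where "W2' = (if W' = W then ?W else W')"
      \<comment> \<open>The first index of \<open>W2'\<close> after \<open>Min V\<close>. It becomes
        \<open>m\<close> exactly when the original recursion multiplies onto the entry
        \<open>k\<close> that carries the operator of \<open>m\<close> as its left factor.\<close>
      define k2 where "k2 = (if W' = W \<and> k' = k \<and> m < k then m else k')"
      have k2: "k2 \<in> W2'" "mv < k2" "\<forall>j\<in>W2'. mv < j \<longrightarrow> k2 \<le> j"
      proof -
        show "k2 \<in> W2'" using w(5) by (auto simp: k2_def W2'_def)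
        show "mv < k2" using w(6) mvm by (simp add: k2_def)
        show "\<forall>j\<in>W2'. mv < j \<longrightarrow> k2 \<le> j"
        proof (cases "W' = W")
          case True
          have "k' \<le> m \<or> (k' = k \<and> m < k)"
          proof (rule ccontr)
            assume *: "\<not> ?thesis"
            then have "m < k'" by simp
            then have "m < k" "k \<le> k'" using rel w(5) kS k'S True by auto
            moreover have "k' \<le> k" using w(7) kW mvm \<open>m < k\<close> True by auto
            ultimately show False using * by simp
          qed
          then have "k2 \<le> m" "k2 \<le> k'" using True by (auto simp: k2_def)
          moreover have "k' \<le> j" if "j \<in> W2'" "j \<noteq> m" "mv < j" for j
            using w(7) that True by (auto simp: W2'_def)
          ultimately show ?thesis by (metis order_trans)
        qed (use w(7) in \<open>auto simp: k2_def W2'_def\<close>)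
      qed
      \<comment> \<open>The new index takes over the role of \<open>w\<close> only if it is more
        extreme. Adjacency then forces \<open>w = w0\<close>, so \<open>W\<close> was already the
        block chosen by the recursion.\<close>
      define w2 where "w2 = (if (case \<chi> mv of Lft \<Rightarrow> key \<chi> m < key \<chi> w | Rgt \<Rightarrow> key \<chi> w < key \<chi> m) then m else w)"
      have w2W: "w2 \<in> W2'"
      proof (cases "w2 = w")
        case True
        then show ?thesis using w(4) by (auto simp: W2'_def)
      next
        case False
        then have *: "case \<chi> mv of Lft \<Rightarrow> key \<chi> m < key \<chi> w | Rgt \<Rightarrow> key \<chi> w < key \<chi> m" "w2 = m"
          by (auto simp: w2_def split: if_splits)
        have "key \<chi> w = key \<chi> w0"
          using *(1) ext[OF w0S mvw0] adj w(1) unfolding adjacent_def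
          by (cases "\<chi> mv") (auto simp: order_le_less)
        then have "W' = W" using BNC_disjoint[OF bnc w(3) W\<sigma> w(4)] w0 by simp
        then show ?thesis using *(2) by (simp add: W2'_def)
      qed
      have mid2: "mo_mid \<chi> ?\<sigma> (insert m S) V w2 W2' k2"
        unfolding mo_mid_def mv_def[symmetric]
      proof (intro conjI ballI impI)
        show "w2 \<in> insert m S - V" "mv < w2" using w mV mvm by (auto simp: w2_def)
        show "W2' \<in> ?\<sigma>" using w(3) by (auto simp: W2'_def)
        fix i assume "i \<in> insert m S - V" "mv < i"
        then show "case \<chi> mv of Lft \<Rightarrow> key \<chi> w2 \<le> key \<chi> i | Rgt \<Rightarrow> key \<chi> i \<le> key \<chi> w2"
          using ext[of i] by (cases "\<chi> mv") (auto simp: w2_def)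
      qed (use k2 w2W in auto)
      have diff: "?\<sigma> - {V} = insert ?W (\<sigma> - {V} - {W})" using mV by blast
      have WV: "W \<in> \<sigma> - {V}" using W\<sigma> VW by blast
      have "mo \<chi> \<sigma> Z1 = mo \<chi> (\<sigma> - {V}) (Z1(k' := T * Z1 k'))"
        using moment_mid[OF bnc V mid] by (simp add: T_def b flip: mv_def)
      also have "\<dots> = mo \<chi> (insert ?W (\<sigma> - {V} - {W})) (Z2(k2 := T * Z2 k2))"
      proof (rule Suc.hyps(1)[OF n BNC_remove[OF bnc V\<sigma>] WV _ _ _ w0 _ kW])
        show "m \<notin> S - V" using mS by blast
        have "insert m S - V = insert m (S - V)" using mV by blast
        then show "insert ?W (\<sigma> - {V} - {W}) \<in> BNC \<chi> (insert m (S - V))"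
          using BNC_remove[OF bnc2, of V] top2 unfolding diff is_top_def by simp
        show "adjacent \<chi> (S - V) m w0" using adj by (simp add: adjacent_def)
        have km: "k \<noteq> m" using kS mS by blast
        have k'm: "k' \<noteq> m" using k'S mS by blast
        have k'W: "W' = W" if "k' = k"
          using BNC_disjoint[OF bnc w(3) W\<sigma> w(5)] kW that by simp
        show "m < k \<and> m < w0 \<and> (\<forall>j\<in>W. m < j \<longrightarrow> k \<le> j) \<and>
            (Z1(k' := T * Z1 k')) k = (Z2(k2 := T * Z2 k2)) m * (Z2(k2 := T * Z2 k2)) k \<or>
          k < m \<and> w0 = k \<and> (\<forall>j\<in>S - V. j \<le> k) \<and>
            (Z1(k' := T * Z1 k')) k = (Z2(k2 := T * Z2 k2)) k * (Z2(k2 := T * Z2 k2)) m"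
          using rel km k'm k'W by (auto simp: k2_def mult.assoc)
        show "(Z1(k' := T * Z1 k')) x = (Z2(k2 := T * Z2 k2)) x" if "x \<in> S - V" "x \<noteq> k" for x
          using that same[of x] mS by (auto simp: k2_def)
      qed (use mins in blast)
      also have "\<dots> = mo \<chi> ?\<sigma> Z2"
        using moment_mid[OF bnc2 top2 mid2] by (simp add: T_def diff flip: mv_def)
      finally show ?thesis .
    qed
  qed
qed

text \<open>A third partition mediates. In \<open>evM\<close> the top block \<open>V\<close>
  collapses to a singleton at \<open>m = Min V\<close>; in \<open>moment\<close> its operator is
  multiplied onto \<open>Z k\<close>. Both agree with the partition in which \<open>m\<close>,
  carrying the operator, is merged into the block \<open>W\<close> of \<open>k\<close>. It has fewer
  blocks than \<open>\<pi>\<close>, so the induction hypothesis applies, and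
  \<open>evM_split_scalar\<close> detaches \<open>m\<close> again.\<close>

lemma moment_eq_evM:
  assumes "\<pi> \<in> BNC \<chi> S" "adm \<chi> S Z"
  shows "mo \<chi> \<pi> Z = evM \<chi> \<pi> Z"
  using assms
proof (induction "card \<pi>" arbitrary: \<pi> S Z rule: less_induct)
  case less
  note bnc = less.prems(1)
  show ?case
  proof (cases "\<pi> = {}")
    case True
    then show ?thesis by (simp add: moment_single E_1)
  next
    case False
    then obtain V where V: "is_top \<pi> V" using is_top_exists[OF bnc subset_refl] by blast
    note V\<pi> = is_top_in[OF V] and Vb = BNC_block[OF bnc is_top_in[OF V]]
    note bncV = BNC_remove[OF bnc V\<pi>]
    define m where "m = Min V"
    have mV: "m \<in> V" using Vb by (simp add: m_def)
    define b where "b = E (oprod Z V)"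
    define Z' where "Z' = Z(m := side_op \<chi> m b)"
    have mS: "m \<notin> S - V" using mV by blast
    have bB: "b \<in> B" by (simp add: b_def E_B)
    show ?thesis
    proof (cases "S - V = {}")
      case True
      then have "card \<pi> \<le> 1" "S = V" using BNC_card_le_1[OF bnc V\<pi>] Vb(3) by auto
      moreover have "\<pi> = {V}"
        using calculation(1) V\<pi> card_le_Suc0_iff_eq[OF BNC_finite_blocks[OF bnc]] by auto
      ultimately show ?thesis using Vb by (simp add: moment_single ev_single mom_def)
    next
      case nonempty: False
      have adm': "adm \<chi> (insert m (S - V)) Z'"
        using less.prems(2) side_op_face[OF bB] by (auto simp: adm_def Z'_def)
      have int: "chi_interval \<chi> S V"
        by (rule is_top_interval[OF bnc V\<pi>]) (use V in \<open>auto simp: is_top_def\<close>)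
      have collapse: "evM \<chi> \<pi> Z = evM \<chi> (insert {m} (\<pi> - {V})) Z'"
        using evM_collapse[OF bnc V\<pi> int mV less.prems(2)] by (simp add: Z'_def b_def mom_def)
      have mins: "Min U < m" if "U \<in> \<pi> - {V}" for U
        using V that by (auto simp: is_top_def m_def)
      have key: ?thesis
        if W: "W \<in> \<pi> - {V}" and w0: "w0 \<in> W" "adjacent \<chi> (S - V) m w0" and k: "k \<in> W"
          and Z1: "mo \<chi> \<pi> Z = mo \<chi> (\<pi> - {V}) Z1" "\<And>x. x \<noteq> k \<Longrightarrow> Z1 x = Z x"
          and rel: "(m < k \<and> m < w0 \<and> (\<forall>j\<in>W. m < j \<longrightarrow> k \<le> j) \<and> Z1 k = Z' m * Z' k) \<or>
            (k < m \<and> w0 = k \<and> (\<forall>j\<in>S - V. j \<le> k) \<and> Z1 k = Z' k * Z' m)"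
        for W w0 k Z1
      proof -
        let ?\<sigma> = "insert (insert m W) (\<pi> - {V} - {W})"
        have bnc2: "?\<sigma> \<in> BNC \<chi> (insert m (S - V))"
          by (rule BNC_insert_adjacent[OF bncV W mS w0])
        have mW: "m \<notin> W" using BNC_block(3)[OF bncV W] mS by blast
        have Wne: "W \<noteq> {}" using BNC_block(1)[OF bncV W] .
        have "mo \<chi> \<pi> Z = mo \<chi> ?\<sigma> Z'"
          unfolding Z1(1)
        proof (rule moment_merge[where k = k and ?w0.0 = w0])
          show "Z1 x = Z' x" if "x \<in> S - V" "x \<noteq> k" for x
            using Z1(2)[OF that(2)] that(1) mS by (auto simp: Z'_def)
        qed (fact bncV W mS bnc2 mins w0 k rel)+
        also have "\<dots> = evM \<chi> ?\<sigma> Z'"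
        proof (rule less.hyps[OF _ bnc2 adm'])
          have "card ?\<sigma> \<le> Suc (card (\<pi> - {V} - {W}))" by (rule card_insert_le_m1) auto
          then have "card ?\<sigma> \<le> Suc (card (\<pi> - {V} - {W}))" .
          also have "\<dots> = card (\<pi> - {V})"
            using card_Suc_Diff1[OF BNC_finite_blocks[OF bncV] W] .
          also have "\<dots> < card \<pi>"
            using card_Diff1_less[OF BNC_finite_blocks[OF bnc] V\<pi>] .
          finally show "card ?\<sigma> < card \<pi>" .
        qed
        also have "\<dots> = evM \<chi> ((?\<sigma> - {insert m W}) \<union> {insert m W - {m}, {m}}) Z'"
          by (rule evM_split_scalar[OF bnc2 _ _ _ adm' bB, symmetric])
            (use mW Wne in \<open>auto simp: Z'_def\<close>)
        also have "(?\<sigma> - {insert m W}) \<union> {insert m W - {m}, {m}} = insert {m} (\<pi> - {V})"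
        proof -
          have "insert m W \<notin> \<pi> - {V} - {W}" using BNC_block(3)[OF bncV] mS by blast
          then have "?\<sigma> - {insert m W} = \<pi> - {V} - {W}" by blast
          moreover have "insert m W - {m} = W" using mW by blast
          ultimately have "(?\<sigma> - {insert m W}) \<union> {insert m W - {m}, {m}} = (\<pi> - {V} - {W}) \<union> {W, {m}}"
            by (simp only:)
          also have "\<dots> = insert {m} (insert W (\<pi> - {V} - {W}))" by blast
          also have "insert W (\<pi> - {V} - {W}) = \<pi> - {V}" using W by (rule insert_Diff)
          finally show ?thesis .
        qed
        finally show ?thesis unfolding collapse .
      qed
      have lt: "key \<chi> x < key \<chi> y \<longleftrightarrow> chi_less \<chi> x y" for x y by (simp add: chi_less_key)
      from mo_cases[OF bnc V nonempty] show ?thesis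
      proof cases
        case (1 q)
        then have q: "V = {i \<in> S. m \<le> i}" "q \<in> S" "q < m" "\<And>i. i \<in> S \<Longrightarrow> i < m \<Longrightarrow> i \<le> q"
          by (auto simp: mo_end_def m_def)
        have qV: "q \<in> S - V" using q by auto
        then obtain W where W: "W \<in> \<pi> - {V}" "q \<in> W" using BNC_obtain_block[OF bncV] by blast
        have le: "s \<le> q \<and> s < m" if "s \<in> S - V" for s using that q by auto
        \<comment> \<open>\<open>m\<close> and \<open>q\<close> are the two largest indices left, so
          they are neighbours where the left and the right half of the chi-order meet.\<close>
        have "adjacent \<chi> (S - V) m q"
          unfolding adjacent_def lt chi_less_def
          using le q(3) by (auto split: side.splits) (use le in force)+
        then show ?thesis
          using le q(3) moment_end[OF bnc V 1, of Z]
          by (intro key[OF W(1,2) _ W(2), of "Z(q := Z q * side_op \<chi> m b)"])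
            (auto simp: Z'_def m_def b_def)
      next
        case (2 w W k)
        then have w: "w \<in> S - V" "m < w" "W \<in> \<pi>" "w \<in> W" "k \<in> W" "m < k"
          "\<And>j. j \<in> W \<Longrightarrow> m < j \<Longrightarrow> k \<le> j"
          and ext: "\<And>i. i \<in> S - V \<Longrightarrow> m < i \<Longrightarrow>
            (case \<chi> m of Lft \<Rightarrow> key \<chi> w \<le> key \<chi> i | Rgt \<Rightarrow> key \<chi> i \<le> key \<chi> w)"
          by (auto simp: mo_mid_def m_def)
        have W: "W \<in> \<pi> - {V}" using w(1,3,4) by blast
        \<comment> \<open>An index smaller than both \<open>m\<close> and \<open>w\<close> never
          lies between them in the chi-order, and one above \<open>m\<close> is excluded by the
          choice of \<open>w\<close>.\<close>
        have "adjacent \<chi> (S - V) m w"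
          unfolding adjacent_def
        proof (intro ballI)
          fix s assume s: "s \<in> S - V"
          have "s \<noteq> m" using s mV by blast
          show "\<not> (key \<chi> m < key \<chi> s \<and> key \<chi> s < key \<chi> w) \<and> \<not> (key \<chi> w < key \<chi> s \<and> key \<chi> s < key \<chi> m)"
          proof (cases "m < s")
            case True
            then show ?thesis
              using ext[OF s] w(2) \<open>s \<noteq> m\<close> unfolding lt not_less[symmetric] chi_less_def
              by (auto split: side.splits)
          next
            case False
            then show ?thesis
              using w(2) \<open>s \<noteq> m\<close> unfolding lt chi_less_def by (auto split: side.splits)
          qed
        qed
        then show ?thesis
          using w moment_mid[OF bnc V 2, of Z]
          by (intro key[OF W w(4) _ w(5), of "Z(k := side_op \<chi> m b * Z k)"])
            (auto simp: Z'_def m_def b_def)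
      qed
    qed
  qed
qed

end

section \<open>Moebius inversion\<close>

lemma bnc_mobius_sum:
  assumes "\<sigma> \<in> BNC \<chi> S" "\<omega> \<in> BNC \<chi> S"
  shows "(\<Sum>\<tau>\<in>{\<tau> \<in> {\<tau> \<in> BNC \<chi> S. finer \<tau> \<omega>}. finer \<sigma> \<tau>}. bnc_mobius \<chi> S \<sigma> \<tau>) =
    (if \<sigma> = \<omega> then 1 else 0)"
proof -
  let ?I = "{\<tau> \<in> {\<tau> \<in> BNC \<chi> S. finer \<tau> \<omega>}. finer \<sigma> \<tau>}"
  consider "\<sigma> = \<omega>" | "\<sigma> \<noteq> \<omega>" "finer \<sigma> \<omega>" | "\<sigma> \<noteq> \<omega>" "\<not> finer \<sigma> \<omega>" by blast
  then show ?thesis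
  proof cases
    case 1
    then have "?I = {\<omega>}" using assms finer_antisym finer_refl by blast
    then show ?thesis using 1 assms by (simp add: bnc_mobius.simps finer_refl)
  next
    case 2
    have "\<omega> \<in> ?I" using 2 assms finer_refl by blast
    moreover have "finite ?I" by (rule finite_subset[OF _ finite_BNC[of \<chi> S]]) blast
    moreover have "?I - {\<omega>} = {\<tau> \<in> BNC \<chi> S. finer \<sigma> \<tau> \<and> finer \<tau> \<omega> \<and> \<tau> \<noteq> \<omega>}" by blast
    ultimately have "(\<Sum>\<tau>\<in>?I. bnc_mobius \<chi> S \<sigma> \<tau>) = bnc_mobius \<chi> S \<sigma> \<omega> +
        (\<Sum>\<tau>\<in>{\<tau> \<in> BNC \<chi> S. finer \<sigma> \<tau> \<and> finer \<tau> \<omega> \<and> \<tau> \<noteq> \<omega>}. bnc_mobius \<chi> S \<sigma> \<tau>)"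
      using sum.remove[of ?I \<omega> "bnc_mobius \<chi> S \<sigma>"] by simp
    then show ?thesis
      using 2 assms bnc_mobius.simps[of \<chi> S \<sigma> \<omega>] by simp
  next
    case 3
    then have "?I = {}" using finer_trans by blast
    then show ?thesis using 3 by (simp only: sum.empty if_False)
  qed
qed

text \<open>The recursion of \<open>bnc_mobius\<close> controls sums over its second partition.
  These show that the candidate \<open>h'\<close> has the same sums over lower sets as
  \<open>h\<close>, and such sums determine a function by induction.\<close>

lemma bnc_mobius_inversion:
  fixes f h :: "nat set set \<Rightarrow> 'd::ring_1"
  assumes "\<And>\<pi>. \<pi> \<in> BNC \<chi> S \<Longrightarrow> f \<pi> = (\<Sum>\<sigma>\<in>{\<sigma> \<in> BNC \<chi> S. finer \<sigma> \<pi>}. h \<sigma>)"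
    and "\<pi> \<in> BNC \<chi> S"
  shows "h \<pi> = (\<Sum>\<sigma>\<in>{\<sigma> \<in> BNC \<chi> S. finer \<sigma> \<pi>}. f \<sigma> * of_int (bnc_mobius \<chi> S \<sigma> \<pi>))"
proof -
  let ?I = "\<lambda>\<pi>. {\<sigma> \<in> BNC \<chi> S. finer \<sigma> \<pi>}"
  have fin: "finite (?I \<pi>)" for \<pi> by (rule finite_subset[OF _ finite_BNC[of \<chi> S]]) blast
  define h' where "h' \<pi> = (\<Sum>\<sigma>\<in>?I \<pi>. f \<sigma> * of_int (bnc_mobius \<chi> S \<sigma> \<pi>))" for \<pi>
  have h': "(\<Sum>\<tau>\<in>?I \<omega>. h' \<tau>) = f \<omega>" if \<omega>: "\<omega> \<in> BNC \<chi> S" for \<omega>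
  proof -
    have "(\<Sum>\<tau>\<in>?I \<omega>. h' \<tau>) =
        (\<Sum>\<sigma>\<in>BNC \<chi> S. \<Sum>\<tau>\<in>{\<tau> \<in> ?I \<omega>. finer \<sigma> \<tau>}. f \<sigma> * of_int (bnc_mobius \<chi> S \<sigma> \<tau>))"
      unfolding h'_def by (rule sum.swap_restrict[OF fin finite_BNC])
    also have "\<dots> = (\<Sum>\<sigma>\<in>BNC \<chi> S. if \<sigma> = \<omega> then f \<sigma> else 0)"
    proof (rule sum.cong[OF refl])
      fix \<sigma> assume \<sigma>: "\<sigma> \<in> BNC \<chi> S"
      show "(\<Sum>\<tau>\<in>{\<tau> \<in> ?I \<omega>. finer \<sigma> \<tau>}. f \<sigma> * of_int (bnc_mobius \<chi> S \<sigma> \<tau>)) =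
          (if \<sigma> = \<omega> then f \<sigma> else 0)"
        unfolding sum_distrib_left[symmetric] of_int_sum[symmetric] bnc_mobius_sum[OF \<sigma> \<omega>] by simp
    qed
    also have "\<dots> = f \<omega>" using \<omega> by simp
    finally show ?thesis .
  qed
  have "h \<pi> = h' \<pi>"
    using assms(2)
  proof (induction "card (?I \<pi>)" arbitrary: \<pi> rule: less_induct)
    case less
    have \<pi>: "\<pi> \<in> ?I \<pi>" using less.prems finer_refl by blast
    have "h \<tau> = h' \<tau>" if \<tau>: "\<tau> \<in> ?I \<pi> - {\<pi>}" for \<tau>
    proof (rule less.hyps)
      have "\<not> finer \<pi> \<tau>" using finer_antisym[of \<pi> \<chi> S \<tau>] \<tau> less.prems by blast
      then have "?I \<tau> \<subset> ?I \<pi>" using \<tau> \<pi> finer_trans by blast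
      then show "card (?I \<tau>) < card (?I \<pi>)" using fin by (rule psubset_card_mono[rotated])
    qed (use \<tau> in blast)
    then have "(\<Sum>\<tau>\<in>?I \<pi> - {\<pi>}. h \<tau>) = (\<Sum>\<tau>\<in>?I \<pi> - {\<pi>}. h' \<tau>)" by (rule sum.cong[OF refl])
    moreover have "(\<Sum>\<tau>\<in>?I \<pi>. h \<tau>) = (\<Sum>\<tau>\<in>?I \<pi>. h' \<tau>)"
      using h'[OF less.prems] assms(1)[OF less.prems] by simp
    ultimately show ?case
      using sum.remove[OF fin \<pi>, of h] sum.remove[OF fin \<pi>, of h'] by simp
  qed
  then show ?thesis by (simp add: h'_def)
qed


section \<open>Identification of the cumulants\<close>

context bifree_space
begin

text \<open>This is \<open>ev_subst\<close> for the trivial grouping \<open>g = id\<close>, with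
  \<open>D V\<close> consisting of all partitions of \<open>V\<close>: every block moment is
  expanded into cumulants by \<open>cum_moment\<close>.\<close>

lemma evM_eq_sum_cum:
  assumes "\<pi> \<in> BNC \<chi> S" "adm \<chi> S Z"
  shows "evM \<chi> \<pi> Z = (\<Sum>\<sigma>\<in>{\<sigma> \<in> BNC \<chi> S. finer \<sigma> \<pi>}. ev (cum \<chi> E E) (cum \<chi> E E) \<chi> \<sigma> Z)"
proof -
  interpret grouping L R B \<chi> \<chi> id S
    by unfold_locales (use BNC_finite[OF assms(1)] in auto)
  have hat: "hat V = V" if "V \<subseteq> S" for V using that by (auto simp: hat_def)
  have gp: "group_prod Z p = Z p" if "p \<in> S" for Z p using that hat[of "{p}"] by (simp add: group_prod_def)
  note blk = BNC_block[OF assms(1)]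
  let ?D = "\<lambda>V. BNC \<chi> (hat V)"
  have "evM \<chi> \<pi> Z = evM \<chi> \<pi> (group_prod Z)"
    by (rule ev_cong[OF assms(1) is_local_mom is_local_mom]) (simp add: gp)
  also have "\<dots> = (\<Sum>\<sigma>\<in>block_sets ?D \<pi>. ev (cum \<chi> E E) (cum \<chi> E E) \<chi> \<sigma> Z)"
  proof (rule ev_subst)
    show "is_additive (cum \<chi> E E)" by (rule is_additive_cum) (simp_all add: E_add is_inner_mom)
    then show "is_additive (cum \<chi> E E)" .
    show "is_local (cum \<chi> E E)" by (rule is_local_cum)
    show "is_inner \<chi> (cum \<chi> E E)" using is_inner_cum[OF is_inner_mom] .
    show "adm \<chi> (hat S) Z" using assms(2) by (simp add: hat)
    fix V and Z' :: "nat \<Rightarrow> 'a" assume V: "V \<in> \<pi>"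
    have "mom E V (group_prod Z') = mom E V Z'"
      by (rule is_localD[OF is_local_mom]) (use gp blk(3)[OF V] in blast)
    also have "\<dots> = (\<Sum>\<tau>\<in>?D V. ev (cum \<chi> E E) (cum \<chi> E E) \<chi> \<tau> Z')"
      unfolding hat[OF blk(3)[OF V]] mom_def by (rule cum_moment[OF blk(2,1)[OF V]])
    finally show "mom E V (group_prod Z') = (\<Sum>\<tau>\<in>?D V. ev (cum \<chi> E E) (cum \<chi> E E) \<chi> \<tau> Z')" .
    then show "mom E V (group_prod Z') = (\<Sum>\<tau>\<in>?D V. ev (cum \<chi> E E) (cum \<chi> E E) \<chi> \<tau> Z')" .
  qed (use assms(1) in auto)
  also have "block_sets ?D \<pi> = {\<sigma> \<in> BNC \<chi> S. finer \<sigma> \<pi>}"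
  proof -
    have fin: "(\<forall>T\<in>\<sigma>. \<exists>V\<in>\<pi>. T \<subseteq> hat V) \<longleftrightarrow> finer \<sigma> \<pi>" for \<sigma>
      unfolding finer_def using hat[OF blk(3)] by metis
    have "{T \<in> \<sigma>. T \<subseteq> hat V} \<in> BNC \<chi> (hat V)" if "\<sigma> \<in> BNC \<chi> S" "finer \<sigma> \<pi>" "V \<in> \<pi>" for \<sigma> V
      using block_sets_Union[OF assms(1) _ _ that(3), of \<sigma>] that fin hat[of S] by simp
    then show ?thesis
      unfolding block_sets_def fin BNC_Union[OF assms(1)] using hat[of S] by auto
  qed
  finally show ?thesis .
qed

lemma kappa_eq_cum:
  assumes "finite S" "S \<noteq> {}" "adm \<chi> S Z"
  shows "kappa L R E \<chi> {S} Z = cum \<chi> E E S Z"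
proof -
  have bnc: "{S} \<in> BNC \<chi> S" using BNC_single[OF assms(1,2)] .
  have "cum \<chi> E E S Z = ev (cum \<chi> E E) (cum \<chi> E E) \<chi> {S} Z"
    by (simp add: ev_single assms(1,2))
  also have "\<dots> = (\<Sum>\<sigma>\<in>{\<sigma> \<in> BNC \<chi> S. finer \<sigma> {S}}. evM \<chi> \<sigma> Z * of_int (bnc_mobius \<chi> S \<sigma> {S}))"
    by (rule bnc_mobius_inversion[OF evM_eq_sum_cum[OF _ assms(3)] bnc])
  also have "\<dots> = kappa L R E \<chi> {S} Z"
    unfolding kappa_def by (intro sum.cong) (auto simp: moment_eq_evM[OF _ assms(3)])
  finally show ?thesis by simp
qed

text \<open>\<open>V'\<close> contains the first and the last index, so every other block is nested
  in it. Hence \<open>ev_remove\<close> applies in the order of \<open>outer_reduce\<close> although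
  the outer functional \<open>K\<close> may differ from the inner one.\<close>

lemma ev_outer_reduce:
  assumes "is_local K" "\<rho> \<in> BNC \<chi> S" "V' \<in> \<rho>" "a \<in> V'" "b \<in> V'"
    and "\<And>s. s \<in> S \<Longrightarrow> key \<chi> a \<le> key \<chi> s" "\<And>s. s \<in> S \<Longrightarrow> key \<chi> s \<le> key \<chi> b" "adm \<chi> S Z"
  shows "ev K (cum \<chi> E E) \<chi> \<rho> Z = K V' (outer_reduce L R E \<chi> V' \<rho> Z) \<and>
    adm \<chi> V' (outer_reduce L R E \<chi> V' \<rho> Z)"
  using assms(2-)
proof (induction "card \<rho>" arbitrary: \<rho> S Z)
  case 0
  then show ?case using BNC_finite_blocks by fastforce
next
  case (Suc n)
  note bnc = Suc.prems(1) and V' = Suc.prems(2) and a = Suc.prems(3) and b = Suc.prems(4)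
    and amin = Suc.prems(5) and bmax = Suc.prems(6) and adm = Suc.prems(7)
  note Vb' = BNC_block[OF bnc V']
  have fin: "finite (\<rho> - {V'})" using BNC_finite_blocks[OF bnc] by simp
  show ?case
  proof (cases "\<rho> - {V'} = {}")
    case True
    then have \<rho>: "\<rho> = {V'}" using V' by blast
    then show ?thesis
      using Vb' adm_mono[OF adm Vb'(3)] by (simp add: outer_reduce.simps ev_single)
  next
    case False
    obtain V where top: "is_top (\<rho> - {V'}) V" using is_top_exists[OF bnc _ False] by blast
    have V: "V \<in> \<rho>" "V \<noteq> V'" using is_top_in[OF top] by auto
    note Vb = BNC_block[OF bnc V(1)]
    have disj: "V \<inter> V' = {}" using BNC_disjoint[OF bnc V(1) V'] V(2) by blast
    have aV: "before \<chi> {a} V" and bV: "before \<chi> V {b}"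
      unfolding before_def using amin bmax a b disj Vb(3) by (auto simp: order_le_less)
    \<comment> \<open>\<open>V\<close> has the largest minimum only among the blocks other than
      \<open>V'\<close>. For \<open>V'\<close>, the element \<open>a\<close> before \<open>V\<close>
      serves instead.\<close>
    have int: "chi_interval \<chi> S V"
    proof (rule is_top_interval[OF bnc V(1)])
      fix W assume W: "W \<in> \<rho>" "W \<noteq> V"
      show "Min W < Min V \<or> (\<exists>w\<in>W. \<forall>v\<in>V. key \<chi> w < key \<chi> v)"
      proof (cases "W = V'")
        case True
        then show ?thesis using a beforeD[OF aV] by blast
      next
        case False
        then show ?thesis using top W by (auto simp: is_top_def)
      qed
    qed
    obtain p where p: "is_pred \<chi> S V p"
      using is_pred_exists[OF BNC_finite[OF bnc] _ aV] a Vb'(3) by blast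
    define c where "c = cum \<chi> E E V Z"
    have c: "kappa L R E \<chi> {V} Z = c"
      using kappa_eq_cum[OF Vb(2,1) adm_mono[OF adm Vb(3)]] by (simp add: c_def)
    have cB: "c \<in> B" using is_innerD(2)[OF is_inner_cum[OF is_inner_mom]] by (simp add: c_def)
    have red: "outer_reduce L R E \<chi> V' \<rho> Z = outer_reduce L R E \<chi> V' (\<rho> - {V}) (ins \<chi> p c Z)"
    proof -
      have "chi_Max \<chi> {j \<in> \<Union>\<rho>. chi_less \<chi> j (chi_Min \<chi> V)} = p"
        using chi_pred_eq[OF Vb(2,1) p] BNC_Union[OF bnc] by (simp add: chi_pred_def)
      moreover have "card (\<rho> - {V'}) \<noteq> 0" using fin False by simp
      ultimately show ?thesis
        by (subst outer_reduce.simps) (simp only: is_top_arg_max[OF top] c ins_def Let_def if_False)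
    qed
    have "nested \<chi> (\<rho> - {V}) V"
      unfolding nested_def using V' V(2) a b aV bV by blast
    then have "ev K (cum \<chi> E E) \<chi> \<rho> Z = ev K (cum \<chi> E E) \<chi> (\<rho> - {V}) (ins \<chi> p c Z)"
      unfolding c_def
      by (intro ev_remove[OF assms(1) is_inner_cum[OF is_inner_mom] bnc V(1) int p adm] disjI2)
    moreover have "ev K (cum \<chi> E E) \<chi> (\<rho> - {V}) (ins \<chi> p c Z) =
        K V' (outer_reduce L R E \<chi> V' (\<rho> - {V}) (ins \<chi> p c Z)) \<and>
      adm \<chi> V' (outer_reduce L R E \<chi> V' (\<rho> - {V}) (ins \<chi> p c Z))"
    proof (rule Suc.hyps(1)[OF _ BNC_remove[OF bnc V(1)] _ a b])
      show "n = card (\<rho> - {V})" using Suc.hyps(2) BNC_finite_blocks[OF bnc] V(1) by simp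
      show "adm \<chi> (S - V) (ins \<chi> p c Z)" by (intro adm_ins adm_mono[OF adm] cB) blast
    qed (use V' V(2) amin bmax in auto)
    ultimately show ?thesis unfolding red by simp
  qed
qed

text \<open>Each member of the list is a union of blocks lying before all later ones, so
  \<open>ev_append\<close> splits off one factor at a time.\<close>

lemma ev_prod_list:
  assumes "is_local \<Phi>" "is_local \<Psi>" "\<sigma> \<in> BNC \<chi> S"
    and "sorted_wrt (before \<chi>) Vs" "\<Union>(set Vs) = S" "\<And>V. V \<in> set Vs \<Longrightarrow> \<exists>\<rho>\<subseteq>\<sigma>. V = \<Union>\<rho>"
  shows "ev \<Phi> \<Psi> \<chi> \<sigma> Z = prod_list (map (\<lambda>V. ev \<Phi> \<Psi> \<chi> {W \<in> \<sigma>. W \<subseteq> V} Z) Vs)"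
  using assms(3-)
proof (induction Vs arbitrary: \<sigma> S)
  case Nil
  then show ?case using BNC_empty_iff[OF Nil.prems(1)] by simp
next
  case (Cons V Vs)
  note bnc = Cons.prems(1)
  let ?\<sigma>1 = "{W \<in> \<sigma>. W \<subseteq> V}" and ?\<sigma>2 = "{W \<in> \<sigma>. \<not> W \<subseteq> V}"
  obtain \<rho> where \<rho>: "\<rho> \<subseteq> \<sigma>" "V = \<Union>\<rho>" using Cons.prems(4)[of V] by auto
  have U1: "\<Union>?\<sigma>1 = V" using \<rho> by auto
  have later: "V2 \<inter> V = {}" if "V2 \<in> set Vs" for V2
    using Cons.prems(2) that by (force simp: before_def)
  have S: "\<Union>(set Vs) = S - V" using Cons.prems(3) later by auto
  have meet: "W \<subseteq> V" if W: "W \<in> \<sigma>" "x \<in> W" "x \<in> V" for W x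
  proof -
    obtain W' where "W' \<in> \<rho>" "x \<in> W'" using \<rho>(2) W(3) by blast
    then show ?thesis using BNC_disjoint[OF bnc W(1) _ W(2), of W'] \<rho> by blast
  qed
  have U2: "\<Union>?\<sigma>2 = S - V" using BNC_Union[OF bnc] U1 meet by blast
  have bnc1: "?\<sigma>1 \<in> BNC \<chi> V" using BNC_subset[OF bnc, of ?\<sigma>1] U1 by auto
  have bnc2: "?\<sigma>2 \<in> BNC \<chi> (S - V)" using BNC_subset[OF bnc, of ?\<sigma>2] U2 by auto
  have bef: "before \<chi> V (S - V)"
    using Cons.prems(2) unfolding S[symmetric] by (auto simp: before_def)
  have eq: "{W \<in> ?\<sigma>2. W \<subseteq> V2} = {W \<in> \<sigma>. W \<subseteq> V2}" if "V2 \<in> set Vs" for V2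
  proof -
    have "\<not> W \<subseteq> V" if "W \<in> \<sigma>" "W \<subseteq> V2" for W
      using later[OF \<open>V2 \<in> set Vs\<close>] BNC_block(1)[OF bnc that(1)] that(2) by blast
    then show ?thesis by blast
  qed
  have "ev \<Phi> \<Psi> \<chi> ?\<sigma>2 Z = prod_list (map (\<lambda>V2. ev \<Phi> \<Psi> \<chi> {W \<in> ?\<sigma>2. W \<subseteq> V2} Z) Vs)"
  proof (rule Cons.IH[OF bnc2 _ S])
    fix V2 assume V2: "V2 \<in> set Vs"
    then obtain \<rho>2 where \<rho>2: "\<rho>2 \<subseteq> \<sigma>" "V2 = \<Union>\<rho>2" using Cons.prems(4)[of V2] by auto
    have "\<rho>2 \<subseteq> ?\<sigma>2"
    proof
      fix W assume "W \<in> \<rho>2"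
      then show "W \<in> ?\<sigma>2" using \<rho>2 later[OF V2] BNC_block(1)[OF bnc, of W] by blast
    qed
    then show "\<exists>\<rho>\<subseteq>?\<sigma>2. V2 = \<Union>\<rho>" using \<rho>2 by blast
  qed (use Cons.prems(2) in simp)
  also have "\<dots> = prod_list (map (\<lambda>V2. ev \<Phi> \<Psi> \<chi> {W \<in> \<sigma>. W \<subseteq> V2} Z) Vs)"
    using eq by (intro arg_cong[where f = prod_list] map_cong) auto
  finally have tail: "ev \<Phi> \<Psi> \<chi> ?\<sigma>2 Z = \<dots>" .
  have "?\<sigma>1 \<union> ?\<sigma>2 = \<sigma>" by blast
  then show ?case
    using ev_append[OF bnc1 bnc2 bef assms(1,2), of Z] tail by simp
qed

lemma cumK_eq_ev:
  assumes "\<sigma> \<in> BNC \<chi> S" "adm \<chi> S Z"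
  shows "cumK L R E F \<chi> \<sigma> Z = ev (cum \<chi> F E) (cum \<chi> E E) \<chi> \<sigma> Z"
  using assms
\<comment> \<open>The summand 1 ranks the one-block partition above the other partitions of the same
  set, to which its cumulant refers; these in turn refer to single blocks of smaller size.\<close>
proof (induction "2 * card S + (if \<sigma> = {S} then 1 else 0)" arbitrary: \<sigma> S Z rule: less_induct)
  case less
  note bnc = less.prems(1)
  have Un: "\<Union>\<sigma> = S" using BNC_Union[OF bnc] .
  have finS: "finite S" using BNC_finite[OF bnc] .
  show ?case
  proof (cases "\<sigma> = {S}")
    case True
    then have ne: "S \<noteq> {}" using BNC_block(1)[OF bnc] by blast
    have "cumK L R E F \<chi> \<sigma> Z = F (oprod Z S) - (\<Sum>\<sigma>\<in>BNC \<chi> S - {{S}}. cumK L R E F \<chi> \<sigma> Z)"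
      using True bnc by (subst cumK.simps) simp
    also have "\<dots> = F (oprod Z S) - (\<Sum>\<sigma>\<in>BNC \<chi> S - {{S}}. ev (cum \<chi> F E) (cum \<chi> E E) \<chi> \<sigma> Z)"
      using True less.prems(2) by (intro arg_cong2[where f = minus] sum.cong less.hyps) auto
    also have "\<dots> = ev (cum \<chi> F E) (cum \<chi> E E) \<chi> \<sigma> Z"
      using True finS ne by (simp add: ev_single cum.simps[of \<chi> F E S])
    finally show ?thesis .
  next
    case False
    define Vs where "Vs = outer_list \<chi> \<sigma>"
    have out: "is_outer_list \<chi> \<sigma> Vs" using outer_list[of \<sigma> \<chi>] bnc Un by (simp add: Vs_def)
    have part: "\<Union>(set Vs) = S" "{} \<notin> set Vs"
      using out unfolding is_outer_list_def Un partition_on_def by auto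
    have un: "\<exists>\<rho>\<subseteq>\<sigma>. V = \<Union>\<rho>" if "V \<in> set Vs" for V
      using out that unfolding is_outer_list_def by blast
    have "cumK L R E F \<chi> \<sigma> Z = prod_list (map (\<lambda>V.
         let V' = block_of \<sigma> (chi_Min \<chi> V)
         in cumK L R E F \<chi> {V'} (outer_reduce L R E \<chi> V' {W \<in> \<sigma>. W \<subseteq> V} Z)) Vs)"
      using False bnc Un by (subst cumK.simps) (simp add: Vs_def)
    also have "\<dots> = prod_list (map (\<lambda>V. ev (cum \<chi> F E) (cum \<chi> E E) \<chi> {W \<in> \<sigma>. W \<subseteq> V} Z) Vs)"
    proof (intro arg_cong[where f = prod_list] map_cong refl)
      fix V assume V: "V \<in> set Vs"
      have VS: "V \<subseteq> S" "V \<noteq> {}" using V part by blast+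
      then have VS: "V \<subseteq> S" "V \<noteq> {}" "finite V" using finite_subset[OF _ finS] by blast+
      obtain W where W: "W \<in> \<sigma>" "chi_Min \<chi> V \<in> W" "chi_Max \<chi> V \<in> W"
        using out V unfolding is_outer_list_def by blast
      have blk: "block_of \<sigma> (chi_Min \<chi> V) = W" using block_of_eq[OF BNC_partition[OF bnc] W(1,2)] .
      obtain \<rho> where \<rho>: "\<rho> \<subseteq> \<sigma>" "V = \<Union>\<rho>" using un[OF V] by blast
      have U: "\<Union>{W \<in> \<sigma>. W \<subseteq> V} = V" using \<rho> by auto
      have bncV: "{W \<in> \<sigma>. W \<subseteq> V} \<in> BNC \<chi> V" using BNC_subset[OF bnc, of "{W \<in> \<sigma>. W \<subseteq> V}"] U by auto
      have "chi_Min \<chi> V \<in> V" using chi_Min_key(1)[OF VS(3,2)] .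
      then obtain W' where W': "W' \<in> \<rho>" "chi_Min \<chi> V \<in> W'" using \<rho>(2) by blast
      then have "W' = W" using BNC_disjoint[OF bnc _ W(1) _ W(2)] \<rho>(1) by blast
      then have WV: "W \<in> {W \<in> \<sigma>. W \<subseteq> V}" using W' \<rho> by blast
      have red: "ev (cum \<chi> F E) (cum \<chi> E E) \<chi> {W \<in> \<sigma>. W \<subseteq> V} Z =
          cum \<chi> F E W (outer_reduce L R E \<chi> W {W \<in> \<sigma>. W \<subseteq> V} Z) \<and>
        adm \<chi> W (outer_reduce L R E \<chi> W {W \<in> \<sigma>. W \<subseteq> V} Z)"
        by (rule ev_outer_reduce[OF is_local_cum bncV WV W(2,3)])
          (use chi_Min_key(2)[OF VS(3,2)] chi_Max_key(2)[OF VS(3,2)] adm_mono[OF less.prems(2) VS(1)] in auto)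
      note Wb = BNC_block[OF bnc W(1)]
      have "card W < card S"
        using psubset_card_mono[OF finS] BNC_psubset[OF bnc False W(1)] by blast
      then have "cumK L R E F \<chi> {W} (outer_reduce L R E \<chi> W {W \<in> \<sigma>. W \<subseteq> V} Z) =
          ev (cum \<chi> F E) (cum \<chi> E E) \<chi> {W} (outer_reduce L R E \<chi> W {W \<in> \<sigma>. W \<subseteq> V} Z)"
        using red False by (intro less.hyps[OF _ BNC_single[OF Wb(2,1)]]) (simp, blast)
      then show "(let V' = block_of \<sigma> (chi_Min \<chi> V)
         in cumK L R E F \<chi> {V'} (outer_reduce L R E \<chi> V' {W \<in> \<sigma>. W \<subseteq> V} Z)) =
        ev (cum \<chi> F E) (cum \<chi> E E) \<chi> {W \<in> \<sigma>. W \<subseteq> V} Z"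
        using red Wb by (simp add: blk ev_single)
    qed
    also have "\<dots> = ev (cum \<chi> F E) (cum \<chi> E E) \<chi> \<sigma> Z"
    proof (rule ev_prod_list[OF is_local_cum is_local_cum bnc _ part(1) un, symmetric])
      show "sorted_wrt (before \<chi>) Vs"
        using out unfolding is_outer_list_def before_def chi_less_key by blast
    qed
    finally show ?thesis .
  qed
qed

end

section \<open>Joins\<close>

text \<open>The join is the common refinement of all upper bounds: indices are related if every
  upper bound puts them into one block. A crossing of two classes would be one in each upper bound,
  whose blocks would then coincide, and so would the classes.\<close>

lemma bnc_join_exists:
  assumes "finite S" "S \<noteq> {}" "\<And>T. T \<in> \<sigma> \<union> \<zeta> \<Longrightarrow> T \<subseteq> S \<and> T \<noteq> {}"
  obtains \<tau> where "\<tau> \<in> BNC \<chi> S" "finer \<sigma> \<tau>" "finer \<zeta> \<tau>"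
    "\<forall>\<rho>\<in>BNC \<chi> S. finer \<sigma> \<rho> \<and> finer \<zeta> \<rho> \<longrightarrow> finer \<tau> \<rho>"
proof -
  define U where "U = {\<rho> \<in> BNC \<chi> S. finer \<sigma> \<rho> \<and> finer \<zeta> \<rho>}"
  define r where "r x y \<longleftrightarrow> (\<forall>\<rho>\<in>U. \<exists>W\<in>\<rho>. x \<in> W \<and> y \<in> W)" for x y
  define c where "c x = {y \<in> S. r x y}" for x
  have U: "\<rho> \<in> BNC \<chi> S" if "\<rho> \<in> U" for \<rho> using that by (simp add: U_def)
  have refl: "r x x" if "x \<in> S" for x
    unfolding r_def using that U BNC_obtain_block by metis
  have sym: "r y x" if "r x y" for x y
    using that unfolding r_def by blast
  have trans: "r x z" if xyz: "r x y" "r y z" for x y z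
    unfolding r_def
  proof
    fix \<rho> assume \<rho>: "\<rho> \<in> U"
    obtain W W' where W: "W \<in> \<rho>" "x \<in> W" "y \<in> W" "W' \<in> \<rho>" "y \<in> W'" "z \<in> W'"
      using xyz \<rho> unfolding r_def by blast
    then show "\<exists>W\<in>\<rho>. x \<in> W \<and> z \<in> W" using BNC_disjoint[OF U[OF \<rho>] W(1,4,3,5)] by blast
  qed
  have c_eq: "c x = c y" if "r x y" for x y
    unfolding c_def using that trans sym by blast
  have bnc: "c ` S \<in> BNC \<chi> S"
  proof (rule BNC_key_I[OF assms(1)])
    show "\<Union>(c ` S) = S" using refl by (auto simp: c_def)
    show "{} \<notin> c ` S" using refl by (auto simp: c_def)
    show "V = W" if "V \<in> c ` S" "W \<in> c ` S" "x \<in> V" "x \<in> W" for V W x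
      using that c_eq unfolding c_def by (smt (verit) image_iff mem_Collect_eq)
    fix V W a b c' d
    assume *: "V \<in> c ` S" "W \<in> c ` S" "a \<in> V" "b \<in> W" "c' \<in> V" "d \<in> W"
      "key \<chi> a < key \<chi> b" "key \<chi> b < key \<chi> c'" "key \<chi> c' < key \<chi> d"
    obtain x y where xy: "V = c x" "W = c y" using *(1,2) by blast
    then have r: "r x a" "r x c'" "r y b" "r y d" using *(3-6) by (auto simp: c_def)
    have "r a b"
      unfolding r_def
    proof
      fix \<rho> assume \<rho>: "\<rho> \<in> U"
      obtain W1 where W1: "W1 \<in> \<rho>" "a \<in> W1" "c' \<in> W1"
        using trans[OF sym[OF r(1)] r(2)] \<rho> unfolding r_def by blast
      obtain W2 where W2: "W2 \<in> \<rho>" "b \<in> W2" "d \<in> W2"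
        using trans[OF sym[OF r(3)] r(4)] \<rho> unfolding r_def by blast
      have "W1 = W2"
        using BNC_cross[OF U[OF \<rho>] W1(1) W2(1) W1(2) W2(2) W1(3) W2(3) *(7-9)] .
      then show "\<exists>W\<in>\<rho>. a \<in> W \<and> b \<in> W" using W1 W2 by blast
    qed
    then show "V = W"
      unfolding xy using c_eq[OF trans[OF trans[OF r(1)] sym[OF r(3)]]] by blast
  qed
  have fin: "finer \<theta> (c ` S)" if \<theta>: "\<theta> \<subseteq> \<sigma> \<union> \<zeta>" "\<And>\<rho>. \<rho> \<in> U \<Longrightarrow> finer \<theta> \<rho>" for \<theta>
    unfolding finer_def
  proof
    fix T assume T: "T \<in> \<theta>"
    then have TS: "T \<subseteq> S" "T \<noteq> {}" using assms(3) \<theta>(1) by blast+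
    then obtain x where x: "x \<in> T" by blast
    have "r x y" if y: "y \<in> T" for y
      unfolding r_def
    proof
      fix \<rho> assume "\<rho> \<in> U"
      then obtain W where "W \<in> \<rho>" "T \<subseteq> W" using \<theta>(2) T unfolding finer_def by blast
      then show "\<exists>W\<in>\<rho>. x \<in> W \<and> y \<in> W" using x y by blast
    qed
    then have "T \<subseteq> c x" using TS by (auto simp: c_def)
    then show "\<exists>W\<in>c ` S. T \<subseteq> W" using x TS by blast
  qed
  have least: "finer (c ` S) \<rho>" if \<rho>: "\<rho> \<in> U" for \<rho>
    unfolding finer_def
  proof
    fix V assume "V \<in> c ` S"
    then obtain x where x: "x \<in> S" "V = c x" by blast
    obtain W where W: "W \<in> \<rho>" "x \<in> W" using BNC_obtain_block[OF U[OF \<rho>] x(1)] .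
    have "y \<in> W" if y: "y \<in> c x" for y
    proof -
      obtain W' where W': "W' \<in> \<rho>" "x \<in> W'" "y \<in> W'"
        using y \<rho> unfolding c_def r_def by blast
      then show ?thesis using BNC_disjoint[OF U[OF \<rho>] W'(1) W(1) W'(2) W(2)] by simp
    qed
    then show "\<exists>W\<in>\<rho>. V \<subseteq> W" using W x(2) by blast
  qed
  show ?thesis
  proof (rule that[OF bnc])
    show "finer \<sigma> (c ` S)" "finer \<zeta> (c ` S)" by (rule fin; auto simp: U_def)+
    show "\<forall>\<rho>\<in>BNC \<chi> S. finer \<sigma> \<rho> \<and> finer \<zeta> \<rho> \<longrightarrow> finer (c ` S) \<rho>"
      using least by (simp add: U_def)
  qed
qed

lemma bnc_join_eq_one_iff:
  assumes "finite S" "S \<noteq> {}" "\<And>T. T \<in> \<sigma> \<union> \<zeta> \<Longrightarrow> T \<subseteq> S \<and> T \<noteq> {}"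
  shows "bnc_join \<chi> S \<sigma> \<zeta> = {S} \<longleftrightarrow> (\<forall>\<rho>\<in>BNC \<chi> S. finer \<sigma> \<rho> \<and> finer \<zeta> \<rho> \<longrightarrow> \<rho> = {S})"
proof -
  obtain \<tau> where \<tau>: "\<tau> \<in> BNC \<chi> S" "finer \<sigma> \<tau>" "finer \<zeta> \<tau>"
    "\<forall>\<rho>\<in>BNC \<chi> S. finer \<sigma> \<rho> \<and> finer \<zeta> \<rho> \<longrightarrow> finer \<tau> \<rho>"
    using bnc_join_exists[OF assms] .
  have join: "bnc_join \<chi> S \<sigma> \<zeta> = \<tau>"
    unfolding bnc_join_def
  proof (rule the_equality)
    fix \<tau>' assume "\<tau>' \<in> BNC \<chi> S \<and> finer \<sigma> \<tau>' \<and> finer \<zeta> \<tau>' \<and>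
      (\<forall>\<rho>\<in>BNC \<chi> S. finer \<sigma> \<rho> \<and> finer \<zeta> \<rho> \<longrightarrow> finer \<tau>' \<rho>)"
    then show "\<tau>' = \<tau>" using \<tau> by (intro finer_antisym[of _ \<chi> S]) blast+
  qed (use \<tau> in blast)
  have "\<rho> = {S}" if "\<rho> \<in> BNC \<chi> S" "finer {S} \<rho>" for \<rho>
    using that BNC_psubset[OF that(1)] by (auto simp: finer_def)
  then show ?thesis unfolding join using \<tau> by blast
qed

section \<open>Joins with the partition into groups\<close>

context grouping
begin

lemma BNC_hat_image:
  assumes "\<rho> \<in> BNC \<chi> P" "P \<subseteq> g ` N"
  shows "hat ` \<rho> \<in> BNC \<chi>' (hat P)"
proof (rule BNC_key_I[OF finite_hat])
  show "\<Union>(hat ` \<rho>) = hat P" using BNC_Union[OF assms(1)] by (auto simp: hat_def)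
  show "{} \<notin> hat ` \<rho>"
  proof
    assume "{} \<in> hat ` \<rho>"
    then obtain V where "V \<in> \<rho>" "hat V = {}" by (metis imageE)
    then show False
      using hat_nonempty[of V] BNC_block(1,3)[OF assms(1)] assms(2) by (meson order_trans)
  qed
  show "V = W" if VW: "V \<in> hat ` \<rho>" "W \<in> hat ` \<rho>" "x \<in> V" "x \<in> W" for V W x
  proof -
    obtain V' W' where V': "V' \<in> \<rho>" "V = hat V'" "W' \<in> \<rho>" "W = hat W'" using VW(1,2) by blast
    then have "V' = W'"
      using BNC_disjoint[OF assms(1) V'(1,3), of "g x"] VW(3,4) by (simp add: hat_def)
    then show ?thesis using V' by simp
  qed
  fix V W a b c d
  assume *: "V \<in> hat ` \<rho>" "W \<in> hat ` \<rho>" "a \<in> V" "b \<in> W" "c \<in> V" "d \<in> W"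
    "key \<chi>' a < key \<chi>' b" "key \<chi>' b < key \<chi>' c" "key \<chi>' c < key \<chi>' d"
  obtain V' W' where V': "V' \<in> \<rho>" "V = hat V'" "W' \<in> \<rho>" "W = hat W'" using *(1,2) by blast
  have N: "a \<in> N" "b \<in> N" "c \<in> N" "d \<in> N" "g a \<in> V'" "g b \<in> W'" "g c \<in> V'" "g d \<in> W'"
    using * V' by (auto simp: hat_def)
  show "V = W"
  proof (rule ccontr)
    assume "V \<noteq> W"
    then have neq: "g v \<noteq> g w" if "g v \<in> V'" "g w \<in> W'" for v w
      using BNC_disjoint[OF assms(1) V'(1,3)] V'(2,4) that by metis
    have lt: "key \<chi> (g x) < key \<chi> (g y)" if "key \<chi>' x < key \<chi>' y" "g x \<noteq> g y" "x \<in> N" "y \<in> N" for x y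
      using key_le[OF that(3,4)] that(1,2) by (auto simp: order_le_less)
    have "V' = W'"
      using BNC_cross[OF assms(1) V'(1,3) N(5-8) lt[OF *(7) neq[OF N(5,6)] N(1,2)]
          lt[OF *(8) neq[OF N(7,6), symmetric] N(2,3)] lt[OF *(9) neq[OF N(7,8)] N(3,4)]] .
    with \<open>V \<noteq> W\<close> V' show False by simp
  qed
qed

text \<open>A block of a partition coarser than the groups is a union of groups, hence recovered
  from its image under \<open>g\<close>.\<close>

lemma BNC_hat_preimage:
  assumes "\<tau> \<in> BNC \<chi>' (hat P)" "P \<subseteq> g ` N" "finer ((\<lambda>p. hat {p}) ` P) \<tau>"
  obtains \<rho> where "\<rho> \<in> BNC \<chi> P" "\<tau> = hat ` \<rho>"
proof -
  have hat_g: "hat (g ` T) = T" if T: "T \<in> \<tau>" for T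
  proof (intro equalityI subsetI)
    fix x assume "x \<in> hat (g ` T)"
    then obtain t where t: "t \<in> T" "g x = g t" "x \<in> N" by (auto simp: hat_def)
    have "t \<in> hat P" using BNC_block(3)[OF assms(1) T] t by blast
    then have "g t \<in> P" "t \<in> N" by (auto simp: hat_def)
    then obtain T' where T': "T' \<in> \<tau>" "hat {g t} \<subseteq> T'" using assms(3) unfolding finer_def by blast
    then have "x \<in> T'" "t \<in> T'" using t \<open>t \<in> N\<close> by (auto simp: hat_def)
    then show "x \<in> T" using BNC_disjoint[OF assms(1) T'(1) T _ t(1)] by blast
  next
    fix x assume "x \<in> T"
    then show "x \<in> hat (g ` T)" using BNC_block(3)[OF assms(1) T] by (auto simp: hat_def)
  qed
  have sub: "T \<subseteq> N" if "T \<in> \<tau>" for T using BNC_block(3)[OF assms(1) that] by (auto simp: hat_def)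
  have meet: "T = T'" if T: "T \<in> \<tau>" "T' \<in> \<tau>" "g x \<in> g ` T'" "x \<in> T" for T T' x
  proof -
    have "x \<in> hat (g ` T')" using T sub by (auto simp: hat_def)
    then show ?thesis using hat_g[OF T(2)] BNC_disjoint[OF assms(1) T(1,2,4)] by simp
  qed
  have "(\<lambda>T. g ` T) ` \<tau> \<in> BNC \<chi> P"
  proof (rule BNC_key_I)
    show "finite P" using assms(2) finite_N finite_surj by blast
    show "\<Union>((\<lambda>T. g ` T) ` \<tau>) = P"
    proof -
      have "\<Union>((\<lambda>T. g ` T) ` \<tau>) = g ` hat P" using BNC_Union[OF assms(1)] by blast
      also have "\<dots> = P" using assms(2) by (auto simp: hat_def)
      finally show ?thesis .
    qed
    show "{} \<notin> (\<lambda>T. g ` T) ` \<tau>" using BNC_block(1)[OF assms(1)] by blast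
    show "V = W" if "V \<in> (\<lambda>T. g ` T) ` \<tau>" "W \<in> (\<lambda>T. g ` T) ` \<tau>" "x \<in> V" "x \<in> W" for V W x
      using that meet by blast
    fix V W a b c d
    assume *: "V \<in> (\<lambda>T. g ` T) ` \<tau>" "W \<in> (\<lambda>T. g ` T) ` \<tau>" "a \<in> V" "b \<in> W" "c \<in> V" "d \<in> W"
      "key \<chi> a < key \<chi> b" "key \<chi> b < key \<chi> c" "key \<chi> c < key \<chi> d"
    obtain T T' where T: "T \<in> \<tau>" "V = g ` T" "T' \<in> \<tau>" "W = g ` T'" using *(1,2) by blast
    obtain a' b' c' d' where ab: "a' \<in> T" "a = g a'" "b' \<in> T'" "b = g b'" "c' \<in> T" "c = g c'" "d' \<in> T'" "d = g d'"
      using *(3-6) T(2,4) by blast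
    have N: "a' \<in> N" "b' \<in> N" "c' \<in> N" "d' \<in> N" using ab sub T by blast+
    have "T = T'"
      using BNC_cross[OF assms(1) T(1,3) ab(1,3,5,7)] key_less N *(7-9) ab(2,4,6,8) by simp
    then show "V = W" using T by simp
  qed
  moreover have "\<tau> = hat ` (\<lambda>T. g ` T) ` \<tau>" using hat_g by (force simp: image_image)
  ultimately show ?thesis by (rule that)
qed

text \<open>\<open>connecting\<close> quantifies over partitions of \<open>P\<close>. Through
  \<open>hat\<close> these correspond to the bi-non-crossing partitions of \<open>hat P\<close>
  coarser than the groups, the only ones that can bound the join from above.\<close>

lemma connecting_eq_join:
  assumes "P \<subseteq> g ` N" "P \<noteq> {}"
  shows "connecting P = {\<sigma> \<in> BNC \<chi>' (hat P). bnc_join \<chi>' (hat P) \<sigma> ((\<lambda>p. hat {p}) ` P) = {hat P}}"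
proof -
  have "bnc_join \<chi>' (hat P) \<sigma> ((\<lambda>p. hat {p}) ` P) = {hat P} \<longleftrightarrow>
      (\<forall>\<rho>\<in>BNC \<chi> P. (\<forall>T\<in>\<sigma>. \<exists>W\<in>\<rho>. T \<subseteq> hat W) \<longrightarrow> \<rho> = {P})" if \<sigma>: "\<sigma> \<in> BNC \<chi>' (hat P)" for \<sigma>
  proof -
    have blocks: "T \<subseteq> hat P \<and> T \<noteq> {}" if T: "T \<in> \<sigma> \<union> (\<lambda>p. hat {p}) ` P" for T
    proof (cases "T \<in> \<sigma>")
      case True
      then show ?thesis using BNC_block[OF \<sigma>] by simp
    next
      case False
      then obtain p where p: "p \<in> P" "T = hat {p}" using T by blast
      then show ?thesis using hat_nonempty[of "{p}"] hat_mono[of "{p}" P] assms(1) by auto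
    qed
    have finer_hat: "finer \<sigma> (hat ` \<rho>) \<longleftrightarrow> (\<forall>T\<in>\<sigma>. \<exists>W\<in>\<rho>. T \<subseteq> hat W)" for \<rho>
      by (auto simp: finer_def)
    have zero: "finer ((\<lambda>p. hat {p}) ` P) (hat ` \<rho>)" if \<rho>: "\<rho> \<in> BNC \<chi> P" for \<rho>
      unfolding finer_def
    proof
      fix T assume "T \<in> (\<lambda>p. hat {p}) ` P"
      then obtain p where p: "p \<in> P" "T = hat {p}" by blast
      obtain W where W: "W \<in> \<rho>" "p \<in> W" using BNC_obtain_block[OF \<rho> p(1)] .
      then show "\<exists>W\<in>hat ` \<rho>. T \<subseteq> W" using hat_mono[of "{p}" W] p(2) by blast
    qed
    have one: "hat ` \<rho> = {hat P} \<longleftrightarrow> \<rho> = {P}" if \<rho>: "\<rho> \<in> BNC \<chi> P" for \<rho>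
    proof
      assume *: "hat ` \<rho> = {hat P}"
      have "W = P" if W: "W \<in> \<rho>" for W
      proof -
        have "hat P \<subseteq> hat W" using * W by auto
        then have "P \<subseteq> W" using hat_subset_iff[OF assms(1)] by simp
        then show ?thesis using BNC_block(3)[OF \<rho> W] by blast
      qed
      moreover have "\<rho> \<noteq> {}" using * by auto
      ultimately show "\<rho> = {P}" by blast
    qed simp
    have join: "bnc_join \<chi>' (hat P) \<sigma> ((\<lambda>p. hat {p}) ` P) = {hat P} \<longleftrightarrow>
        (\<forall>\<rho>\<in>BNC \<chi>' (hat P). finer \<sigma> \<rho> \<and> finer ((\<lambda>p. hat {p}) ` P) \<rho> \<longrightarrow> \<rho> = {hat P})"
      by (rule bnc_join_eq_one_iff[OF finite_hat hat_nonempty[OF assms] blocks])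
    show ?thesis
      unfolding join
    proof
      assume *: "\<forall>\<rho>\<in>BNC \<chi>' (hat P). finer \<sigma> \<rho> \<and> finer ((\<lambda>p. hat {p}) ` P) \<rho> \<longrightarrow> \<rho> = {hat P}"
      show "\<forall>\<rho>\<in>BNC \<chi> P. (\<forall>T\<in>\<sigma>. \<exists>W\<in>\<rho>. T \<subseteq> hat W) \<longrightarrow> \<rho> = {P}"
      proof (intro ballI impI)
        fix \<rho> assume \<rho>: "\<rho> \<in> BNC \<chi> P" "\<forall>T\<in>\<sigma>. \<exists>W\<in>\<rho>. T \<subseteq> hat W"
        have "hat ` \<rho> = {hat P}"
          using * BNC_hat_image[OF \<rho>(1) assms(1)] zero[OF \<rho>(1)] \<rho>(2) unfolding finer_hat[symmetric] by blast
        then show "\<rho> = {P}" using one[OF \<rho>(1)] by simp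
      qed
    next
      assume *: "\<forall>\<rho>\<in>BNC \<chi> P. (\<forall>T\<in>\<sigma>. \<exists>W\<in>\<rho>. T \<subseteq> hat W) \<longrightarrow> \<rho> = {P}"
      show "\<forall>\<rho>\<in>BNC \<chi>' (hat P). finer \<sigma> \<rho> \<and> finer ((\<lambda>p. hat {p}) ` P) \<rho> \<longrightarrow> \<rho> = {hat P}"
      proof (intro ballI impI)
        fix \<tau> assume \<tau>: "\<tau> \<in> BNC \<chi>' (hat P)" "finer \<sigma> \<tau> \<and> finer ((\<lambda>p. hat {p}) ` P) \<tau>"
        obtain \<rho> where \<rho>: "\<rho> \<in> BNC \<chi> P" "\<tau> = hat ` \<rho>"
          using BNC_hat_preimage[OF \<tau>(1) assms(1)] \<tau>(2) by blast
        have "\<forall>T\<in>\<sigma>. \<exists>W\<in>\<rho>. T \<subseteq> hat W" using \<tau>(2) \<rho>(2) finer_hat by simp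
        then have "\<rho> = {P}" using * \<rho>(1) by blast
        then show "\<tau> = {hat P}" using \<rho>(2) by simp
      qed
    qed
  qed
  then show ?thesis unfolding connecting_def by (intro Collect_cong) auto
qed

end


section \<open>The product formula\<close>

text \<open>\<open>Lop\<close> and \<open>Rop\<close> are values of \<open>\<epsilon>\<close> at
  tensors with one factor 1. Each rule for them is the homomorphism property applied to such
  tensors, with additivity coming from the bilinearity relations.\<close>

lemma (in cbf_space) bifree_space: "bifree_space (Lop sD B \<epsilon>) (Rop sD B \<epsilon>) B E"
proof -
  note alg = D.complex_algebra_axioms
  have B: "1 \<in> B" "module.subspace sD B" "\<And>x y. x \<in> B \<Longrightarrow> y \<in> B \<Longrightarrow> x * y \<in> B"
    using B_subalgebra by (auto simp: unital_subalgebra_def)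
  have free: "symb b c \<in> tensor_free B" if "b \<in> B" "c \<in> B" for b c
    using that by (auto simp: tensor_free_def)
  have hom: "\<epsilon> (tcls sD B (p + q)) = \<epsilon> (tcls sD B p) + \<epsilon> (tcls sD B q)"
    "\<epsilon> (tcls sD B (p * q)) = \<epsilon> (tcls sD B p) * \<epsilon> (tcls sD B q)"
    if "p \<in> tensor_free B" "q \<in> tensor_free B" for p q
    using \<epsilon>_hom that unfolding tensor_unital_hom_def by blast+
  have one: "\<epsilon> (tcls sD B (symb 1 1)) = 1"
    using \<epsilon>_hom unfolding tensor_unital_hom_def
    by (simp flip: zero_op_pair_def add: single_one)
  have mult: "symb a b * symb c d = symb (a * c) (d * b)" for a b c d :: 'd
    by (simp add: mult_single)
  have eq: "tcls sD B p = tcls sD B q" if "p - q \<in> tensor_null sD B" for p q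
    using tcls_eq_iff[OF alg B_subalgebra] that by blast
  interpret E: module_hom sA sD E
    using E_linear unfolding Vector_Spaces.linear_def by blast
  show ?thesis
  proof unfold_locales
    show "0 \<in> B" "1 \<in> B" using D.subspace_0[OF B(2)] B(1) .
    show "b + c \<in> B" "b - c \<in> B" "b * c \<in> B" if "b \<in> B" "c \<in> B" for b c
      using that B(3) D.subspace_add[OF B(2)] D.subspace_diff[OF B(2)] by auto
    show "Lop sD B \<epsilon> 1 = 1" "Rop sD B \<epsilon> 1 = 1" by (simp_all add: Lop_def Rop_def tens_def one)
    fix b c assume bc: "b \<in> B" "c \<in> B"
    show "Lop sD B \<epsilon> (b + c) = Lop sD B \<epsilon> b + Lop sD B \<epsilon> c"
      using hom(1)[OF free free, of b 1 c 1] eq[OF tensor_null.add_left[of b B c 1 sD]] bc B(1)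
      by (simp add: Lop_def tens_def)
    show "Rop sD B \<epsilon> (b + c) = Rop sD B \<epsilon> b + Rop sD B \<epsilon> c"
      using hom(1)[OF free free, of 1 b 1 c] eq[OF tensor_null.add_right[of b B c 1 sD]] bc B(1)
      by (simp add: Rop_def tens_def)
    show "Lop sD B \<epsilon> (b * c) = Lop sD B \<epsilon> b * Lop sD B \<epsilon> c"
      using hom(2)[OF free free, of b 1 c 1] bc B(1) by (simp add: Lop_def tens_def mult)
    show "Rop sD B \<epsilon> (b * c) = Rop sD B \<epsilon> c * Rop sD B \<epsilon> b"
      using hom(2)[OF free free, of 1 c 1 b] bc B(1) by (simp add: Rop_def tens_def mult)
    show "Lop sD B \<epsilon> b * Rop sD B \<epsilon> c = Rop sD B \<epsilon> c * Lop sD B \<epsilon> b"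
      using hom(2)[OF free free, of b 1 1 c] hom(2)[OF free free, of 1 c b 1] bc B(1)
      by (simp add: Lop_def Rop_def tens_def mult)
  next
    show "E (x + y) = E x + E y" for x y by (rule E.add)
    show "E x \<in> B" for x using E_range by blast
  qed (fact E_unital E_bimodule E_left_right)+
qed

theorem theorem7p4:
  fixes sA :: "complex \<Rightarrow> 'a::ring_1 \<Rightarrow> 'a"
    and sD :: "complex \<Rightarrow> 'd::ring_1 \<Rightarrow> 'd"
    and B :: "'d set"
    and \<epsilon> :: "'d tensor_rep set \<Rightarrow> 'a"
    and E F :: "'a \<Rightarrow> 'd"
    and m n :: nat
    and k :: "nat \<Rightarrow> nat"
    and \<chi> :: "nat \<Rightarrow> side"
    and Z :: "nat \<Rightarrow> 'a"
  assumes "cbf_space sA sD B \<epsilon> E F"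
    and "1 \<le> m" and "1 \<le> n" and "m < n"
    and "k 0 = 0" and "\<forall>p<m. k p < k (p + 1)" and "k m = n"
    and "\<forall>q\<in>{1..n}. Z q \<in> face (Lop sD B \<epsilon>) (Rop sD B \<epsilon>) B (hat_chi k m \<chi> q)"
  shows "cumK (Lop sD B \<epsilon>) (Rop sD B \<epsilon>) E F \<chi> {{1..m}} (\<lambda>p. oprod Z {k (p - 1) + 1..k p}) =
    (\<Sum>\<sigma> \<in> {\<sigma> \<in> BNC (hat_chi k m \<chi>) {1..n}.
            bnc_join (hat_chi k m \<chi>) {1..n} \<sigma> (hat_zero k m) = {{1..n}}}.
      cumK (Lop sD B \<epsilon>) (Rop sD B \<epsilon>) E F (hat_chi k m \<chi>) \<sigma> Z)"
proof -
  interpret S: cbf_space sA sD B \<epsilon> E F by fact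
  let ?L = "Lop sD B \<epsilon>" and ?R = "Rop sD B \<epsilon>" and ?\<chi> = "hat_chi k m \<chi>"
  interpret bifree_space ?L ?R B E by (rule S.bifree_space)
  \<comment> \<open>The map from \<open>q\<close> to its group \<open>p_q\<close>, described as in
    \<open>hat_chi\<close>, so that the latter is \<open>\<chi>\<close> composed with
    \<open>g\<close> by definition.\<close>
  define g where "g q = (THE p. p \<in> {1..m} \<and> k (p - 1) < q \<and> q \<le> k p)" for q
  have k_mono: "k i \<le> k j" if "i \<le> j" "j \<le> m" for i j
    using that
  proof (induction j rule: dec_induct)
    case (step j)
    then show ?case using assms(6) by (metis Suc_eq_plus1 Suc_le_lessD less_imp_le order_trans)
  qed simp
  have g_eq: "g q = p" if "p \<in> {1..m}" "k (p - 1) < q" "q \<le> k p" for p q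
    unfolding g_def
  proof (rule the_equality)
    fix p' assume p': "p' \<in> {1..m} \<and> k (p' - 1) < q \<and> q \<le> k p'"
    have "\<not> p' \<le> p - 1" using k_mono[of p' "p - 1"] that p' by force
    moreover have "\<not> p \<le> p' - 1" using k_mono[of p "p' - 1"] that p' by force
    ultimately show "p' = p" using that(1) p' by auto
  qed (use that in blast)
  have g_ex: "\<exists>p\<in>{1..m}. k (p - 1) < q \<and> q \<le> k p" if "q \<in> {1..n}" for q
  proof -
    define p where "p = (LEAST p. q \<le> k p)"
    have q: "q \<le> k p" unfolding p_def by (rule LeastI[of _ m]) (use that assms(7) in simp)
    have "p \<le> m" unfolding p_def by (rule Least_le) (use that assms(7) in simp)
    moreover have "p \<noteq> 0" using q that assms(5) by (cases p) auto
    moreover have "\<not> q \<le> k (p - 1)"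
      using not_less_Least[of "p - 1" "\<lambda>p. q \<le> k p"] \<open>p \<noteq> 0\<close> by (simp add: p_def)
    ultimately show ?thesis using q by (intro bexI[of _ p]) auto
  qed
  have g: "g q \<in> {1..m} \<and> k (g q - 1) < q \<and> q \<le> k (g q)" if "q \<in> {1..n}" for q
    using g_ex[OF that] g_eq by metis
  interpret grouping ?L ?R B \<chi> ?\<chi> g "{1..n}"
  proof unfold_locales
    show "?\<chi> q = \<chi> (g q)" for q by (simp add: hat_chi_def g_def)
    show "g q \<le> g q'" if "q \<in> {1..n}" "q' \<in> {1..n}" "q \<le> q'" for q q'
    proof (rule ccontr)
      assume "\<not> g q \<le> g q'"
      then show False using k_mono[of "g q'" "g q - 1"] g[OF that(1)] g[OF that(2)] that(3) by force
    qed
  qed simp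
  have in_hat: "q \<in> hat V \<longleftrightarrow> q \<in> {1..n} \<and> g q \<in> V" for q V
    by (simp only: hat_def mem_Collect_eq)
  have hat1: "hat {p} = {k (p - 1) + 1..k p}" if p: "p \<in> {1..m}" for p
  proof (intro equalityI subsetI)
    fix q assume "q \<in> hat {p}"
    then show "q \<in> {k (p - 1) + 1..k p}" using g[of q] unfolding in_hat by auto
  next
    fix q assume q: "q \<in> {k (p - 1) + 1..k p}"
    then have "q \<le> n" using k_mono[of p m] p assms(7) by force
    then show "q \<in> hat {p}" using g_eq[OF p, of q] q unfolding in_hat by auto
  qed
  have P: "{1..m} \<subseteq> g ` {1..n}"
  proof
    fix p assume p: "p \<in> {1..m}"
    have "k (p - 1) < k p" using assms(6)[rule_format, of "p - 1"] p by (cases p) auto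
    then have "k p \<in> hat {p}" unfolding hat1[OF p] by simp
    then show "p \<in> g ` {1..n}" unfolding in_hat by (metis imageI singletonD)
  qed
  have hatP: "hat {1..m} = {1..n}" using g unfolding set_eq_iff in_hat by blast
  have zero: "hat_zero k m = (\<lambda>p. hat {p}) ` {1..m}"
    unfolding hat_zero_def using hat1 by (intro image_cong) auto
  have adm: "adm ?\<chi> (hat {1..m}) Z" using assms(8) unfolding hatP adm_def by blast
  have eq: "oprod Z {k (p - 1) + 1..k p} = group_prod Z p" if "p \<in> {1..m}" for p
    by (simp only: group_prod_def hat1[OF that])
  have ne: "{1..m} \<noteq> {}" using assms(2) by simp
  interpret F: module_hom sA sD F
    using S.F_linear unfolding Vector_Spaces.linear_def by blast
  have adm': "adm \<chi> {1..m} (\<lambda>p. oprod Z {k (p - 1) + 1..k p})"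
    using adm_group_prod[OF adm] eq by (simp add: adm_def)
  have "cumK ?L ?R E F \<chi> {{1..m}} (\<lambda>p. oprod Z {k (p - 1) + 1..k p}) =
      cum \<chi> F E {1..m} (\<lambda>p. oprod Z {k (p - 1) + 1..k p})"
    by (subst cumK_eq_ev[OF BNC_single adm']) (use ne in \<open>simp_all add: ev_single\<close>)
  also have "\<dots> = cum \<chi> F E {1..m} (group_prod Z)"
    by (rule is_localD[OF is_local_cum]) (rule eq)
  also have "\<dots> = (\<Sum>\<sigma>\<in>connecting {1..m}. ev (cum ?\<chi> F E) (cum ?\<chi> E E) ?\<chi> \<sigma> Z)"
    by (rule cum_group_prod[OF F.add E_add is_inner_mom P ne adm])
  also have "\<dots> = (\<Sum>\<sigma>\<in>connecting {1..m}. cumK ?L ?R E F ?\<chi> \<sigma> Z)"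
    by (rule sum.cong[OF refl], rule cumK_eq_ev[symmetric, OF _ adm]) (use connecting_def in blast)
  finally show ?thesis
    unfolding connecting_eq_join[OF P ne] hatP zero .
qed

end
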